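(* Let $n\ge 2$, $E\in\mathrm{GL}_n(\mathbb C)$, and suppose that the asymmetry $F=E^tE^{-1}$ is generic. Then $\mathcal H(F)\cong\mathcal B(E)\mathbin{\tilde *}\mathbb C\mathbb Z_2$ as Hopf algebras.
   Context: All vector spaces and algebras are over $\mathbb C$; $t$ denotes the transpose. For $E\in \mathrm{GL}_n(\mathbb C)$, $n\ge2$, $\mathcal B(E)$ is the universal unital algebra generated by the entries of $x=(x_{ij})_{i,j=1}^n$ subject to $E^{-1}x^tEx=I=xE^{-1}x^tE$; it is a Hopf algebra with $\Delta(x_{ij})=\sum_kx_{ik}\otimes x_{kj}$, $\varepsilon(x_{ij})=\delta_{ij}$, $S(x)=E^{-1}x^tE$. For $F\in\mathrm{GL}_n(\mathbb C)$, $\mathcal H(F)$ is the universal unital algebra generated by the entries of $u=(u_{ij})_{i,j=1}^n$ and $v=(v_{ij})_{i,j=1}^n$ subject to $uv^t=v^tu=I$, $vFu^tF^{-1}=Fu^tF^{-1}v=I$; it is a Hopf algebra with $\Delta(u_{ij})=\sum_k u_{ik}\otimes u_{kj}$, $\Delta(v_{ij})=\sum_k v_{ik}\otimes v_{kj}$, $\varepsilon(u_{ij})=\varepsilon(v_{ij})=\delta_{ij}$, $S(u)=v^t$, $S(v)=Fu^tF^{-1}$. $F$ is called normalizable if either $\mathrm{tr}(F)\ne0$ and $\mathrm{tr}(F^{-1})\neq 0$, or $\mathrm{tr}(F)=0=\mathrm{tr}(F^{-1})$. $F$ is called generic if it is normalizable and the solutions $q$ of $q^2-\sqrt{\mathrm{tr}(F)\mathrm{tr}(F^{-1})}\,q+1=0$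 are not roots of unity of order $\ge 3$. $\mathbb C\mathbb Z_2$ is the group Hopf algebra with generator $g$, $g^2=1$, $\Delta(g)=g\otimes g$. The free product $\mathcal B(E)*\mathbb C\mathbb Z_2$ of unital algebras carries the Hopf algebra structure extending those of the factors. The glued free product $\mathcal B(E)\mathbin{\tilde*}\mathbb C\mathbb Z_2$ is the Hopf subalgebra of $\mathcal B(E)*\mathbb C\mathbb Z_2$ generated (as a Hopf algebra) by the elements $x_{ij}g$, $1\le i,j\le n$. *)

theory Defs
  imports
    "HOL-Analysis.Determinants"
    "HOL-Algebra.Module"
    "HOL-Algebra.QuotRing"
    "HOL-Algebra.Subrings"
    "HOL-Algebra.Elementary_Groups"
    "HOL-Library.Poly_Mapping"
begin

section \<open>Complex algebras\<close>

text \<open>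
  Complex algebras are records of type \<open>(complex, 'a) module\<close> (or extensions of it).
  The locale \<open>algebra\<close> of HOL-Algebra is restricted to commutative algebras, so the
  noncommutative notion is introduced here.
\<close>

definition complex_alg :: "(complex, complex) module" where
  "complex_alg = \<lparr>carrier = UNIV, mult = (*), one = 1, zero = 0, add = (+), smult = (*)\<rparr>"

definition calgebra :: "(complex, 'a, 'm) module_scheme \<Rightarrow> bool" where
  "calgebra A \<longleftrightarrow> Ring.ring A \<and> Module.module complex_alg A \<and>
     (\<forall>c. \<forall>x\<in>carrier A. \<forall>y\<in>carrier A.
        (c \<odot>\<^bsub>A\<^esub> x) \<otimes>\<^bsub>A\<^esub> y = c \<odot>\<^bsub>A\<^esub> (x \<otimes>\<^bsub>A\<^esub> y) \<and>
        x \<otimes>\<^bsub>A\<^esub> (c \<odot>\<^bsub>A\<^esub> y) = c \<odot>\<^bsub>A\<^esub> (x \<otimes>\<^bsub>A\<^esub> y))"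

definition calg_hom ::
  "(complex, 'a, 'm) module_scheme \<Rightarrow> (complex, 'b, 'k) module_scheme \<Rightarrow> ('a \<Rightarrow> 'b) set" where
  "calg_hom A B = {f \<in> ring_hom A B. \<forall>c. \<forall>x\<in>carrier A. f (c \<odot>\<^bsub>A\<^esub> x) = c \<odot>\<^bsub>B\<^esub> f x}"

definition clin_hom ::
  "(complex, 'a, 'm) module_scheme \<Rightarrow> (complex, 'b, 'k) module_scheme \<Rightarrow> ('a \<Rightarrow> 'b) set" where
  "clin_hom A B = {f \<in> carrier A \<rightarrow> carrier B.
     (\<forall>x\<in>carrier A. \<forall>y\<in>carrier A. f (x \<oplus>\<^bsub>A\<^esub> y) = f x \<oplus>\<^bsub>B\<^esub> f y) \<and>
     (\<forall>c. \<forall>x\<in>carrier A. f (c \<odot>\<^bsub>A\<^esub> x) = c \<odot>\<^bsub>B\<^esub> f x)}"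

definition opposite_alg :: "(complex, 'a, 'm) module_scheme \<Rightarrow> (complex, 'a, 'm) module_scheme" where
  "opposite_alg A = A\<lparr>mult := \<lambda>x y. y \<otimes>\<^bsub>A\<^esub> x\<rparr>"

text \<open>
  Quotient by a two-sided ideal: the library's quotient ring, with the induced scalar
  multiplication.
\<close>

definition quot_alg :: "(complex, 'a, 'm) module_scheme \<Rightarrow> 'a set \<Rightarrow> (complex, 'a set) module" where
  "quot_alg A I = \<lparr>carrier = carrier (A Quot I), mult = mult (A Quot I), one = one (A Quot I),
     zero = zero (A Quot I), add = add (A Quot I),
     smult = \<lambda>c X. \<Union>x\<in>X. I +>\<^bsub>A\<^esub> (c \<odot>\<^bsub>A\<^esub> x)\<rparr>"

text \<open>
  The monoid algebra of \<open>G\<close>: finitely supported functions on the carrier of \<open>G\<close>, with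
  convolution.  As a vector space it is the free vector space on the carrier of \<open>G\<close>.
\<close>

definition monoid_alg :: "('g, 'm) monoid_scheme \<Rightarrow> (complex, 'g \<Rightarrow>\<^sub>0 complex) module" where
  "monoid_alg G = \<lparr>carrier = {p. Poly_Mapping.keys p \<subseteq> carrier G},
     mult = (\<lambda>p q. \<Sum>g\<in>Poly_Mapping.keys p. \<Sum>h\<in>Poly_Mapping.keys q.
       Poly_Mapping.single (g \<otimes>\<^bsub>G\<^esub> h) (Poly_Mapping.lookup p g * Poly_Mapping.lookup q h)),
     one = Poly_Mapping.single \<one>\<^bsub>G\<^esub> 1, zero = 0, add = (+),
     smult = (\<lambda>c. Poly_Mapping.map ((*) c))\<rparr>"

definition lin_ext :: "(complex, 'a, 'm) module_scheme \<Rightarrow> ('g \<Rightarrow> 'a) \<Rightarrow> ('g \<Rightarrow>\<^sub>0 complex) \<Rightarrow> 'a" where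
  "lin_ext M f p = finsum M (\<lambda>g. Poly_Mapping.lookup p g \<odot>\<^bsub>M\<^esub> f g) (Poly_Mapping.keys p)"

definition free_monoid :: "'g set \<Rightarrow> 'g list monoid" where
  "free_monoid X = \<lparr>carrier = lists X, mult = (@), one = []\<rparr>"

abbreviation free_alg :: "'g set \<Rightarrow> (complex, 'g list \<Rightarrow>\<^sub>0 complex) module" where
  "free_alg X \<equiv> monoid_alg (free_monoid X)"

abbreviation free_gen :: "'g \<Rightarrow> ('g list \<Rightarrow>\<^sub>0 complex)" where
  "free_gen g \<equiv> Poly_Mapping.single [g] 1"

definition free_eval :: "(complex, 'a, 'm) module_scheme \<Rightarrow> ('g \<Rightarrow> 'a) \<Rightarrow> ('g list \<Rightarrow>\<^sub>0 complex) \<Rightarrow> 'a" where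
  "free_eval A f = lin_ext A (\<lambda>w. foldr (\<lambda>g a. f g \<otimes>\<^bsub>A\<^esub> a) w \<one>\<^bsub>A\<^esub>)"

text \<open>The universal unital algebra on generators \<open>X\<close> in which the elements of \<open>R\<close> vanish.\<close>

definition present_alg :: "'g set \<Rightarrow> ('g list \<Rightarrow>\<^sub>0 complex) set \<Rightarrow>
    (complex, ('g list \<Rightarrow>\<^sub>0 complex) set) module" where
  "present_alg X R = quot_alg (free_alg X) (Idl\<^bsub>free_alg X\<^esub> R)"

definition present_gen :: "'g set \<Rightarrow> ('g list \<Rightarrow>\<^sub>0 complex) set \<Rightarrow> 'g \<Rightarrow> ('g list \<Rightarrow>\<^sub>0 complex) set" where
  "present_gen X R g = (Idl\<^bsub>free_alg X\<^esub> R) +>\<^bsub>free_alg X\<^esub> free_gen g"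


section \<open>Tensor products\<close>

text \<open>
  \<open>A \<otimes> B\<close> is the free vector space on \<open>A \<times> B\<close> modulo the linear span of the bilinearity
  relations.  The free vector space is the monoid algebra of the product of the
  multiplicative monoids, so the quotient carries the product
  \<open>(a \<otimes> b) (a' \<otimes> b') = a a' \<otimes> b b'\<close>.
\<close>

definition bilin_rels :: "(complex, 'a, 'm) module_scheme \<Rightarrow> (complex, 'b, 'k) module_scheme \<Rightarrow>
    ('a \<times> 'b \<Rightarrow>\<^sub>0 complex) set" where
  "bilin_rels A B =
     {Poly_Mapping.single (a \<oplus>\<^bsub>A\<^esub> a', b) 1 - Poly_Mapping.single (a, b) 1 - Poly_Mapping.single (a', b) 1
       | a a' b. a \<in> carrier A \<and> a' \<in> carrier A \<and> b \<in> carrier B} \<union>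
     {Poly_Mapping.single (a, b \<oplus>\<^bsub>B\<^esub> b') 1 - Poly_Mapping.single (a, b) 1 - Poly_Mapping.single (a, b') 1
       | a b b'. a \<in> carrier A \<and> b \<in> carrier B \<and> b' \<in> carrier B} \<union>
     {Poly_Mapping.single (c \<odot>\<^bsub>A\<^esub> a, b) 1 - Poly_Mapping.single (a, b) c
       | c a b. a \<in> carrier A \<and> b \<in> carrier B} \<union>
     {Poly_Mapping.single (a, c \<odot>\<^bsub>B\<^esub> b) 1 - Poly_Mapping.single (a, b) c
       | c a b. a \<in> carrier A \<and> b \<in> carrier B}"

definition bilin_span :: "(complex, 'a, 'm) module_scheme \<Rightarrow> (complex, 'b, 'k) module_scheme \<Rightarrow>
    ('a \<times> 'b \<Rightarrow>\<^sub>0 complex) set" where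
  "bilin_span A B = \<Inter>{N. submodule N complex_alg (monoid_alg (A \<times>\<times> B)) \<and> bilin_rels A B \<subseteq> N}"

definition tensor :: "(complex, 'a, 'm) module_scheme \<Rightarrow> (complex, 'b, 'k) module_scheme \<Rightarrow>
    (complex, ('a \<times> 'b \<Rightarrow>\<^sub>0 complex) set) module" where
  "tensor A B = quot_alg (monoid_alg (A \<times>\<times> B)) (bilin_span A B)"

definition pure_tensor :: "(complex, 'a, 'm) module_scheme \<Rightarrow> (complex, 'b, 'k) module_scheme \<Rightarrow>
    'a \<Rightarrow> 'b \<Rightarrow> ('a \<times> 'b \<Rightarrow>\<^sub>0 complex) set" where
  "pure_tensor A B a b = bilin_span A B +>\<^bsub>monoid_alg (A \<times>\<times> B)\<^esub> Poly_Mapping.single (a, b) 1"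

text \<open>The linear map with values in \<open>C\<close> induced on a tensor product by a bilinear map \<open>\<beta>\<close>.\<close>

definition tensor_lift :: "(complex, 'c, 'm) module_scheme \<Rightarrow> ('a \<Rightarrow> 'b \<Rightarrow> 'c) \<Rightarrow>
    ('a \<times> 'b \<Rightarrow>\<^sub>0 complex) set \<Rightarrow> 'c" where
  "tensor_lift C \<beta> T = the_elem (lin_ext C (\<lambda>(a, b). \<beta> a b) ` T)"

definition tensor_map :: "(complex, 'c, 'm) module_scheme \<Rightarrow> (complex, 'd, 'k) module_scheme \<Rightarrow>
    ('a \<Rightarrow> 'c) \<Rightarrow> ('b \<Rightarrow> 'd) \<Rightarrow> ('a \<times> 'b \<Rightarrow>\<^sub>0 complex) set \<Rightarrow> ('c \<times> 'd \<Rightarrow>\<^sub>0 complex) set" where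
  "tensor_map C D f g = tensor_lift (tensor C D) (\<lambda>a b. pure_tensor C D (f a) (g b))"

definition tensor_assoc :: "(complex, 'a, 'm) module_scheme \<Rightarrow> (complex, 'b, 'k) module_scheme \<Rightarrow>
    (complex, 'c, 'l) module_scheme \<Rightarrow>
    (('a \<times> 'b \<Rightarrow>\<^sub>0 complex) set \<times> 'c \<Rightarrow>\<^sub>0 complex) set \<Rightarrow>
    ('a \<times> ('b \<times> 'c \<Rightarrow>\<^sub>0 complex) set \<Rightarrow>\<^sub>0 complex) set" where
  "tensor_assoc A B C =
     tensor_lift (tensor A (tensor B C)) (\<lambda>t c.
       tensor_lift (tensor A (tensor B C)) (\<lambda>a b.
         pure_tensor A (tensor B C) a (pure_tensor B C b c)) t)"


section \<open>Hopf algebras\<close>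

record 'a hopf = "(complex, 'a) module" +
  comult :: "'a \<Rightarrow> ('a \<times> 'a \<Rightarrow>\<^sub>0 complex) set"
  counit :: "'a \<Rightarrow> complex"
  antipode :: "'a \<Rightarrow> 'a"

definition hopf_algebra :: "'a hopf \<Rightarrow> bool" where
  "hopf_algebra A \<longleftrightarrow>
     calgebra A \<and>
     comult A \<in> calg_hom A (tensor A A) \<and>
     counit A \<in> calg_hom A complex_alg \<and>
     antipode A \<in> clin_hom A A \<and>
     (\<forall>a\<in>carrier A.
        tensor_assoc A A A (tensor_map (tensor A A) A (comult A) (\<lambda>x. x) (comult A a)) =
          tensor_map A (tensor A A) (\<lambda>x. x) (comult A) (comult A a) \<and>
        tensor_lift A (\<lambda>x y. counit A x \<odot>\<^bsub>A\<^esub> y) (comult A a) = a \<and>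
        tensor_lift A (\<lambda>x y. counit A y \<odot>\<^bsub>A\<^esub> x) (comult A a) = a \<and>
        tensor_lift A (\<lambda>x y. antipode A x \<otimes>\<^bsub>A\<^esub> y) (comult A a) = counit A a \<odot>\<^bsub>A\<^esub> \<one>\<^bsub>A\<^esub> \<and>
        tensor_lift A (\<lambda>x y. x \<otimes>\<^bsub>A\<^esub> antipode A y) (comult A a) = counit A a \<odot>\<^bsub>A\<^esub> \<one>\<^bsub>A\<^esub>)"

definition hopf_hom :: "'a hopf \<Rightarrow> 'b hopf \<Rightarrow> ('a \<Rightarrow> 'b) set" where
  "hopf_hom A B = {f \<in> calg_hom A B. \<forall>a\<in>carrier A.
     comult B (f a) = tensor_map B B f f (comult A a) \<and>
     counit B (f a) = counit A a \<and>
     antipode B (f a) = f (antipode A a)}"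

definition hopf_isomorphic :: "'a hopf \<Rightarrow> 'b hopf \<Rightarrow> bool" where
  "hopf_isomorphic A B \<longleftrightarrow> hopf_algebra A \<and> hopf_algebra B \<and>
     (\<exists>f\<in>hopf_hom A B. bij_betw f (carrier A) (carrier B))"

text \<open>
  A Hopf subalgebra \<open>H\<close> of \<open>A\<close> is a unital subalgebra stable under the antipode with
  \<open>\<Delta>(H) \<subseteq> H \<otimes> H\<close>.  Since \<open>H \<otimes> H\<close> is a quotient in its own right, the latter means that
  \<open>\<Delta>(h)\<close> lies in the image of the map \<open>H \<otimes> H \<rightarrow> A \<otimes> A\<close> induced by the inclusion, and the
  comultiplication of \<open>H\<close> is obtained by inverting this (injective) map.
\<close>

definition sub_tensor_incl :: "'a hopf \<Rightarrow> ('a \<times> 'a \<Rightarrow>\<^sub>0 complex) set \<Rightarrow> ('a \<times> 'a \<Rightarrow>\<^sub>0 complex) set" where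
  "sub_tensor_incl A = tensor_map A A (\<lambda>x. x) (\<lambda>x. x)"

definition hopf_subalgebra :: "'a set \<Rightarrow> 'a hopf \<Rightarrow> bool" where
  "hopf_subalgebra H A \<longleftrightarrow>
     subring H A \<and>
     (\<forall>c. \<forall>h\<in>H. c \<odot>\<^bsub>A\<^esub> h \<in> H) \<and>
     (\<forall>h\<in>H. antipode A h \<in> H) \<and>
     (\<forall>h\<in>H. comult A h \<in>
        sub_tensor_incl A ` carrier (tensor (A\<lparr>carrier := H\<rparr>) (A\<lparr>carrier := H\<rparr>)))"

definition sub_hopf :: "'a hopf \<Rightarrow> 'a set \<Rightarrow> 'a hopf" where
  "sub_hopf A H = A\<lparr>carrier := H,
     comult := \<lambda>h. THE t. t \<in> carrier (tensor (A\<lparr>carrier := H\<rparr>) (A\<lparr>carrier := H\<rparr>)) \<and>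
       sub_tensor_incl A t = comult A h\<rparr>"

definition hopf_generated :: "'a hopf \<Rightarrow> 'a set \<Rightarrow> 'a set" where
  "hopf_generated A S = \<Inter>{H. hopf_subalgebra H A \<and> S \<subseteq> H}"

text \<open>
  The Hopf algebra on \<open>present_alg X R\<close> whose comultiplication and counit are the algebra
  homomorphisms, and whose antipode is the algebra antihomomorphism, with the prescribed
  values \<open>\<delta>\<close>, \<open>\<epsilon>\<close>, \<open>s\<close> on the generators.
\<close>

definition present_hopf :: "'g set \<Rightarrow> ('g list \<Rightarrow>\<^sub>0 complex) set \<Rightarrow>
    ('g \<Rightarrow> (('g list \<Rightarrow>\<^sub>0 complex) set \<times> ('g list \<Rightarrow>\<^sub>0 complex) set \<Rightarrow>\<^sub>0 complex) set) \<Rightarrow>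
    ('g \<Rightarrow> complex) \<Rightarrow> ('g \<Rightarrow> ('g list \<Rightarrow>\<^sub>0 complex) set) \<Rightarrow>
    ('g list \<Rightarrow>\<^sub>0 complex) set hopf" where
  "present_hopf X R \<delta> \<epsilon> s = (let A = present_alg X R in
     \<lparr>carrier = carrier A, mult = mult A, one = one A, zero = zero A, add = add A, smult = smult A,
      comult = \<lambda>a. the_elem (free_eval (tensor A A) \<delta> ` a),
      counit = \<lambda>a. the_elem (free_eval complex_alg \<epsilon> ` a),
      antipode = \<lambda>a. the_elem (free_eval (opposite_alg A) s ` a)\<rparr>)"

definition group_hopf :: "('g, 'm) monoid_scheme \<Rightarrow> ('g \<Rightarrow>\<^sub>0 complex) hopf" where
  "group_hopf G = (let A = monoid_alg G; \<gamma> = (\<lambda>g. Poly_Mapping.single g 1) in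
     \<lparr>carrier = carrier A, mult = mult A, one = one A, zero = zero A, add = add A, smult = smult A,
      comult = lin_ext (tensor A A) (\<lambda>g. pure_tensor A A (\<gamma> g) (\<gamma> g)),
      counit = lin_ext complex_alg (\<lambda>g. 1),
      antipode = lin_ext A (\<lambda>g. \<gamma> (inv\<^bsub>G\<^esub> g))\<rparr>)"

text \<open>
  The free product (coproduct of unital algebras): generated by the elements of both
  factors, subject to all relations making the two maps \<open>free_prod_inl\<close> and
  \<open>free_prod_inr\<close> unital algebra homomorphisms.
\<close>

definition alg_rels :: "('a \<Rightarrow> 'g) \<Rightarrow> (complex, 'a, 'm) module_scheme \<Rightarrow> ('g list \<Rightarrow>\<^sub>0 complex) set" where
  "alg_rels j A =
     {free_gen (j (a \<oplus>\<^bsub>A\<^esub> b)) - free_gen (j a) - free_gen (j b)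
       | a b. a \<in> carrier A \<and> b \<in> carrier A} \<union>
     {free_gen (j (c \<odot>\<^bsub>A\<^esub> a)) - Poly_Mapping.single [j a] c | c a. a \<in> carrier A} \<union>
     {free_gen (j (a \<otimes>\<^bsub>A\<^esub> b)) - Poly_Mapping.single [j a, j b] 1
       | a b. a \<in> carrier A \<and> b \<in> carrier A} \<union>
     {free_gen (j \<one>\<^bsub>A\<^esub>) - Poly_Mapping.single [] 1}"

definition free_prod_rels :: "(complex, 'a, 'm) module_scheme \<Rightarrow> (complex, 'b, 'k) module_scheme \<Rightarrow>
    (('a + 'b) list \<Rightarrow>\<^sub>0 complex) set" where
  "free_prod_rels A B = alg_rels Inl A \<union> alg_rels Inr B"

definition free_prod_inl :: "(complex, 'a, 'm) module_scheme \<Rightarrow> (complex, 'b, 'k) module_scheme \<Rightarrow>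
    'a \<Rightarrow> (('a + 'b) list \<Rightarrow>\<^sub>0 complex) set" where
  "free_prod_inl A B a = present_gen (carrier A <+> carrier B) (free_prod_rels A B) (Inl a)"

definition free_prod_inr :: "(complex, 'a, 'm) module_scheme \<Rightarrow> (complex, 'b, 'k) module_scheme \<Rightarrow>
    'b \<Rightarrow> (('a + 'b) list \<Rightarrow>\<^sub>0 complex) set" where
  "free_prod_inr A B b = present_gen (carrier A <+> carrier B) (free_prod_rels A B) (Inr b)"

definition free_prod :: "'a hopf \<Rightarrow> 'b hopf \<Rightarrow> (('a + 'b) list \<Rightarrow>\<^sub>0 complex) set hopf" where
  "free_prod A B =
     (let X = carrier A <+> carrier B; R = free_prod_rels A B; P = present_alg X R;
          \<iota>\<^sub>1 = free_prod_inl A B; \<iota>\<^sub>2 = free_prod_inr A B in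
      present_hopf X R
        (case_sum (\<lambda>a. tensor_map P P \<iota>\<^sub>1 \<iota>\<^sub>1 (comult A a)) (\<lambda>b. tensor_map P P \<iota>\<^sub>2 \<iota>\<^sub>2 (comult B b)))
        (case_sum (counit A) (counit B))
        (case_sum (\<lambda>a. \<iota>\<^sub>1 (antipode A a)) (\<lambda>b. \<iota>\<^sub>2 (antipode B b))))"


section \<open>Matrices over a complex algebra\<close>

definition amat_mult :: "(complex, 'a, 'm) module_scheme \<Rightarrow>
    ('n::finite \<Rightarrow> 'n \<Rightarrow> 'a) \<Rightarrow> ('n \<Rightarrow> 'n \<Rightarrow> 'a) \<Rightarrow> 'n \<Rightarrow> 'n \<Rightarrow> 'a" where
  "amat_mult A M N = (\<lambda>i j. finsum A (\<lambda>k. M i k \<otimes>\<^bsub>A\<^esub> N k j) UNIV)"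

definition amat_scalar :: "(complex, 'a, 'm) module_scheme \<Rightarrow> complex^'n::finite^'n \<Rightarrow> 'n \<Rightarrow> 'n \<Rightarrow> 'a" where
  "amat_scalar A M = (\<lambda>i j. M $ i $ j \<odot>\<^bsub>A\<^esub> \<one>\<^bsub>A\<^esub>)"

definition amat_transpose :: "('n \<Rightarrow> 'n \<Rightarrow> 'a) \<Rightarrow> 'n \<Rightarrow> 'n \<Rightarrow> 'a" where
  "amat_transpose M = (\<lambda>i j. M j i)"

text \<open>The matrix \<open>P x\<^sup>t Q\<close>, for scalar matrices \<open>P\<close> and \<open>Q\<close>.\<close>

definition amat_twist :: "(complex, 'a, 'm) module_scheme \<Rightarrow> complex^'n::finite^'n \<Rightarrow>
    ('n \<Rightarrow> 'n \<Rightarrow> 'a) \<Rightarrow> complex^'n^'n \<Rightarrow> 'n \<Rightarrow> 'n \<Rightarrow> 'a" where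
  "amat_twist A P x Q =
     amat_mult A (amat_mult A (amat_scalar A P) (amat_transpose x)) (amat_scalar A Q)"

text \<open>The entrywise relations expressing the matrix equation \<open>M = N\<close>.\<close>

definition amat_eq_rels :: "('n \<Rightarrow> 'n \<Rightarrow> ('g \<Rightarrow>\<^sub>0 complex)) \<Rightarrow> ('n \<Rightarrow> 'n \<Rightarrow> ('g \<Rightarrow>\<^sub>0 complex)) \<Rightarrow>
    ('g \<Rightarrow>\<^sub>0 complex) set" where
  "amat_eq_rels M N = {M i j - N i j | i j. True}"

text \<open>The value \<open>\<Delta>(x\<^sub>i\<^sub>j) = \<Sum>\<^sub>k x\<^sub>i\<^sub>k \<otimes> x\<^sub>k\<^sub>j\<close> of the comultiplication on a matrix coalgebra.\<close>

definition amat_comult :: "(complex, 'a, 'm) module_scheme \<Rightarrow> ('n::finite \<Rightarrow> 'n \<Rightarrow> 'a) \<Rightarrow>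
    'n \<Rightarrow> 'n \<Rightarrow> ('a \<times> 'a \<Rightarrow>\<^sub>0 complex) set" where
  "amat_comult A x i j = finsum (tensor A A) (\<lambda>k. pure_tensor A A (x i k) (x k j)) UNIV"


section \<open>The Hopf algebras \<open>\<B>(E)\<close> and \<open>\<H>(F)\<close>\<close>

text \<open>The generator \<open>x\<^sub>i\<^sub>j\<close> of \<open>\<B>(E)\<close> is indexed by \<open>(i, j)\<close>.\<close>

definition B_rels :: "complex^'n::finite^'n \<Rightarrow> (('n \<times> 'n) list \<Rightarrow>\<^sub>0 complex) set" where
  "B_rels E =
     (let A = free_alg UNIV; x = (\<lambda>i j. free_gen (i, j)); y = amat_twist A (matrix_inv E) x E in
      amat_eq_rels (amat_mult A y x) (amat_scalar A (mat 1)) \<union>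
      amat_eq_rels (amat_mult A x y) (amat_scalar A (mat 1)))"

definition B_gen :: "complex^'n::finite^'n \<Rightarrow> 'n \<Rightarrow> 'n \<Rightarrow> (('n \<times> 'n) list \<Rightarrow>\<^sub>0 complex) set" where
  "B_gen E i j = present_gen UNIV (B_rels E) (i, j)"

definition B_hopf :: "complex^'n::finite^'n \<Rightarrow> (('n \<times> 'n) list \<Rightarrow>\<^sub>0 complex) set hopf" where
  "B_hopf E =
     (let A = present_alg UNIV (B_rels E); x = B_gen E in
      present_hopf UNIV (B_rels E)
        (\<lambda>(i, j). amat_comult A x i j)
        (\<lambda>(i, j). if i = j then 1 else 0)
        (\<lambda>(i, j). amat_twist A (matrix_inv E) x E i j))"

text \<open>The generators \<open>u\<^sub>i\<^sub>j\<close> and \<open>v\<^sub>i\<^sub>j\<close> of \<open>\<H>(F)\<close> are indexed by \<open>Inl (i, j)\<close> and \<open>Inr (i, j)\<close>.\<close>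

definition H_rels :: "complex^'n::finite^'n \<Rightarrow> (('n \<times> 'n + 'n \<times> 'n) list \<Rightarrow>\<^sub>0 complex) set" where
  "H_rels F =
     (let A = free_alg UNIV; u = (\<lambda>i j. free_gen (Inl (i, j))); v = (\<lambda>i j. free_gen (Inr (i, j)));
          w = amat_twist A F u (matrix_inv F); I = amat_scalar A (mat 1) in
      amat_eq_rels (amat_mult A u (amat_transpose v)) I \<union>
      amat_eq_rels (amat_mult A (amat_transpose v) u) I \<union>
      amat_eq_rels (amat_mult A v w) I \<union>
      amat_eq_rels (amat_mult A w v) I)"

definition H_hopf :: "complex^'n::finite^'n \<Rightarrow> (('n \<times> 'n + 'n \<times> 'n) list \<Rightarrow>\<^sub>0 complex) set hopf" where
  "H_hopf F =
     (let A = present_alg UNIV (H_rels F);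
          u = (\<lambda>i j. present_gen UNIV (H_rels F) (Inl (i, j)));
          v = (\<lambda>i j. present_gen UNIV (H_rels F) (Inr (i, j))) in
      present_hopf UNIV (H_rels F)
        (case_sum (\<lambda>(i, j). amat_comult A u i j) (\<lambda>(i, j). amat_comult A v i j))
        (case_sum (\<lambda>(i, j). if i = j then 1 else 0) (\<lambda>(i, j). if i = j then 1 else 0))
        (case_sum (\<lambda>(i, j). amat_transpose v i j)
                  (\<lambda>(i, j). amat_twist A F u (matrix_inv F) i j)))"


section \<open>The glued free product and genericity\<close>

definition CZ2_hopf :: "(int \<Rightarrow>\<^sub>0 complex) hopf" where
  "CZ2_hopf = group_hopf (integer_mod_group 2)"

definition CZ2_gen :: "int \<Rightarrow>\<^sub>0 complex" where
  "CZ2_gen = Poly_Mapping.single 1 1"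

definition glued_free_prod :: "complex^'n::finite^'n \<Rightarrow>
    (((('n \<times> 'n) list \<Rightarrow>\<^sub>0 complex) set + (int \<Rightarrow>\<^sub>0 complex)) list \<Rightarrow>\<^sub>0 complex) set hopf" where
  "glued_free_prod E =
     (let P = free_prod (B_hopf E) CZ2_hopf in
      sub_hopf P (hopf_generated P
        {free_prod_inl (B_hopf E) CZ2_hopf (B_gen E i j) \<otimes>\<^bsub>P\<^esub>
           free_prod_inr (B_hopf E) CZ2_hopf CZ2_gen | i j. True}))"

definition normalizable :: "complex^'n::finite^'n \<Rightarrow> bool" where
  "normalizable F \<longleftrightarrow>
     (trace F \<noteq> 0 \<and> trace (matrix_inv F) \<noteq> 0) \<or> (trace F = 0 \<and> trace (matrix_inv F) = 0)"

definition root_of_unity_of_order :: "nat \<Rightarrow> complex \<Rightarrow> bool" where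
  "root_of_unity_of_order m q \<longleftrightarrow> m > 0 \<and> q ^ m = 1 \<and> (\<forall>k. 0 < k \<and> k < m \<longrightarrow> q ^ k \<noteq> 1)"

text \<open>
  The choice of the square root is immaterial: the other one replaces the solutions \<open>q\<close>
  by \<open>-q\<close>, and \<open>q\<close> is a root of unity of order at least 3 if and only if \<open>-q\<close> is.
\<close>

definition generic :: "complex^'n::finite^'n \<Rightarrow> bool" where
  "generic F \<longleftrightarrow> normalizable F \<and>
     (\<forall>q. q\<^sup>2 - csqrt (trace F * trace (matrix_inv F)) * q + 1 = 0 \<longrightarrow>
        \<not> (\<exists>m\<ge>3. root_of_unity_of_order m q))"

end

theory Submission
  imports Defs
begin

text \<open>
  Write \<open>E'\<close> for the inverse of \<open>E\<close> and let \<open>P = \<B>(E) * \<complex>\<int>\<^sub>2\<close>.  The matrices \<open>u = x g\<close> and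
  \<open>v = E\<^sup>t (g x) E'\<^sup>t\<close> satisfy the relations of \<open>\<H>(F)\<close> in \<open>P\<close>, which gives a Hopf algebra map
  \<open>f : \<H>(F) \<rightarrow> P\<close>; since the \<open>v\<^sub>i\<^sub>j\<close> are obtained from the \<open>u\<^sub>i\<^sub>j\<close> by the antipode, its image is the
  Hopf subalgebra generated by the \<open>x\<^sub>i\<^sub>j g\<close>.  For injectivity no representation theory is needed:
  conjugation by \<open>g\<close> corresponds to the involution \<open>u \<mapsto> E'\<^sup>t v E\<^sup>t\<close> of \<open>\<H>(F)\<close>, and \<open>P\<close> is the crossed
  product by it.  Concretely, \<open>g\<close> acts as the swap and \<open>x\<close> as the off-diagonal matrix with entries \<open>u\<close>
  and \<open>E'\<^sup>t v E\<^sup>t\<close> in the \<open>2 \<times> 2\<close> matrices over \<open>\<H>(F)\<close>, and the upper left entry is a left inverse of \<open>f\<close>.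
\<close>

text \<open>The asymmetry enters through one cancellation: for F = E^t E' one has E'^t F = E'. In v
  F u^t the twist around g x therefore meets F and leaves x E' x^t, which a relation of B(E)
  evaluates. The same identity, read backwards, makes the off-diagonal 2 x 2 matrix a solution of
  the relations of B(E), so that the crossed product itself never has to be constructed.

  The upper left entry is not multiplicative on the whole matrix algebra, so the retraction from P
  to H(F) is merely linear. It still gives more than injectivity of f: the tensor square of a Hopf
  subalgebra is a quotient in its own right, and its comultiplication has to be recovered by
  inverting the map to P \<otimes> P. A linear retraction splits that map.

  The structure maps come from one principle. An algebra map out of B(E) or H(F) is a solution of
  the matrix relations in the target; the counit is the identity matrix, the comultiplication a
  product of two entrywise commuting solutions, and the antipode a solution in the opposite
  algebra.\<close>

abbreviation (input) "keys \<equiv> Poly_Mapping.keys"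
abbreviation (input) "lookup \<equiv> Poly_Mapping.lookup"
abbreviation (input) "single \<equiv> Poly_Mapping.single"

section \<open>Algebras and homomorphisms\<close>

text \<open>One flat list of axioms in place of a ring together with a module over the record
  \<open>complex_alg\<close>. Statements use the predicate \<open>calgebra\<close>; proofs pass to
  this locale by \<open>calgebra_iff_calg\<close> to obtain the simplification rules.\<close>

locale calg = ring A for A :: "(complex, 'a, 'm) module_scheme" (structure) +
  assumes smult_closed [simp, intro]: "x \<in> carrier A \<Longrightarrow> c \<odot> x \<in> carrier A"
    and smult_l_distr: "x \<in> carrier A \<Longrightarrow> (c + d) \<odot> x = c \<odot> x \<oplus> d \<odot> x"
    and smult_r_distr: "x \<in> carrier A \<Longrightarrow> y \<in> carrier A \<Longrightarrow> c \<odot> (x \<oplus> y) = c \<odot> x \<oplus> c \<odot> y"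
    and smult_smult [simp]: "x \<in> carrier A \<Longrightarrow> c \<odot> (d \<odot> x) = (c * d) \<odot> x"
    and smult_one [simp]: "x \<in> carrier A \<Longrightarrow> 1 \<odot> x = x"
    and mult_smult_left [simp]:
      "x \<in> carrier A \<Longrightarrow> y \<in> carrier A \<Longrightarrow> (c \<odot> x) \<otimes> y = c \<odot> (x \<otimes> y)"
    and mult_smult_right [simp]:
      "x \<in> carrier A \<Longrightarrow> y \<in> carrier A \<Longrightarrow> x \<otimes> (c \<odot> y) = c \<odot> (x \<otimes> y)"

lemma complex_alg_simps [simp]:
  "carrier complex_alg = UNIV" "x \<otimes>\<^bsub>complex_alg\<^esub> y = x * y" "x \<oplus>\<^bsub>complex_alg\<^esub> y = x + y"
  "\<zero>\<^bsub>complex_alg\<^esub> = 0" "\<one>\<^bsub>complex_alg\<^esub> = 1" "x \<odot>\<^bsub>complex_alg\<^esub> y = x * y"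
  by (simp_all add: complex_alg_def)

lemma cring_complex_alg: "cring complex_alg"
proof (rule cringI)
  show "abelian_group complex_alg"
  proof (rule abelian_groupI)
    fix x show "\<exists>y\<in>carrier complex_alg. y \<oplus>\<^bsub>complex_alg\<^esub> x = \<zero>\<^bsub>complex_alg\<^esub>"
      by (rule bexI[of _ "- x"]) auto
  qed auto
  show "Group.comm_monoid complex_alg"
    by (rule comm_monoidI) auto
qed (auto simp: algebra_simps)

lemma calgebra_iff_calg: "calgebra A \<longleftrightarrow> calg A"
proof
  assume a: "calgebra A"
  then interpret R: ring A by (simp add: calgebra_def)
  interpret M: Module.module complex_alg A using a by (simp add: calgebra_def)
  show "calg A"
    using a M.smult_closed M.smult_l_distr M.smult_r_distr M.smult_assoc1 M.smult_one
    by unfold_locales (auto simp: calgebra_def)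
next
  assume "calg A"
  then interpret calg A .
  have "Module.module complex_alg A"
    by (rule moduleI) (auto simp: cring_complex_alg abelian_group_axioms smult_l_distr smult_r_distr)
  then show "calgebra A"
    by (auto simp: calgebra_def ring_axioms)
qed

lemma calgebra_complex_alg: "calgebra complex_alg"
  unfolding calgebra_iff_calg using cring_complex_alg
  by (auto simp: calg_def calg_axioms_def cring_def algebra_simps)

context calg
begin

lemma smult_zero_left [simp]: "x \<in> carrier A \<Longrightarrow> 0 \<odot> x = \<zero>"
  using smult_l_distr[of x 0 0] by (metis add.l_cancel_one add_0 smult_closed)

lemma smult_zero_right [simp]: "c \<odot> \<zero> = \<zero>"
  using smult_smult[of \<zero> c 0] by simp

lemma smult_minus_one: "x \<in> carrier A \<Longrightarrow> (-1) \<odot> x = \<ominus> x"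
  using smult_l_distr[of x "-1" 1] by (simp add: minus_equality)

lemma finsum_smult:
  "f \<in> S \<rightarrow> carrier A \<Longrightarrow> c \<odot> (finsum A f S) = finsum A (\<lambda>i. c \<odot> f i) S"
proof (induction S rule: infinite_finite_induct)
  case (insert x F)
  then show ?case by (simp add: smult_r_distr Pi_def)
qed simp_all

lemma finsum_swap:
  assumes "finite S" "finite T" "\<And>i j. i \<in> S \<Longrightarrow> j \<in> T \<Longrightarrow> f i j \<in> carrier A"
  shows "finsum A (\<lambda>i. finsum A (f i) T) S = finsum A (\<lambda>j. finsum A (\<lambda>i. f i j) S) T"
  using assms(1,3)
proof (induction S rule: finite_induct)
  case (insert x F)
  have "finsum A (\<lambda>i. finsum A (f i) T) (insert x F) = finsum A (f x) T \<oplus> finsum A (\<lambda>i. finsum A (f i) T) F"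
    using insert by (intro finsum_insert) (auto intro!: finsum_closed)
  also have "\<dots> = finsum A (\<lambda>j. f x j \<oplus> finsum A (\<lambda>i. f i j) F) T"
    using insert by (simp add: finsum_addf Pi_def)
  also have "\<dots> = finsum A (\<lambda>j. finsum A (\<lambda>i. f i j) (insert x F)) T"
    using insert by (intro finsum_cong') (auto intro!: finsum_closed)
  finally show ?case .
qed simp

lemma finsum_delta:
  assumes "finite S" "a \<in> S" "f \<in> S \<rightarrow> carrier A"
  shows "finsum A (\<lambda>i. if i = a then f i else \<zero>) S = f a"
    and "finsum A (\<lambda>i. if a = i then f i else \<zero>) S = f a"
proof -
  show *: "finsum A (\<lambda>i. if a = i then f i else \<zero>) S = f a"
    using assms add.finprod_singleton[of a S f] by simp
  show "finsum A (\<lambda>i. if i = a then f i else \<zero>) S = f a"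
    unfolding *[symmetric] using assms by (intro finsum_cong') auto
qed

end

lemma clin_homI:
  assumes "\<And>x. x \<in> carrier A \<Longrightarrow> f x \<in> carrier B"
    "\<And>x y. x \<in> carrier A \<Longrightarrow> y \<in> carrier A \<Longrightarrow> f (x \<oplus>\<^bsub>A\<^esub> y) = f x \<oplus>\<^bsub>B\<^esub> f y"
    "\<And>c x. x \<in> carrier A \<Longrightarrow> f (c \<odot>\<^bsub>A\<^esub> x) = c \<odot>\<^bsub>B\<^esub> f x"
  shows "f \<in> clin_hom A B"
  using assms by (auto simp: clin_hom_def)

lemma clin_hom_simps:
  assumes "f \<in> clin_hom A B"
  shows clin_hom_closed: "x \<in> carrier A \<Longrightarrow> f x \<in> carrier B"
    and clin_hom_add: "x \<in> carrier A \<Longrightarrow> y \<in> carrier A \<Longrightarrow> f (x \<oplus>\<^bsub>A\<^esub> y) = f x \<oplus>\<^bsub>B\<^esub> f y"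
    and clin_hom_smult: "x \<in> carrier A \<Longrightarrow> f (c \<odot>\<^bsub>A\<^esub> x) = c \<odot>\<^bsub>B\<^esub> f x"
  using assms by (auto simp: clin_hom_def)

lemma calg_hom_iff:
  "f \<in> calg_hom A B \<longleftrightarrow> f \<in> clin_hom A B \<and>
    (\<forall>x\<in>carrier A. \<forall>y\<in>carrier A. f (x \<otimes>\<^bsub>A\<^esub> y) = f x \<otimes>\<^bsub>B\<^esub> f y) \<and> f \<one>\<^bsub>A\<^esub> = \<one>\<^bsub>B\<^esub>"
  by (auto simp: calg_hom_def clin_hom_def ring_hom_def)

lemma calg_hom_clin: "f \<in> calg_hom A B \<Longrightarrow> f \<in> clin_hom A B"
  by (simp add: calg_hom_iff)

lemma calg_hom_simps:
  assumes "f \<in> calg_hom A B"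
  shows calg_hom_closed: "x \<in> carrier A \<Longrightarrow> f x \<in> carrier B"
    and calg_hom_add: "x \<in> carrier A \<Longrightarrow> y \<in> carrier A \<Longrightarrow> f (x \<oplus>\<^bsub>A\<^esub> y) = f x \<oplus>\<^bsub>B\<^esub> f y"
    and calg_hom_smult: "x \<in> carrier A \<Longrightarrow> f (c \<odot>\<^bsub>A\<^esub> x) = c \<odot>\<^bsub>B\<^esub> f x"
    and calg_hom_mult: "x \<in> carrier A \<Longrightarrow> y \<in> carrier A \<Longrightarrow> f (x \<otimes>\<^bsub>A\<^esub> y) = f x \<otimes>\<^bsub>B\<^esub> f y"
    and calg_hom_one: "f \<one>\<^bsub>A\<^esub> = \<one>\<^bsub>B\<^esub>"
  using assms by (auto simp: calg_hom_iff clin_hom_def)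

lemma clin_hom_zero:
  assumes "f \<in> clin_hom A B" "calgebra A" "calgebra B"
  shows "f \<zero>\<^bsub>A\<^esub> = \<zero>\<^bsub>B\<^esub>"
proof -
  interpret A: calg A using assms by (simp add: calgebra_iff_calg)
  interpret B: calg B using assms by (simp add: calgebra_iff_calg)
  show ?thesis
    using clin_hom_smult[OF assms(1) A.zero_closed, of 0] clin_hom_closed[OF assms(1) A.zero_closed]
    by simp
qed

lemma clin_hom_a_inv:
  assumes "f \<in> clin_hom A B" "calgebra A" "calgebra B" "x \<in> carrier A"
  shows "f (\<ominus>\<^bsub>A\<^esub> x) = \<ominus>\<^bsub>B\<^esub> f x"
proof -
  interpret A: calg A using assms by (simp add: calgebra_iff_calg)
  interpret B: calg B using assms by (simp add: calgebra_iff_calg)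
  show ?thesis
    using clin_hom_smult[OF assms(1,4), of "-1"] clin_hom_closed[OF assms(1,4)] assms(4)
    by (simp add: A.smult_minus_one B.smult_minus_one)
qed

lemma clin_hom_minus:
  assumes "f \<in> clin_hom A B" "calgebra A" "calgebra B" "x \<in> carrier A" "y \<in> carrier A"
  shows "f (x \<ominus>\<^bsub>A\<^esub> y) = f x \<ominus>\<^bsub>B\<^esub> f y"
proof -
  interpret A: calg A using assms by (simp add: calgebra_iff_calg)
  show ?thesis
    using assms by (simp add: a_minus_def clin_hom_add clin_hom_a_inv)
qed

lemma clin_hom_finsum:
  assumes f: "f \<in> clin_hom A B" and A: "calgebra A" and B: "calgebra B"
    and g: "g \<in> S \<rightarrow> carrier A"
  shows "f (finsum A g S) = finsum B (\<lambda>i. f (g i)) S"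
proof -
  interpret A: calg A using A by (simp add: calgebra_iff_calg)
  interpret B: calg B using B by (simp add: calgebra_iff_calg)
  show ?thesis
    using g
  proof (induction S rule: infinite_finite_induct)
    case (insert x F)
    then show ?case
      by (simp add: clin_hom_add[OF f] clin_hom_closed[OF f] Pi_def)
  qed (simp_all add: clin_hom_zero[OF f A B])
qed

lemma clin_hom_comp: "f \<in> clin_hom A B \<Longrightarrow> g \<in> clin_hom B C \<Longrightarrow> (\<lambda>x. g (f x)) \<in> clin_hom A C"
  by (auto simp: clin_hom_def Pi_iff)

lemma calg_hom_comp: "f \<in> calg_hom A B \<Longrightarrow> g \<in> calg_hom B C \<Longrightarrow> (\<lambda>x. g (f x)) \<in> calg_hom A C"
  by (auto simp: calg_hom_iff clin_hom_comp clin_hom_closed)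

lemma calg_hom_id: "(\<lambda>x. x) \<in> calg_hom A A"
  by (simp add: calg_hom_iff clin_hom_def)

lemma calg_hom_cong:
  assumes "f \<in> calg_hom A B" "\<And>x. x \<in> carrier A \<Longrightarrow> f x = g x" "calgebra A"
  shows "g \<in> calg_hom A B"
proof -
  interpret A: calg A using assms by (simp add: calgebra_iff_calg)
  have "f x = g x \<Longrightarrow> f x \<in> carrier B \<Longrightarrow> g x \<in> carrier B" for x by simp
  then show ?thesis
    using assms(1) assms(2)[symmetric] by (simp add: calg_hom_iff clin_hom_def Pi_def)
qed

text \<open>Zero and negatives come for free as the multiples by 0 and -1. The definition lists
  exactly the operations that an induction over generators has to check.\<close>

definition subalg :: "'a set \<Rightarrow> (complex, 'a, 'm) module_scheme \<Rightarrow> bool" where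
  "subalg S A \<longleftrightarrow> S \<subseteq> carrier A \<and> \<one>\<^bsub>A\<^esub> \<in> S \<and>
     (\<forall>x\<in>S. \<forall>y\<in>S. x \<oplus>\<^bsub>A\<^esub> y \<in> S \<and> x \<otimes>\<^bsub>A\<^esub> y \<in> S) \<and> (\<forall>c. \<forall>x\<in>S. c \<odot>\<^bsub>A\<^esub> x \<in> S)"

lemma subalg_carrier:
  assumes "calgebra A" shows "subalg (carrier A) A"
proof -
  interpret calg A using assms by (simp add: calgebra_iff_calg)
  show ?thesis by (simp add: subalg_def)
qed

lemma subalg_equalizer:
  assumes "f \<in> calg_hom A B" "g \<in> calg_hom A B" "calgebra A"
  shows "subalg {x \<in> carrier A. f x = g x} A"
proof -
  interpret calg A using assms by (simp add: calgebra_iff_calg)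
  show ?thesis
    by (auto simp: subalg_def calg_hom_simps[OF assms(1)] calg_hom_simps[OF assms(2)])
qed

lemma subalg_image:
  assumes "f \<in> calg_hom A B" "calgebra A" "subalg S A"
  shows "subalg (f ` S) B"
proof -
  have "S \<subseteq> carrier A" using assms(3) by (simp add: subalg_def)
  moreover from this have "f x \<in> carrier B" if "x \<in> S" for x
    using that by (auto intro: calg_hom_closed[OF assms(1)])
  ultimately show ?thesis using assms(3)
    unfolding subalg_def
    by (auto simp: subset_iff calg_hom_add[OF assms(1), symmetric] calg_hom_mult[OF assms(1), symmetric]
        calg_hom_smult[OF assms(1), symmetric] calg_hom_one[OF assms(1), symmetric])
qed

lemma calgebra_restrict:
  fixes A (structure)
  assumes "calgebra A" "subalg S A"
  shows "calgebra (A\<lparr>carrier := S\<rparr>)"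
proof -
  interpret calg A using assms by (simp add: calgebra_iff_calg)
  have S: "x \<in> carrier A" if "x \<in> S" for x using assms(2) that by (auto simp: subalg_def)
  have 0: "\<zero> \<in> S" using assms(2) smult_zero_left[OF one_closed] unfolding subalg_def by metis
  have m: "\<ominus> x \<in> S" if "x \<in> S" for x 
    using assms(2) smult_minus_one[OF S[OF that]] that unfolding subalg_def by metis
  have cl: "x \<oplus> y \<in> S" "x \<otimes> y \<in> S" "c \<odot> x \<in> S" "\<one> \<in> S" if "x \<in> S" "y \<in> S" for x y c
    using that assms(2) by (auto simp: subalg_def)
  have "ring (A\<lparr>carrier := S\<rparr>)"
  proof (rule ringI)
    show "abelian_group (A\<lparr>carrier := S\<rparr>)"
    proof (rule abelian_groupI)
      fix x assume "x \<in> carrier (A\<lparr>carrier := S\<rparr>)"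
      then show "\<exists>y\<in>carrier (A\<lparr>carrier := S\<rparr>). y \<oplus>\<^bsub>A\<lparr>carrier := S\<rparr>\<^esub> x = \<zero>\<^bsub>A\<lparr>carrier := S\<rparr>\<^esub>"
        using m[of x] S[of x] by (intro bexI[of _ "\<ominus> x"]) (auto simp: l_neg)
    qed (auto simp: S 0 cl a_ac)
    show "Group.monoid (A\<lparr>carrier := S\<rparr>)"
      by (rule monoidI) (auto simp: S cl 0 m_assoc intro: cl[OF 0 0])
  qed (auto simp: S l_distr r_distr)
  then show ?thesis
    by (simp add: calgebra_iff_calg calg_def calg_axioms_def S cl smult_l_distr smult_r_distr)
qed

lemma opposite_alg_simps [simp]:
  "carrier (opposite_alg A) = carrier A" "x \<otimes>\<^bsub>opposite_alg A\<^esub> y = y \<otimes>\<^bsub>A\<^esub> x"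
  "add (opposite_alg A) = add A" "\<zero>\<^bsub>opposite_alg A\<^esub> = \<zero>\<^bsub>A\<^esub>" "\<one>\<^bsub>opposite_alg A\<^esub> = \<one>\<^bsub>A\<^esub>"
  "smult (opposite_alg A) = smult A"
  by (simp_all add: opposite_alg_def)

lemma finsum_opposite [simp]: "finsum (opposite_alg A) = finsum A"
  by (simp add: finsum_def)

lemma calgebra_opposite:
  assumes "calgebra A" shows "calgebra (opposite_alg A)"
proof -
  interpret calg A using assms by (simp add: calgebra_iff_calg)
  have "ring (opposite_alg A)"
  proof (rule ringI)
    show "abelian_group (opposite_alg A)"
      using abelian_group_axioms by (simp add: abelian_group_def abelian_monoid_def abelian_group_axioms_def)
    show "Group.monoid (opposite_alg A)"
      by (rule monoidI) (auto simp: m_assoc)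
  qed (auto simp: l_distr r_distr)
  then show ?thesis
    by (simp add: calgebra_iff_calg calg_def calg_axioms_def smult_l_distr smult_r_distr)
qed

lemma calg_hom_opposite: 
  "f \<in> calg_hom A B \<Longrightarrow> calgebra A \<Longrightarrow> f \<in> calg_hom (opposite_alg A) (opposite_alg B)"
  by (simp add: calg_hom_iff clin_hom_def)

lemma clin_hom_opposite [simp]: "clin_hom A (opposite_alg B) = clin_hom A B"
  by (simp add: clin_hom_def)

section \<open>Monoid algebras\<close>

lemma lookup_smult: "lookup (Poly_Mapping.map ((*) c) p) k = c * lookup p k"
  for c :: complex
  by transfer (auto simp: when_def)

lemma keys_smult: "keys (Poly_Mapping.map ((*) c) p) \<subseteq> keys p"
  for c :: complex
  by (auto simp: in_keys_iff lookup_smult)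

lemma poly_mapping_sum_single:
  "p = (\<Sum>k\<in>keys p. single k (lookup p k))"
  by (rule poly_mapping_eqI) (auto simp: lookup_sum lookup_single when_def in_keys_iff)

text \<open>Linear statements about a monoid algebra reduce to basis elements by this rule. It keeps
  the support inside \<open>X\<close>, since the laws of the monoid hold only on its
  carrier.\<close>

lemma poly_mapping_keys_induct [consumes 1, case_names zero single add]:
  fixes p :: "'a \<Rightarrow>\<^sub>0 'b::comm_monoid_add"
  assumes p: "keys p \<subseteq> X"
    and zero: "P 0"
    and single: "\<And>g c. g \<in> X \<Longrightarrow> P (single g c)"
    and add: "\<And>p q. keys p \<subseteq> X \<Longrightarrow> keys q \<subseteq> X \<Longrightarrow> P p \<Longrightarrow> P q \<Longrightarrow> P (p + q)"
  shows "P p"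
proof -
  let ?s = "\<lambda>F. \<Sum>k\<in>F. single k (lookup p k)"
  have "F \<subseteq> X \<Longrightarrow> keys (?s F) \<subseteq> X \<and> P (?s F)" if "finite F" for F
    using that
  proof (induction F rule: finite_induct)
    case (insert x F)
    then have "keys (single x (lookup p x) + ?s F) \<subseteq> X"
      using keys_add[of "single x (lookup p x)" "?s F"] by (auto split: if_splits)
    with insert show ?case by (auto intro!: add single split: if_splits)
  qed (simp add: zero)
  from this[OF finite_keys p] show ?thesis
    using poly_mapping_sum_single[of p] by simp
qed

text \<open>The supports of p, q and p + q differ. Summing over a common finite superset makes their
  linear extensions comparable term by term.\<close>

lemma lin_ext_superset:
  assumes "calgebra M" "finite S" "keys p \<subseteq> S" "f \<in> S \<rightarrow> carrier M"
  shows "lin_ext M f p = finsum M (\<lambda>g. lookup p g \<odot>\<^bsub>M\<^esub> f g) S"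
proof -
  interpret calg M using assms by (simp add: calgebra_iff_calg)
  show ?thesis
    unfolding lin_ext_def
    by (rule add.finprod_mono_neutral_cong_left) (use assms in \<open>auto simp: in_keys_iff Pi_iff\<close>)
qed

lemma lin_ext_single:
  assumes "calgebra M" "f g \<in> carrier M"
  shows "lin_ext M f (single g c) = c \<odot>\<^bsub>M\<^esub> f g"
proof -
  interpret calg M using assms by (simp add: calgebra_iff_calg)
  show ?thesis
    by (subst lin_ext_superset[where S = "{g}"]) (use assms in \<open>auto simp: finsum_insert\<close>)
qed

lemma monoid_alg_simps [simp]:
  "carrier (monoid_alg G) = {p. keys p \<subseteq> carrier G}"
  "\<one>\<^bsub>monoid_alg G\<^esub> = single \<one>\<^bsub>G\<^esub> 1"
  "\<zero>\<^bsub>monoid_alg G\<^esub> = 0" "p \<oplus>\<^bsub>monoid_alg G\<^esub> q = p + q" "c \<odot>\<^bsub>monoid_alg G\<^esub> p = Poly_Mapping.map ((*) c) p"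
  by (simp_all add: monoid_alg_def)

lemma lin_ext_clin_hom:
  assumes M: "calgebra M" and f: "f \<in> carrier G \<rightarrow> carrier M"
  shows "lin_ext M f \<in> clin_hom (monoid_alg G) M"
proof -
  interpret calg M using M by (simp add: calgebra_iff_calg)
  have c: "lin_ext M f p \<in> carrier M" if "keys p \<subseteq> carrier G" for p
    unfolding lin_ext_def using that f by (intro finsum_closed) auto
  show ?thesis
  proof (rule clin_homI)
    fix p q assume "p \<in> carrier (monoid_alg G)" "q \<in> carrier (monoid_alg G)"
    then have k: "keys p \<subseteq> carrier G" "keys q \<subseteq> carrier G" by auto
    let ?S = "keys p \<union> keys q"
    have fS: "f \<in> ?S \<rightarrow> carrier M" using k f by auto
    note l = lin_ext_superset[OF M _ _ fS]
    show "lin_ext M f (p \<oplus>\<^bsub>monoid_alg G\<^esub> q) = lin_ext M f p \<oplus>\<^bsub>M\<^esub> lin_ext M f q"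
      using fS keys_add[of p q]
      by (auto simp: l lookup_add smult_l_distr Pi_iff simp flip: finsum_addf intro!: finsum_cong')
  next
    fix c p assume "p \<in> carrier (monoid_alg G)"
    then have k: "keys p \<subseteq> carrier G" by auto
    then have fS: "f \<in> keys p \<rightarrow> carrier M" using f by auto
    show "lin_ext M f (c \<odot>\<^bsub>monoid_alg G\<^esub> p) = c \<odot>\<^bsub>M\<^esub> lin_ext M f p"
      using fS keys_smult[of c p]
      by (auto simp: lin_ext_superset[OF M _ _ fS] finsum_smult lookup_smult Pi_iff intro!: finsum_cong')
  qed (use c in auto)
qed

lemma monoid_alg_mult:
  "p \<otimes>\<^bsub>monoid_alg G\<^esub> q = (\<Sum>g\<in>keys p. \<Sum>h\<in>keys q.
       single (g \<otimes>\<^bsub>G\<^esub> h) (lookup p g * lookup q h))"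
  by (simp add: monoid_alg_def)

text \<open>The index sets may exceed the supports, for the same purpose as in
  \<open>lin_ext_superset\<close>: distributivity becomes an identity between summands.\<close>

lemma lookup_monoid_alg_mult:
  assumes "finite S" "finite T" "keys p \<subseteq> S" "keys q \<subseteq> T"
  shows "lookup (p \<otimes>\<^bsub>monoid_alg G\<^esub> q) k =
    (\<Sum>g\<in>S. \<Sum>h\<in>T. if g \<otimes>\<^bsub>G\<^esub> h = k then lookup p g * lookup q h else 0)"
proof -
  have "lookup (p \<otimes>\<^bsub>monoid_alg G\<^esub> q) k =
    (\<Sum>g\<in>keys p. \<Sum>h\<in>keys q.
      if g \<otimes>\<^bsub>G\<^esub> h = k then lookup p g * lookup q h else 0)"
    by (simp add: monoid_alg_mult lookup_sum lookup_single when_def)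
  also have "\<dots> = (\<Sum>g\<in>keys p. \<Sum>h\<in>T.
      if g \<otimes>\<^bsub>G\<^esub> h = k then lookup p g * lookup q h else 0)"
    using assms by (intro sum.cong sum.mono_neutral_left refl) (auto simp: in_keys_iff)
  also have "\<dots> = (\<Sum>g\<in>S. \<Sum>h\<in>T.
      if g \<otimes>\<^bsub>G\<^esub> h = k then lookup p g * lookup q h else 0)"
    using assms by (intro sum.mono_neutral_left) (auto simp: in_keys_iff intro!: sum.neutral)
  finally show ?thesis .
qed

lemma monoid_alg_mult_single:
  "single g c \<otimes>\<^bsub>monoid_alg G\<^esub> single h d = single (g \<otimes>\<^bsub>G\<^esub> h) (c * d)"
  by (rule poly_mapping_eqI, subst lookup_monoid_alg_mult[where S = "{g}" and T = "{h}"])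
    (auto simp: lookup_single when_def)

lemma monoid_alg_mult_zero: "p \<otimes>\<^bsub>monoid_alg G\<^esub> 0 = 0" "0 \<otimes>\<^bsub>monoid_alg G\<^esub> p = 0"
  by (simp_all add: monoid_alg_mult)

lemma monoid_alg_l_distr:
  "(p + p') \<otimes>\<^bsub>monoid_alg G\<^esub> q = p \<otimes>\<^bsub>monoid_alg G\<^esub> q + p' \<otimes>\<^bsub>monoid_alg G\<^esub> q"
proof (rule poly_mapping_eqI)
  fix k
  note l = lookup_monoid_alg_mult[of "keys p \<union> keys p'" "keys q"]
  show "lookup ((p + p') \<otimes>\<^bsub>monoid_alg G\<^esub> q) k =
    lookup (p \<otimes>\<^bsub>monoid_alg G\<^esub> q + p' \<otimes>\<^bsub>monoid_alg G\<^esub> q) k"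
    using keys_add[of p p']
    by (simp add: l lookup_add algebra_simps flip: sum.distrib) (intro sum.cong, auto simp: lookup_add algebra_simps)
qed

lemma monoid_alg_r_distr:
  "q \<otimes>\<^bsub>monoid_alg G\<^esub> (p + p') = q \<otimes>\<^bsub>monoid_alg G\<^esub> p + q \<otimes>\<^bsub>monoid_alg G\<^esub> p'"
proof (rule poly_mapping_eqI)
  fix k
  note l = lookup_monoid_alg_mult[of "keys q" "keys p \<union> keys p'"]
  show "lookup (q \<otimes>\<^bsub>monoid_alg G\<^esub> (p + p')) k =
    lookup (q \<otimes>\<^bsub>monoid_alg G\<^esub> p + q \<otimes>\<^bsub>monoid_alg G\<^esub> p') k"
    using keys_add[of p p']
    by (simp add: l lookup_add algebra_simps flip: sum.distrib) (intro sum.cong, auto simp: lookup_add algebra_simps)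
qed

lemma monoid_alg_mult_closed:
  assumes "Group.monoid G" "keys p \<subseteq> carrier G" "keys q \<subseteq> carrier G"
  shows "keys (p \<otimes>\<^bsub>monoid_alg G\<^esub> q) \<subseteq> carrier G"
proof
  fix k assume "k \<in> keys (p \<otimes>\<^bsub>monoid_alg G\<^esub> q)"
  then have "(\<Sum>g\<in>keys p. \<Sum>h\<in>keys q.
      if g \<otimes>\<^bsub>G\<^esub> h = k then lookup p g * lookup q h else 0) \<noteq> 0"
    by (simp add: in_keys_iff lookup_monoid_alg_mult[of "keys p" "keys q"])
  then have "\<exists>g\<in>keys p. \<exists>h\<in>keys q. g \<otimes>\<^bsub>G\<^esub> h = k"
    by (rule contrapos_np) (auto intro!: sum.neutral)
  then obtain g h where "g \<in> keys p" "h \<in> keys q" "g \<otimes>\<^bsub>G\<^esub> h = k"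
    by auto
  then show "k \<in> carrier G"
    using assms monoid.m_closed[OF assms(1)] by blast
qed

lemma monoid_alg_assoc:
  assumes "Group.monoid G" and k: "keys p \<subseteq> carrier G" "keys q \<subseteq> carrier G"
    "keys r \<subseteq> carrier G"
  shows "(p \<otimes>\<^bsub>monoid_alg G\<^esub> q) \<otimes>\<^bsub>monoid_alg G\<^esub> r = p \<otimes>\<^bsub>monoid_alg G\<^esub> (q \<otimes>\<^bsub>monoid_alg G\<^esub> r)"
  using k(1)
proof (induction p rule: poly_mapping_keys_induct)
  case (single g c)
  note g = this
  show ?case
    using k(2)
  proof (induction q rule: poly_mapping_keys_induct)
    case (single h d)
    note h = this
    show ?case
      using k(3)
    proof (induction r rule: poly_mapping_keys_induct)
      case (single i e)
      then show ?case
        by (simp add: monoid_alg_mult_single mult.assoc monoid.m_assoc[OF assms(1) g h])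
    qed (simp_all add: monoid_alg_r_distr monoid_alg_mult_zero)
  qed (simp_all add: monoid_alg_r_distr monoid_alg_l_distr monoid_alg_mult_zero)
qed (simp_all add: monoid_alg_l_distr monoid_alg_mult_zero)

lemma calgebra_monoid_alg:
  assumes "Group.monoid G"
  shows "calgebra (monoid_alg G)"
proof -
  interpret G: Group.monoid G by fact
  have kadd: "keys (p + q) \<subseteq> carrier G"
    if "keys p \<subseteq> carrier G" "keys q \<subseteq> carrier G" for p q :: "'a \<Rightarrow>\<^sub>0 complex"
    using that keys_add[of p q] by auto
  have ksm: "keys (Poly_Mapping.map ((*) c) p) \<subseteq> carrier G"
    if "keys p \<subseteq> carrier G" for p and c :: complex
    using that keys_smult[of c p] by auto
  have "ring (monoid_alg G)"
  proof (rule ringI)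
    show "abelian_group (monoid_alg G)"
    proof (rule abelian_groupI)
      fix p assume p: "p \<in> carrier (monoid_alg G)"
      have "keys (- p) = keys p"
        by (auto simp: in_keys_iff)
      with p show "\<exists>q\<in>carrier (monoid_alg G). q \<oplus>\<^bsub>monoid_alg G\<^esub> p = \<zero>\<^bsub>monoid_alg G\<^esub>"
        by (intro bexI[of _ "- p"]) auto
    qed (auto simp: add_ac dest: subsetD[OF kadd])
    have one: "single \<one>\<^bsub>G\<^esub> 1 \<otimes>\<^bsub>monoid_alg G\<^esub> p = p \<and> p \<otimes>\<^bsub>monoid_alg G\<^esub> single \<one>\<^bsub>G\<^esub> 1 = p"
      if "keys p \<subseteq> carrier G" for p
      using that
      by (induction p rule: poly_mapping_keys_induct)
        (simp_all add: monoid_alg_mult_single monoid_alg_mult_zero monoid_alg_r_distr monoid_alg_l_distr)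
    show "Group.monoid (monoid_alg G)"
      by (rule monoidI) (use one in \<open>auto simp: monoid_alg_assoc[OF assms] dest: subsetD[OF monoid_alg_mult_closed[OF assms]]\<close>)
  qed (auto simp: monoid_alg_r_distr monoid_alg_l_distr)
  moreover have "Poly_Mapping.map ((*) c) p \<otimes>\<^bsub>monoid_alg G\<^esub> q = Poly_Mapping.map ((*) c) (p \<otimes>\<^bsub>monoid_alg G\<^esub> q)"
      "p \<otimes>\<^bsub>monoid_alg G\<^esub> Poly_Mapping.map ((*) c) q = Poly_Mapping.map ((*) c) (p \<otimes>\<^bsub>monoid_alg G\<^esub> q)" for p q c
    using keys_smult[of c p] keys_smult[of c q]
    by (auto intro!: poly_mapping_eqI sum.cong simp: lookup_smult sum_distrib_left
        lookup_monoid_alg_mult[of "keys p" "keys q"])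
  ultimately show ?thesis
    by (auto simp: calgebra_iff_calg calg_def calg_axioms_def lookup_smult lookup_add algebra_simps
        intro!: poly_mapping_eqI dest: subsetD[OF ksm])
qed

lemma a_inv_monoid_alg:
  assumes "Group.monoid G" "keys p \<subseteq> carrier G"
  shows "\<ominus>\<^bsub>monoid_alg G\<^esub> p = - p"
proof -
  interpret calg "monoid_alg G" using calgebra_monoid_alg[OF assms(1)] by (simp add: calgebra_iff_calg)
  have "\<ominus>\<^bsub>monoid_alg G\<^esub> p = (-1) \<odot>\<^bsub>monoid_alg G\<^esub> p"
    using smult_minus_one[of p] assms by simp
  also have "\<dots> = - p" by (auto intro!: poly_mapping_eqI simp: lookup_smult)
  finally show ?thesis .
qed

lemma minus_monoid_alg:
  assumes "Group.monoid G" "keys q \<subseteq> carrier G"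
  shows "p - q = p \<ominus>\<^bsub>monoid_alg G\<^esub> q"
  using a_inv_monoid_alg[OF assms] by (simp add: a_minus_def)

text \<open>This is the universal property of the monoid algebra. Both sides of multiplicativity are
  bilinear, so two nested inductions leave only products of basis elements.\<close>

lemma lin_ext_calg_hom:
  assumes G: "Group.monoid G" and C: "calgebra C" and f: "f \<in> carrier G \<rightarrow> carrier C"
    and mult: "\<And>g h. g \<in> carrier G \<Longrightarrow> h \<in> carrier G \<Longrightarrow> f (g \<otimes>\<^bsub>G\<^esub> h) = f g \<otimes>\<^bsub>C\<^esub> f h"
    and one: "f \<one>\<^bsub>G\<^esub> = \<one>\<^bsub>C\<^esub>"
  shows "lin_ext C f \<in> calg_hom (monoid_alg G) C"
proof -
  interpret G: Group.monoid G by fact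
  interpret A: calg "monoid_alg G" using calgebra_monoid_alg[OF G] by (simp add: calgebra_iff_calg)
  interpret C: calg C using C by (simp add: calgebra_iff_calg)
  let ?h = "lin_ext C f"
  have lin: "?h \<in> clin_hom (monoid_alg G) C" by (rule lin_ext_clin_hom[OF C f])
  have h_add: "?h (p + q) = ?h p \<oplus>\<^bsub>C\<^esub> ?h q"
    if "keys p \<subseteq> carrier G" "keys q \<subseteq> carrier G" for p q
    using clin_hom_add[OF lin] that by simp
  have cl: "?h p \<in> carrier C" if "keys p \<subseteq> carrier G" for p
    using clin_hom_closed[OF lin] that by simp
  have z: "?h 0 = \<zero>\<^bsub>C\<^esub>" by (simp add: lin_ext_def)
  have s: "?h (single g c) = c \<odot>\<^bsub>C\<^esub> f g" if "g \<in> carrier G" for g c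
    using that f by (intro lin_ext_single[OF C]) auto
  have fc: "f g \<in> carrier C" if "g \<in> carrier G" for g using that f by auto
  have "?h (p \<otimes>\<^bsub>monoid_alg G\<^esub> q) = ?h p \<otimes>\<^bsub>C\<^esub> ?h q"
    if k: "keys p \<subseteq> carrier G" "keys q \<subseteq> carrier G" for p q
    using k(1)
  proof (induction p rule: poly_mapping_keys_induct)
    case (single g c)
    note g = this
    have g': "keys (single g c) \<subseteq> carrier G" using g by auto
    show ?case
      using k(2)
    proof (induction q rule: poly_mapping_keys_induct)
      case (single h d)
      then show ?case
        by (simp add: monoid_alg_mult_single s g mult fc mult.commute)
    next
      case (add p q)
      then show ?case
        by (simp add: monoid_alg_r_distr h_add
            monoid_alg_mult_closed[OF G g'] C.r_distr cl[OF g'] cl)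
    qed (simp add: monoid_alg_mult_zero z cl[OF g'])
  next
    case (add p p')
    then show ?case
      by (simp add: monoid_alg_l_distr h_add
          monoid_alg_mult_closed[OF G _ k(2)] C.l_distr cl k(2))
  qed (simp add: monoid_alg_mult_zero z cl k)
  moreover have "?h (single \<one>\<^bsub>G\<^esub> 1) = \<one>\<^bsub>C\<^esub>" by (simp add: s one)
  ultimately show ?thesis using lin by (simp add: calg_hom_iff)
qed

section \<open>Quotients and presentations\<close>

lemma quot_alg_simps [simp]:
  "carrier (quot_alg A I) = carrier (A Quot I)" "mult (quot_alg A I) = mult (A Quot I)"
  "one (quot_alg A I) = one (A Quot I)" "zero (quot_alg A I) = zero (A Quot I)"
  "add (quot_alg A I) = add (A Quot I)"
  by (simp_all add: quot_alg_def)

text \<open>A ring ideal is automatically a linear subspace, because a multiple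
  \<open>c \<odot> i\<close> is the product of \<open>c \<odot> \<one>\<close> with
  \<open>i\<close>. Hence all cosets in the union defining the scalar multiplication
  coincide.\<close>

lemma quot_alg_smult:
  fixes A (structure)
  assumes A: "calgebra A" and I: "ideal I A" and x: "x \<in> carrier A"
  shows "c \<odot>\<^bsub>quot_alg A I\<^esub> (I +> x) = I +> (c \<odot> x)"
proof -
  interpret calg A using A by (simp add: calgebra_iff_calg)
  interpret ideal I A by fact
  have "I +> (c \<odot> y) = I +> (c \<odot> x)" if "y \<in> I +> x" for y
  proof -
    obtain i where i: "i \<in> I" "y = i \<oplus> x" using \<open>y \<in> I +> x\<close> by (auto simp: a_r_coset_def')
    have "c \<odot> i = (c \<odot> \<one>) \<otimes> i" using i by simp
    then have "c \<odot> i \<in> I" using i I_l_closed[of i "c \<odot> \<one>"] by simp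
    moreover have "c \<odot> y = c \<odot> i \<oplus> c \<odot> x" using i x by (simp add: smult_r_distr)
    ultimately have "c \<odot> y \<in> I +> (c \<odot> x)" by (auto simp: a_r_coset_def')
    then show ?thesis using a_repr_independence[of "c \<odot> y" I "c \<odot> x"] x
      by (simp add: additive_subgroup_axioms a_subgroup is_additive_subgroup)
  qed
  moreover have "x \<in> I +> x" using x by (rule a_rcos_self)
  ultimately have "(\<Union>y\<in>I +> x. I +> (c \<odot> y)) = I +> (c \<odot> x)" by blast
  then show ?thesis by (simp add: quot_alg_def)
qed

lemma quot_alg_carrierE:
  fixes A (structure)
  assumes "X \<in> carrier (quot_alg A I)"
  obtains x where "x \<in> carrier A" "X = I +> x"
  using assms by (auto simp: FactRing_simps)

lemma quot_alg_proj:
  fixes A (structure)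
  assumes A: "calgebra A" and I: "ideal I A"
  shows calgebra_quot_alg: "calgebra (quot_alg A I)"
    and quot_alg_proj_hom: "(\<lambda>x. I +> x) \<in> calg_hom A (quot_alg A I)"
    and quot_alg_proj_zero: "i \<in> I \<Longrightarrow> I +> i = \<zero>\<^bsub>quot_alg A I\<^esub>"
proof -
  interpret calg A using A by (simp add: calgebra_iff_calg)
  interpret ideal I A by fact
  interpret Q: ring "A Quot I" by (rule quotient_is_ring)
  let ?Q = "quot_alg A I"
  have h: "(\<lambda>x. I +> x) \<in> ring_hom A (A Quot I)" by (rule rcos_ring_hom)
  show hom: "(\<lambda>x. I +> x) \<in> calg_hom A ?Q"
    using h quot_alg_smult[OF A I] by (auto simp: calg_hom_def ring_hom_def)
  show "i \<in> I \<Longrightarrow> I +> i = \<zero>\<^bsub>quot_alg A I\<^esub>"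
    by (simp add: FactRing_def a_rcos_const)
  have "abelian_group ?Q"
  proof (rule abelian_groupI)
    fix X assume "X \<in> carrier ?Q"
    then show "\<exists>Y\<in>carrier ?Q. Y \<oplus>\<^bsub>?Q\<^esub> X = \<zero>\<^bsub>?Q\<^esub>"
      by (intro bexI[of _ "\<ominus>\<^bsub>A Quot I\<^esub> X"]) (auto simp: Q.l_neg)
  qed (auto simp: Q.a_ac)
  moreover have "Group.monoid ?Q"
    by (rule monoidI) (auto simp: Q.m_assoc)
  ultimately have "ring ?Q"
    by (intro ringI) (auto simp: Q.l_distr Q.r_distr)
  moreover have "calg_axioms ?Q"
  proof
    fix X c assume "X \<in> carrier ?Q"
    then obtain x where x: "x \<in> carrier A" "X = I +> x" by (rule quot_alg_carrierE)
    show "c \<odot>\<^bsub>?Q\<^esub> X \<in> carrier ?Q"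
      using x calg_hom_closed[OF hom, of "c \<odot> x"] by (simp add: calg_hom_smult[OF hom])
    show "(c + d) \<odot>\<^bsub>?Q\<^esub> X = c \<odot>\<^bsub>?Q\<^esub> X \<oplus>\<^bsub>?Q\<^esub> d \<odot>\<^bsub>?Q\<^esub> X" for d
      using x smult_l_distr[of x c d] by (simp add: calg_hom_smult[OF hom, symmetric] calg_hom_add[OF hom, symmetric] del: quot_alg_simps)
    show "c \<odot>\<^bsub>?Q\<^esub> (d \<odot>\<^bsub>?Q\<^esub> X) = (c * d) \<odot>\<^bsub>?Q\<^esub> X" "1 \<odot>\<^bsub>?Q\<^esub> X = X" for d
      using x by (simp_all add: calg_hom_smult[OF hom, symmetric] del: quot_alg_simps)
    fix Y assume "Y \<in> carrier ?Q"
    then obtain y where y: "y \<in> carrier A" "Y = I +> y" by (rule quot_alg_carrierE)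
    show "c \<odot>\<^bsub>?Q\<^esub> (X \<oplus>\<^bsub>?Q\<^esub> Y) = c \<odot>\<^bsub>?Q\<^esub> X \<oplus>\<^bsub>?Q\<^esub> c \<odot>\<^bsub>?Q\<^esub> Y"
      "c \<odot>\<^bsub>?Q\<^esub> X \<otimes>\<^bsub>?Q\<^esub> Y = c \<odot>\<^bsub>?Q\<^esub> (X \<otimes>\<^bsub>?Q\<^esub> Y)"
      "X \<otimes>\<^bsub>?Q\<^esub> (c \<odot>\<^bsub>?Q\<^esub> Y) = c \<odot>\<^bsub>?Q\<^esub> (X \<otimes>\<^bsub>?Q\<^esub> Y)"
      using x y by (simp_all add: calg_hom_smult[OF hom, symmetric] calg_hom_add[OF hom, symmetric]
          calg_hom_mult[OF hom, symmetric] smult_r_distr del: quot_alg_simps)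
  qed
  ultimately show "calgebra ?Q" by (simp add: calgebra_iff_calg calg_def)
qed

text \<open>Since \<open>h\<close> is constant on cosets, the image of a coset is a singleton and
  \<open>the_elem\<close> reads off its value. The linear version is kept separate because maps out
  of tensor products are often only linear.\<close>

lemma quot_alg_lift:
  fixes A (structure)
  assumes A: "calgebra A" and I: "ideal I A" and C: "calgebra C" and h: "h \<in> clin_hom A C"
    and z: "\<And>i. i \<in> I \<Longrightarrow> h i = \<zero>\<^bsub>C\<^esub>"
  shows quot_alg_lift_coset: "x \<in> carrier A \<Longrightarrow> the_elem (h ` (I +> x)) = h x"
    and quot_alg_lift_clin_hom: "(\<lambda>X. the_elem (h ` X)) \<in> clin_hom (quot_alg A I) C"
    and quot_alg_lift_calg_hom: "h \<in> calg_hom A C \<Longrightarrow> (\<lambda>X. the_elem (h ` X)) \<in> calg_hom (quot_alg A I) C"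
proof -
  interpret calg A using A by (simp add: calgebra_iff_calg)
  interpret C: calg C using C by (simp add: calgebra_iff_calg)
  interpret ideal I A by fact
  let ?Q = "quot_alg A I" and ?L = "\<lambda>X. the_elem (h ` X)"
  have L: "?L (I +> x) = h x" if x: "x \<in> carrier A" for x
  proof -
    have "h y = h x" if "y \<in> I +> x" for y
    proof -
      obtain i where i: "i \<in> I" "y = i \<oplus> x" using \<open>y \<in> I +> x\<close> by (auto simp: a_r_coset_def')
      then show ?thesis using x z[of i] by (simp add: clin_hom_add[OF h] clin_hom_closed[OF h] a_Hcarr)
    qed
    moreover have "x \<in> I +> x" using x by (rule a_rcos_self)
    ultimately have "h ` (I +> x) = {h x}" by blast
    then show ?thesis by simp
  qed
  then show "x \<in> carrier A \<Longrightarrow> ?L (I +> x) = h x" .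
  note hom = quot_alg_proj_hom[OF A I]
  show lin: "?L \<in> clin_hom ?Q C"
  proof (rule clin_homI)
    fix X c assume "X \<in> carrier ?Q"
    then obtain x where x: "x \<in> carrier A" "X = I +> x" by (rule quot_alg_carrierE)
    show "?L X \<in> carrier C" "?L (c \<odot>\<^bsub>?Q\<^esub> X) = c \<odot>\<^bsub>C\<^esub> ?L X"
      using x by (simp_all add: L clin_hom_closed[OF h] clin_hom_smult[OF h] calg_hom_smult[OF hom, symmetric] del: quot_alg_simps)
    fix Y assume "Y \<in> carrier ?Q"
    then obtain y where y: "y \<in> carrier A" "Y = I +> y" by (rule quot_alg_carrierE)
    show "?L (X \<oplus>\<^bsub>?Q\<^esub> Y) = ?L X \<oplus>\<^bsub>C\<^esub> ?L Y"
      using x y by (simp add: L clin_hom_add[OF h] calg_hom_add[OF hom, symmetric] del: quot_alg_simps)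
  qed
  assume hh: "h \<in> calg_hom A C"
  have "?L (X \<otimes>\<^bsub>?Q\<^esub> Y) = ?L X \<otimes>\<^bsub>C\<^esub> ?L Y" if X: "X \<in> carrier ?Q" and Y: "Y \<in> carrier ?Q" for X Y
  proof -
    obtain x where x: "x \<in> carrier A" "X = I +> x" using X by (rule quot_alg_carrierE)
    obtain y where y: "y \<in> carrier A" "Y = I +> y" using Y by (rule quot_alg_carrierE)
    show ?thesis
      using x y by (simp add: L calg_hom_mult[OF hh] calg_hom_mult[OF hom, symmetric] del: quot_alg_simps)
  qed
  moreover have "?L \<one>\<^bsub>?Q\<^esub> = \<one>\<^bsub>C\<^esub>"
    using L[OF one_closed] calg_hom_one[OF hom] calg_hom_one[OF hh] by simp
  ultimately show "?L \<in> calg_hom ?Q C" using lin by (simp add: calg_hom_iff)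
qed

section \<open>Free algebras and presentations by generators and relations\<close>

lemma free_monoid_simps [simp]:
  "carrier (free_monoid X) = lists X" "v \<otimes>\<^bsub>free_monoid X\<^esub> w = v @ w" "\<one>\<^bsub>free_monoid X\<^esub> = []"
  by (simp_all add: free_monoid_def)

lemma monoid_free_monoid: "Group.monoid (free_monoid X)"
  by (rule monoidI) auto

lemmas calgebra_free_alg = calgebra_monoid_alg[OF monoid_free_monoid]

lemma keys_diff_subset:
  "keys p \<subseteq> X \<Longrightarrow> keys q \<subseteq> X \<Longrightarrow> keys (p - q) \<subseteq> X"
  for p :: "'a \<Rightarrow>\<^sub>0 'b::ab_group_add"
proof
  assume X: "keys p \<subseteq> X" "keys q \<subseteq> X"
  fix x assume "x \<in> keys (p - q)"
  then have "x \<in> keys p \<or> x \<in> keys q"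
    by (auto simp: in_keys_iff lookup_minus)
  with X show "x \<in> X" by blast
qed

lemma clin_hom_monoid_alg_diff:
  assumes "h \<in> clin_hom (monoid_alg G) C" "Group.monoid G" "calgebra C"
    "keys p \<subseteq> carrier G" "keys q \<subseteq> carrier G"
  shows "h (p - q) = h p \<ominus>\<^bsub>C\<^esub> h q"
  using clin_hom_minus[OF assms(1) calgebra_monoid_alg[OF assms(2)] assms(3), of p q] assms
  by (simp add: minus_monoid_alg)

lemma foldr_mult_closed:
  assumes "calgebra C" "f \<in> X \<rightarrow> carrier C" "w \<in> lists X"
  shows "foldr (\<lambda>g a. f g \<otimes>\<^bsub>C\<^esub> a) w \<one>\<^bsub>C\<^esub> \<in> carrier C"
proof -
  interpret calg C using assms by (simp add: calgebra_iff_calg)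
  show ?thesis using assms(3,2) by (induction w) auto
qed

lemma free_eval_hom:
  assumes C: "calgebra C" and f: "f \<in> X \<rightarrow> carrier C"
  shows "free_eval C f \<in> calg_hom (free_alg X) C"
proof -
  interpret calg C using C by (simp add: calgebra_iff_calg)
  note cl = foldr_mult_closed[OF C f]
  have app: "foldr (\<lambda>g a. f g \<otimes>\<^bsub>C\<^esub> a) (v @ w) \<one>\<^bsub>C\<^esub> =
      foldr (\<lambda>g a. f g \<otimes>\<^bsub>C\<^esub> a) v \<one>\<^bsub>C\<^esub> \<otimes>\<^bsub>C\<^esub> foldr (\<lambda>g a. f g \<otimes>\<^bsub>C\<^esub> a) w \<one>\<^bsub>C\<^esub>"
    if "v \<in> lists X" "w \<in> lists X" for v w
    using that(1)
  proof (induction v)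
    case (Cons x v)
    moreover have "f x \<in> carrier C" using Cons f by auto
    moreover have "v \<in> lists X" using Cons by auto
    ultimately show ?case using cl[of v] cl[of w] that by (simp add: m_assoc)
  qed (use cl[of w] that in simp)
  show ?thesis
    unfolding free_eval_def
    by (rule lin_ext_calg_hom[OF monoid_free_monoid C]) (use cl app in \<open>auto simp del: foldr_append\<close>)
qed

lemma free_eval_single:
  assumes "calgebra C" "f \<in> X \<rightarrow> carrier C" "w \<in> lists X"
  shows "free_eval C f (single w c) = c \<odot>\<^bsub>C\<^esub> foldr (\<lambda>g a. f g \<otimes>\<^bsub>C\<^esub> a) w \<one>\<^bsub>C\<^esub>"
  unfolding free_eval_def by (rule lin_ext_single) (use assms foldr_mult_closed[OF assms] in auto)

lemma free_eval_gen:
  assumes "calgebra C" "f \<in> X \<rightarrow> carrier C" "g \<in> X"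
  shows "free_eval C f (free_gen g) = f g"
proof -
  interpret calg C using assms by (simp add: calgebra_iff_calg)
  have "f g \<in> carrier C" using assms by auto
  then show ?thesis using assms by (simp add: free_eval_single)
qed

lemma kernel_ideal:
  assumes h: "h \<in> calg_hom A C" and A: "calgebra A" and C: "calgebra C"
  shows "ideal {x \<in> carrier A. h x = \<zero>\<^bsub>C\<^esub>} A"
proof -
  interpret calg A using A by (simp add: calgebra_iff_calg)
  interpret C: calg C using C by (simp add: calgebra_iff_calg)
  note l = calg_hom_clin[OF h]
  show ?thesis
  proof (rule idealI)
    show "subgroup {x \<in> carrier A. h x = \<zero>\<^bsub>C\<^esub>} (add_monoid A)"
      by (rule add.subgroupI)
        (auto simp: clin_hom_a_inv[OF l A C, unfolded a_inv_def] calg_hom_add[OF h]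
          clin_hom_a_inv[OF l A C] simp flip: a_inv_def intro!: exI[of _ "\<zero>\<^bsub>A\<^esub>"] clin_hom_zero[OF l A C])
  qed (auto simp: ring_axioms calg_hom_mult[OF h] calg_hom_closed[OF h])
qed

locale presentation =
  fixes X :: "'g set" and R :: "('g list \<Rightarrow>\<^sub>0 complex) set"
  assumes R_carrier: "R \<subseteq> carrier (free_alg X)"
begin

abbreviation "PA \<equiv> present_alg X R"
abbreviation "proj p \<equiv> (Idl\<^bsub>free_alg X\<^esub> R) +>\<^bsub>free_alg X\<^esub> p"

interpretation F: calg "free_alg X"
  using calgebra_free_alg by (simp add: calgebra_iff_calg)

lemma ideal_R: "ideal (Idl\<^bsub>free_alg X\<^esub> R) (free_alg X)"
  by (rule F.genideal_ideal[OF R_carrier])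

lemma calgebra_PA: "calgebra PA"
  unfolding present_alg_def by (rule calgebra_quot_alg[OF calgebra_free_alg ideal_R])

lemma proj_hom: "(\<lambda>p. proj p) \<in> calg_hom (free_alg X) PA"
  unfolding present_alg_def by (rule quot_alg_proj_hom[OF calgebra_free_alg ideal_R])

lemma gen_closed: "g \<in> X \<Longrightarrow> present_gen X R g \<in> carrier PA"
  unfolding present_gen_def using calg_hom_closed[OF proj_hom] by simp

text \<open>Every class is a linear combination of words and every word is a product of generators;
  a \<open>subalg\<close> is closed under precisely these operations.\<close>

lemma present_induct:
  assumes S: "subalg S PA" and g: "\<And>g. g \<in> X \<Longrightarrow> present_gen X R g \<in> S"
  shows "carrier PA \<subseteq> S"
proof
  fix a assume "a \<in> carrier PA"
  then obtain p where p: "p \<in> carrier (free_alg X)" "a = proj p"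
    unfolding present_alg_def by (rule quot_alg_carrierE)
  have word: "proj (single w 1) \<in> S" if "w \<in> lists X" for w
    using that
  proof (induction w)
    case Nil
    then show ?case using calg_hom_one[OF proj_hom] S by (simp add: subalg_def)
  next
    case (Cons x w)
    have "proj (single (x # w) 1) = proj (free_gen x) \<otimes>\<^bsub>PA\<^esub> proj (single w 1)"
      using calg_hom_mult[OF proj_hom, of "free_gen x" "single w 1"] Cons
      by (simp add: monoid_alg_mult_single)
    then show ?case using Cons g[of x] S by (simp add: subalg_def present_gen_def)
  qed
  have "proj p \<in> S" if "keys p \<subseteq> lists X"
    using that
  proof (induction p rule: poly_mapping_keys_induct)
    case zero
    interpret P: calg PA using calgebra_PA by (simp add: calgebra_iff_calg)
    have "\<zero>\<^bsub>PA\<^esub> \<in> S"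
      using P.smult_zero_left[OF P.one_closed] S by (metis subalg_def)
    then show ?case
      using clin_hom_zero[OF calg_hom_clin[OF proj_hom] calgebra_free_alg calgebra_PA] by simp
  next
    case (single w c)
    have "Poly_Mapping.map ((*) c) (single w 1) = single w c"
      by (rule poly_mapping_eqI) (simp add: lookup_smult lookup_single when_def)
    then show ?case
      using calg_hom_smult[OF proj_hom, of "single w 1" c] word[OF single] single S
      by (simp add: subalg_def)
  next
    case (add p q)
    then show ?case
      using calg_hom_add[OF proj_hom, of p q] S by (simp add: subalg_def)
  qed
  with p show "a \<in> S" by simp
qed

context
  fixes C :: "(complex, 'c, 'k) module_scheme" and f
  assumes C: "calgebra C" and f: "f \<in> X \<rightarrow> carrier C"
    and rels: "\<And>r. r \<in> R \<Longrightarrow> free_eval C f r = \<zero>\<^bsub>C\<^esub>"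
begin

text \<open>The kernel of the evaluation is an ideal containing \<open>R\<close>, hence contains the
  ideal generated by \<open>R\<close>.\<close>

lemma free_eval_ideal: "r \<in> Idl\<^bsub>free_alg X\<^esub> R \<Longrightarrow> free_eval C f r = \<zero>\<^bsub>C\<^esub>"
  using F.genideal_minimal[OF kernel_ideal[OF free_eval_hom[OF C f] calgebra_free_alg C], of R] rels R_carrier
  by auto

lemma present_lift_hom: "(\<lambda>a. the_elem (free_eval C f ` a)) \<in> calg_hom PA C"
  unfolding present_alg_def
  by (rule quot_alg_lift_calg_hom[OF calgebra_free_alg ideal_R C calg_hom_clin free_eval_ideal])
    (use free_eval_hom[OF C f] in auto)

lemma present_lift_gen:
  assumes "g \<in> X"
  shows "the_elem (free_eval C f ` present_gen X R g) = f g"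
proof -
  have "the_elem (free_eval C f ` proj (free_gen g)) = free_eval C f (free_gen g)"
    by (rule quot_alg_lift_coset[OF calgebra_free_alg ideal_R C calg_hom_clin free_eval_ideal])
      (use free_eval_hom[OF C f] assms in auto)
  then show ?thesis
    using free_eval_gen[OF C f assms] by (simp add: present_gen_def)
qed

end

text \<open>Evaluating at the classes of the generators is the projection itself, as both are
  algebra maps that agree on words. This carries a formal relation over to an identity in the
  quotient.\<close>

lemma present_rel:
  assumes "r \<in> R"
  shows "free_eval PA (present_gen X R) r = \<zero>\<^bsub>PA\<^esub>"
proof -
  have g: "present_gen X R \<in> X \<rightarrow> carrier PA" using gen_closed by auto
  note ev = free_eval_hom[OF calgebra_PA g]
  have word: "free_eval PA (present_gen X R) (single w 1) = proj (single w 1)"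
    if "w \<in> lists X" for w
    using that
  proof (induction w)
    case Nil
    then show ?case using calg_hom_one[OF proj_hom] calg_hom_one[OF ev] by simp
  next
    case (Cons x w)
    let ?x = "free_gen x :: 'g list \<Rightarrow>\<^sub>0 complex"
    have *: "single (x # w) 1 = ?x \<otimes>\<^bsub>free_alg X\<^esub> single w 1"
      by (simp add: monoid_alg_mult_single)
    have "free_eval PA (present_gen X R) ?x = proj ?x"
      using free_eval_gen[OF calgebra_PA g] Cons by (simp add: present_gen_def)
    then show ?case
      unfolding * using Cons by (subst calg_hom_mult[OF ev], simp, simp, subst calg_hom_mult[OF proj_hom]) auto
  qed
  have "free_eval PA (present_gen X R) p = proj p" if "keys p \<subseteq> lists X" for p
    using that
  proof (induction p rule: poly_mapping_keys_induct)
    case zero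
    then show ?case
      using clin_hom_zero[OF calg_hom_clin[OF proj_hom] calgebra_free_alg calgebra_PA]
        clin_hom_zero[OF calg_hom_clin[OF ev] calgebra_free_alg calgebra_PA] by simp
  next
    case (single w c)
    have *: "single w c = c \<odot>\<^bsub>free_alg X\<^esub> (single w 1)"
      by (rule poly_mapping_eqI) (simp add: lookup_smult lookup_single when_def)
    show ?case
      unfolding * using word[OF single] single
      by (subst calg_hom_smult[OF ev], simp, subst calg_hom_smult[OF proj_hom]) auto
  next
    case (add p q)
    then show ?case
      using calg_hom_add[OF proj_hom, of p q] calg_hom_add[OF ev, of p q] by simp
  qed
  moreover have "proj r = \<zero>\<^bsub>PA\<^esub>"
    unfolding present_alg_def
    by (rule quot_alg_proj_zero[OF calgebra_free_alg ideal_R]) (use F.genideal_self[OF R_carrier] assms in auto)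
  ultimately show ?thesis using assms R_carrier by auto
qed

end

section \<open>Tensor products\<close>

lemma submodule_iff:
  fixes M (structure)
  assumes M: "calgebra M"
  shows "submodule N complex_alg M \<longleftrightarrow> N \<subseteq> carrier M \<and> \<zero> \<in> N \<and>
    (\<forall>x\<in>N. \<forall>y\<in>N. x \<oplus> y \<in> N) \<and> (\<forall>c. \<forall>x\<in>N. c \<odot> x \<in> N)"
proof -
  interpret calg M using M by (simp add: calgebra_iff_calg)
  interpret L: Module.module complex_alg M using M by (simp add: calgebra_def)
  show ?thesis
  proof (intro iffI)
    assume s: "submodule N complex_alg M"
    have "\<zero> \<in> N"
      using subgroup.one_closed[OF submodule.axioms(1)[OF s]] by simp
    then show "N \<subseteq> carrier M \<and> \<zero> \<in> N \<and> (\<forall>x\<in>N. \<forall>y\<in>N. x \<oplus> y \<in> N) \<and> (\<forall>c. \<forall>x\<in>N. c \<odot> x \<in> N)"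
      using L.submoduleE[OF s] by auto
  next
    assume s: "N \<subseteq> carrier M \<and> \<zero> \<in> N \<and> (\<forall>x\<in>N. \<forall>y\<in>N. x \<oplus> y \<in> N) \<and> (\<forall>c. \<forall>x\<in>N. c \<odot> x \<in> N)"
    show "submodule N complex_alg M"
      by (rule L.submoduleI) (use s smult_minus_one[symmetric] in \<open>auto simp: subset_iff\<close>)
  qed
qed

definition bilin :: "(complex, 'a, 'm) module_scheme \<Rightarrow> (complex, 'b, 'k) module_scheme \<Rightarrow>
    (complex, 'c, 'l) module_scheme \<Rightarrow> ('a \<Rightarrow> 'b \<Rightarrow> 'c) \<Rightarrow> bool" where
  "bilin A B C \<beta> \<longleftrightarrow> (\<forall>b\<in>carrier B. (\<lambda>a. \<beta> a b) \<in> clin_hom A C) \<and> (\<forall>a\<in>carrier A. \<beta> a \<in> clin_hom B C)"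

locale tensor_algs =
  fixes A :: "(complex, 'a, 'm) module_scheme" and B :: "(complex, 'b, 'k) module_scheme"
  assumes A: "calgebra A" and B: "calgebra B"
begin

interpretation A: calg A using A by (simp add: calgebra_iff_calg)
interpretation B: calg B using B by (simp add: calgebra_iff_calg)

abbreviation "M \<equiv> monoid_alg (A \<times>\<times> B)"

lemma monoid_AB: "Group.monoid (A \<times>\<times> B)"
  by (rule DirProd_monoid) (rule A.monoid_axioms B.monoid_axioms)+

lemmas calgebra_M = calgebra_monoid_alg[OF monoid_AB]

interpretation M: calg M using calgebra_M by (simp add: calgebra_iff_calg)

lemma bilin_rels_carrier: "bilin_rels A B \<subseteq> carrier M"
proof
  fix r assume "r \<in> bilin_rels A B"
  then show "r \<in> carrier M"
    unfolding bilin_rels_def by (elim UnE CollectE exE conjE) (simp_all add: keys_diff_subset)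
qed

lemma bilin_span_submodule: "submodule (bilin_span A B) complex_alg M"
proof -
  have "submodule (carrier M) complex_alg M"
    unfolding submodule_iff[OF calgebra_M] using M.zero_closed M.add.m_closed M.smult_closed by blast
  then have "bilin_span A B \<subseteq> carrier M"
    unfolding bilin_span_def using bilin_rels_carrier by blast
  then show ?thesis
    unfolding submodule_iff[OF calgebra_M, of "bilin_span A B"]
    by (auto simp: bilin_span_def submodule_iff[OF calgebra_M] simp del: monoid_alg_simps)
qed

lemma bilin_span_minimal:
  "submodule N complex_alg M \<Longrightarrow> bilin_rels A B \<subseteq> N \<Longrightarrow> bilin_span A B \<subseteq> N"
  unfolding bilin_span_def by blast

lemma bilin_rels_span: "bilin_rels A B \<subseteq> bilin_span A B"
  unfolding bilin_span_def by blast

text \<open>Multiplying a bilinearity relation by a basis element yields another relation of the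
  same kind, with both entries multiplied. This is why their linear span is a two-sided ideal and
  the tensor product inherits a multiplication.\<close>

lemma single_mult_rel:
  assumes r: "r \<in> bilin_rels A B" and ab: "a0 \<in> carrier A" "b0 \<in> carrier B"
  shows "single (a0, b0) 1 \<otimes>\<^bsub>M\<^esub> r \<in> bilin_rels A B"
    and "r \<otimes>\<^bsub>M\<^esub> single (a0, b0) 1 \<in> bilin_rels A B"
proof -
  let ?s = "single (a0, b0) 1 :: 'a \<times> 'b \<Rightarrow>\<^sub>0 complex"
  have s: "?s \<in> carrier M" using ab by simp
  have l: "?s \<otimes>\<^bsub>M\<^esub> (p - q) = ?s \<otimes>\<^bsub>M\<^esub> p - ?s \<otimes>\<^bsub>M\<^esub> q"
    and rr: "(p - q) \<otimes>\<^bsub>M\<^esub> ?s = p \<otimes>\<^bsub>M\<^esub> ?s - q \<otimes>\<^bsub>M\<^esub> ?s" for p q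
    using monoid_alg_r_distr[where G = "A \<times>\<times> B" and q = ?s and p = "p - q" and p' = q]
      monoid_alg_l_distr[where G = "A \<times>\<times> B" and q = ?s and p = "p - q" and p' = q]
    by (simp_all add: algebra_simps)
  from r show "?s \<otimes>\<^bsub>M\<^esub> r \<in> bilin_rels A B"
    unfolding bilin_rels_def
    using ab
    apply (elim UnE CollectE exE conjE)
       apply (simp_all add: l monoid_alg_mult_single A.r_distr B.r_distr)
       apply (metis A.m_closed B.m_closed)+
    done
  from r show "r \<otimes>\<^bsub>M\<^esub> ?s \<in> bilin_rels A B"
    unfolding bilin_rels_def
    using ab
    apply (elim UnE CollectE exE conjE)
       apply (simp_all add: rr monoid_alg_mult_single A.l_distr B.l_distr)
       apply (metis A.m_closed B.m_closed)+
    done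
qed

lemma bilin_span_ideal: "ideal (bilin_span A B) M"
proof -
  let ?N = "bilin_span A B"
  have N: "?N \<subseteq> carrier M" "0 \<in> ?N" "\<And>x y. x \<in> ?N \<Longrightarrow> y \<in> ?N \<Longrightarrow> x + y \<in> ?N"
    "\<And>c x. x \<in> ?N \<Longrightarrow> Poly_Mapping.map ((*) c) x \<in> ?N"
    using bilin_span_submodule unfolding submodule_iff[OF calgebra_M] by simp_all
  have Nc: "keys x \<subseteq> carrier A \<times> carrier B" if "x \<in> ?N" for x using N(1) that by auto
  have sm: "m \<otimes>\<^bsub>M\<^esub> Poly_Mapping.map ((*) c) x = Poly_Mapping.map ((*) c) (m \<otimes>\<^bsub>M\<^esub> x)"
    "Poly_Mapping.map ((*) c) x \<otimes>\<^bsub>M\<^esub> m = Poly_Mapping.map ((*) c) (x \<otimes>\<^bsub>M\<^esub> m)"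
    if "keys x \<subseteq> carrier A \<times> carrier B" "keys m \<subseteq> carrier A \<times> carrier B" for m c x
    using M.mult_smult_right[of m x c] M.mult_smult_left[of x m c] that by simp_all
  \<comment> \<open>For a fixed basis element s, the elements that s multiplies into the span from
    both sides form a submodule containing the relations. By minimality it contains the whole span;
    linearity in s then gives arbitrary multipliers.\<close>
  let ?K = "\<lambda>s. {p \<in> carrier M. s \<otimes>\<^bsub>M\<^esub> p \<in> ?N \<and> p \<otimes>\<^bsub>M\<^esub> s \<in> ?N}"
  have K: "?N \<subseteq> ?K (single (a, b) 1)" if ab: "a \<in> carrier A" "b \<in> carrier B" for a b
  proof (rule bilin_span_minimal)
    show "bilin_rels A B \<subseteq> ?K (single (a, b) 1)"
      using bilin_rels_carrier single_mult_rel[OF _ ab] bilin_rels_span by blast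
    have cl: "z \<in> keys (p + q) \<Longrightarrow> z \<in> carrier A \<times> carrier B"
        "z \<in> keys (Poly_Mapping.map ((*) c) p) \<Longrightarrow> z \<in> carrier A \<times> carrier B"
      if "keys p \<subseteq> carrier A \<times> carrier B" "keys q \<subseteq> carrier A \<times> carrier B" for p q :: "'a \<times> 'b \<Rightarrow>\<^sub>0 complex" and c z
      using keys_add[of p q] keys_smult[of c p] that by blast+
    show "submodule (?K (single (a, b) 1)) complex_alg M"
      unfolding submodule_iff[OF calgebra_M]
      using cl ab N(2-)
      by (auto simp: monoid_alg_mult_zero monoid_alg_r_distr monoid_alg_l_distr sm dest: cl)
  qed
  have main: "m \<otimes>\<^bsub>M\<^esub> n \<in> ?N \<and> n \<otimes>\<^bsub>M\<^esub> m \<in> ?N" if n: "n \<in> ?N" and m: "keys m \<subseteq> carrier (A \<times>\<times> B)" for m n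
    using m
  proof (induction m rule: poly_mapping_keys_induct)
    case (single g c)
    then obtain a b where g: "g = (a, b)" "a \<in> carrier A" "b \<in> carrier B" by (cases g) auto
    have *: "single g c = Poly_Mapping.map ((*) c) (single g 1)"
      by (rule poly_mapping_eqI) (simp add: lookup_smult lookup_single when_def)
    have "single g 1 \<otimes>\<^bsub>M\<^esub> n \<in> ?N" "n \<otimes>\<^bsub>M\<^esub> single g 1 \<in> ?N"
      using K[OF g(2,3)] n g by auto
    then show ?case
      unfolding * using g Nc[OF n] by (simp add: sm N(4) del: Poly_Mapping.map_single)
  qed (simp_all add: monoid_alg_mult_zero monoid_alg_r_distr monoid_alg_l_distr N)
  show ?thesis
    by (rule idealI) (use main submodule.axioms(1)[OF bilin_span_submodule] M.ring_axioms in auto)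
qed

lemma calgebra_tensor: "calgebra (tensor A B)"
  unfolding tensor_def by (rule calgebra_quot_alg[OF calgebra_M bilin_span_ideal])

abbreviation (input) "tproj p \<equiv> bilin_span A B +>\<^bsub>M\<^esub> p"

lemma tproj_hom: "(\<lambda>p. tproj p) \<in> calg_hom M (tensor A B)"
  unfolding tensor_def by (rule quot_alg_proj_hom[OF calgebra_M bilin_span_ideal])

interpretation T: calg "tensor A B" using calgebra_tensor by (simp add: calgebra_iff_calg)

lemma pure_closed [simp]:
  "a \<in> carrier A \<Longrightarrow> b \<in> carrier B \<Longrightarrow> pure_tensor A B a b \<in> carrier (tensor A B)"
  unfolding pure_tensor_def using calg_hom_closed[OF tproj_hom, of "single (a, b) 1"] by simp

lemma tproj_single:
  assumes "a \<in> carrier A" "b \<in> carrier B"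
  shows "tproj (single (a, b) c) = c \<odot>\<^bsub>tensor A B\<^esub> pure_tensor A B a b"
proof -
  have "single (a, b) c = c \<odot>\<^bsub>M\<^esub> single (a, b) 1"
    by (rule poly_mapping_eqI) (simp add: lookup_smult lookup_single when_def)
  then show ?thesis
    using calg_hom_smult[OF tproj_hom, of "single (a, b) 1" c] assms by (simp add: pure_tensor_def)
qed

lemma tproj_rel:
  assumes "p - q \<in> bilin_rels A B" "keys p \<subseteq> carrier A \<times> carrier B" "keys q \<subseteq> carrier A \<times> carrier B"
  shows "tproj p = tproj q"
proof -
  have "tproj (p - q) = \<zero>\<^bsub>tensor A B\<^esub>"
    unfolding tensor_def
    by (rule quot_alg_proj_zero[OF calgebra_M bilin_span_ideal]) (use assms bilin_rels_span in auto)
  then have "tproj p \<ominus>\<^bsub>tensor A B\<^esub> tproj q = \<zero>\<^bsub>tensor A B\<^esub>"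
    using clin_hom_monoid_alg_diff[OF calg_hom_clin[OF tproj_hom] monoid_AB calgebra_tensor, of p q] assms by simp
  then show ?thesis
    using T.r_right_minus_eq calg_hom_closed[OF tproj_hom] assms by simp
qed

lemma pure_bilin: "bilin A B (tensor A B) (pure_tensor A B)"
  unfolding bilin_def
proof (intro conjI ballI clin_homI)
  have add: "tproj (p + q) = tproj p \<oplus>\<^bsub>tensor A B\<^esub> tproj q"
    if "keys p \<subseteq> carrier A \<times> carrier B" "keys q \<subseteq> carrier A \<times> carrier B" for p q
    using calg_hom_add[OF tproj_hom, of p q] that by simp
  have kadd: "keys (single g (1::complex) + single h 1) \<subseteq> carrier A \<times> carrier B"
    if "g \<in> carrier A \<times> carrier B" "h \<in> carrier A \<times> carrier B" for g h
    using keys_add[of "single g (1::complex)" "single h 1"] that by auto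
  fix a b
  {
    fix a' assume ab: "a \<in> carrier A" "a' \<in> carrier A" "b \<in> carrier B"
    have "tproj (single (a \<oplus>\<^bsub>A\<^esub> a', b) 1) =
        tproj (single (a, b) 1 + single (a', b) 1)"
    proof (rule tproj_rel)
      show "single (a \<oplus>\<^bsub>A\<^esub> a', b) 1 - (single (a, b) 1 + single (a', b) 1) \<in> bilin_rels A B"
        unfolding bilin_rels_def diff_diff_eq[symmetric] using ab by blast
    qed (use ab kadd in auto)
    then show "pure_tensor A B (a \<oplus>\<^bsub>A\<^esub> a') b = pure_tensor A B a b \<oplus>\<^bsub>tensor A B\<^esub> pure_tensor A B a' b"
      using ab by (simp add: add pure_tensor_def)
  }
  {
    fix b' assume ab: "a \<in> carrier A" "b \<in> carrier B" "b' \<in> carrier B"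
    have "tproj (single (a, b \<oplus>\<^bsub>B\<^esub> b') 1) =
        tproj (single (a, b) 1 + single (a, b') 1)"
    proof (rule tproj_rel)
      show "single (a, b \<oplus>\<^bsub>B\<^esub> b') 1 - (single (a, b) 1 + single (a, b') 1) \<in> bilin_rels A B"
        unfolding bilin_rels_def diff_diff_eq[symmetric] using ab by blast
    qed (use ab kadd in auto)
    then show "pure_tensor A B a (b \<oplus>\<^bsub>B\<^esub> b') = pure_tensor A B a b \<oplus>\<^bsub>tensor A B\<^esub> pure_tensor A B a b'"
      using ab by (simp add: add pure_tensor_def)
  }
  {
    fix c assume ab: "a \<in> carrier A" "b \<in> carrier B"
    have "tproj (single (c \<odot>\<^bsub>A\<^esub> a, b) 1) = tproj (single (a, b) c)"
      "tproj (single (a, c \<odot>\<^bsub>B\<^esub> b) 1) = tproj (single (a, b) c)"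
      by (rule tproj_rel; (unfold bilin_rels_def)?; use ab in \<open>blast | simp\<close>)+
    then show "pure_tensor A B (c \<odot>\<^bsub>A\<^esub> a) b = c \<odot>\<^bsub>tensor A B\<^esub> pure_tensor A B a b"
      "pure_tensor A B a (c \<odot>\<^bsub>B\<^esub> b) = c \<odot>\<^bsub>tensor A B\<^esub> pure_tensor A B a b"
      using ab by (simp_all add: tproj_single pure_tensor_def[symmetric])
  }
qed simp_all

lemma pure_mult:
  assumes "a \<in> carrier A" "b \<in> carrier B" "a' \<in> carrier A" "b' \<in> carrier B"
  shows "pure_tensor A B a b \<otimes>\<^bsub>tensor A B\<^esub> pure_tensor A B a' b' = pure_tensor A B (a \<otimes>\<^bsub>A\<^esub> a') (b \<otimes>\<^bsub>B\<^esub> b')"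
  using calg_hom_mult[OF tproj_hom, of "single (a, b) 1" "single (a', b') 1"] assms
  by (simp add: monoid_alg_mult_single pure_tensor_def)

lemma pure_one: "pure_tensor A B \<one>\<^bsub>A\<^esub> \<one>\<^bsub>B\<^esub> = \<one>\<^bsub>tensor A B\<^esub>"
  using calg_hom_one[OF tproj_hom] by (simp add: pure_tensor_def)

text \<open>A scalar multiple of a pure tensor is again pure, the scalar being absorbed in the first
  factor. Hence sums of pure tensors exhaust the tensor product, and neither a scalar nor a zero
  case appears.\<close>

lemma tensor_induct [consumes 1, case_names pure add]:
  assumes t: "t \<in> carrier (tensor A B)"
    and pure: "\<And>a b. a \<in> carrier A \<Longrightarrow> b \<in> carrier B \<Longrightarrow> P (pure_tensor A B a b)"
    and add: "\<And>s t. s \<in> carrier (tensor A B) \<Longrightarrow> t \<in> carrier (tensor A B) \<Longrightarrow> P s \<Longrightarrow> P t \<Longrightarrow> P (s \<oplus>\<^bsub>tensor A B\<^esub> t)"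
  shows "P t"
proof -
  obtain p where p: "p \<in> carrier M" "t = tproj p"
    using t unfolding tensor_def by (rule quot_alg_carrierE)
  have pl: "(\<lambda>a. pure_tensor A B a b) \<in> clin_hom A (tensor A B)" if "b \<in> carrier B" for b
    using pure_bilin that by (simp add: bilin_def)
  have s: "P (tproj (single (a, b) c))" if "a \<in> carrier A" "b \<in> carrier B" for a b c
    using that pure[of "c \<odot>\<^bsub>A\<^esub> a" b] clin_hom_smult[OF pl, of b a c] by (simp add: tproj_single)
  have "P (tproj p)" if "keys p \<subseteq> carrier (A \<times>\<times> B)"
    using that
  proof (induction p rule: poly_mapping_keys_induct)
    case zero
    then show ?case using s[of "\<zero>\<^bsub>A\<^esub>" "\<zero>\<^bsub>B\<^esub>" 0] by simp
  next
    case (single g c)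
    then show ?case using s by (cases g) auto
  next
    case (add p q)
    then show ?case
      using calg_hom_add[OF tproj_hom, of p q] calg_hom_closed[OF tproj_hom] assms(3)[of "tproj p" "tproj q"] by simp
  qed
  with p show ?thesis by simp
qed

lemma tensor_hom_unique:
  assumes "f \<in> clin_hom (tensor A B) C" "h \<in> clin_hom (tensor A B) C"
    and "\<And>a b. a \<in> carrier A \<Longrightarrow> b \<in> carrier B \<Longrightarrow> f (pure_tensor A B a b) = h (pure_tensor A B a b)"
    and "t \<in> carrier (tensor A B)"
  shows "f t = h t"
  using assms(4)
proof (induction t rule: tensor_induct)
  case (add s t)
  then show ?case by (simp add: clin_hom_add[OF assms(1)] clin_hom_add[OF assms(2)])
qed (rule assms(3))

context
  fixes C :: "(complex, 'c, 'l) module_scheme" and \<beta>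
  assumes C: "calgebra C" and \<beta>: "bilin A B C \<beta>"
begin

interpretation C: calg C using C by (simp add: calgebra_iff_calg)

lemma bilin_simps:
  "a \<in> carrier A \<Longrightarrow> b \<in> carrier B \<Longrightarrow> \<beta> a b \<in> carrier C"
  "a \<in> carrier A \<Longrightarrow> a' \<in> carrier A \<Longrightarrow> b \<in> carrier B \<Longrightarrow> \<beta> (a \<oplus>\<^bsub>A\<^esub> a') b = \<beta> a b \<oplus>\<^bsub>C\<^esub> \<beta> a' b"
  "a \<in> carrier A \<Longrightarrow> b \<in> carrier B \<Longrightarrow> b' \<in> carrier B \<Longrightarrow> \<beta> a (b \<oplus>\<^bsub>B\<^esub> b') = \<beta> a b \<oplus>\<^bsub>C\<^esub> \<beta> a b'"
  "a \<in> carrier A \<Longrightarrow> b \<in> carrier B \<Longrightarrow> \<beta> (c \<odot>\<^bsub>A\<^esub> a) b = c \<odot>\<^bsub>C\<^esub> \<beta> a b"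
  "a \<in> carrier A \<Longrightarrow> b \<in> carrier B \<Longrightarrow> \<beta> a (c \<odot>\<^bsub>B\<^esub> b) = c \<odot>\<^bsub>C\<^esub> \<beta> a b"
  using \<beta> by (auto simp: bilin_def clin_hom_def)

lemma lin_ext_bilin_hom: "lin_ext C (\<lambda>(a, b). \<beta> a b) \<in> clin_hom M C"
  by (rule lin_ext_clin_hom[OF C]) (auto simp: bilin_simps)

lemma lin_ext_bilin_span:
  assumes "n \<in> bilin_span A B"
  shows "lin_ext C (\<lambda>(a, b). \<beta> a b) n = \<zero>\<^bsub>C\<^esub>"
proof -
  let ?h = "lin_ext C (\<lambda>(a, b). \<beta> a b)"
  let ?K = "{p \<in> carrier M. ?h p = \<zero>\<^bsub>C\<^esub>}"
  note h = lin_ext_bilin_hom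
  have s: "?h (single (a, b) c) = c \<odot>\<^bsub>C\<^esub> \<beta> a b" if "a \<in> carrier A" "b \<in> carrier B" for a b c
    by (subst lin_ext_single) (use C that in \<open>auto simp: bilin_simps\<close>)
  have d: "?h (p - q) = ?h p \<ominus>\<^bsub>C\<^esub> ?h q"
    if "keys p \<subseteq> carrier A \<times> carrier B" "keys q \<subseteq> carrier A \<times> carrier B" for p q
    using clin_hom_monoid_alg_diff[OF h monoid_AB C, of p q] that by simp
  have cancel: "x \<oplus>\<^bsub>C\<^esub> (y \<oplus>\<^bsub>C\<^esub> (\<ominus>\<^bsub>C\<^esub> x \<oplus>\<^bsub>C\<^esub> \<ominus>\<^bsub>C\<^esub> y)) = \<zero>\<^bsub>C\<^esub>"
    if "x \<in> carrier C" "y \<in> carrier C" for x y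
    using that by (simp add: C.a_lcomm[of y "\<ominus>\<^bsub>C\<^esub> x"] C.r_neg)
  have "submodule ?K complex_alg M"
    unfolding submodule_iff[OF calgebra_M]
    using M.zero_closed M.add.m_closed M.smult_closed clin_hom_zero[OF h calgebra_M C] clin_hom_add[OF h] clin_hom_smult[OF h]
    by auto
  moreover have "?h r = \<zero>\<^bsub>C\<^esub>" if "r \<in> bilin_rels A B" for r
    using that unfolding bilin_rels_def
    by (elim UnE CollectE exE conjE)
      (simp_all add: d s keys_diff_subset bilin_simps C.minus_eq C.a_assoc C.r_neg cancel)
  ultimately have "bilin_span A B \<subseteq> ?K"
    using bilin_rels_carrier by (intro bilin_span_minimal) auto
  then show ?thesis using assms by auto
qed

lemma tensor_lift_hom: "tensor_lift C \<beta> \<in> clin_hom (tensor A B) C"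
  using quot_alg_lift_clin_hom[OF calgebra_M bilin_span_ideal C lin_ext_bilin_hom lin_ext_bilin_span]
  by (simp add: tensor_def tensor_lift_def[abs_def])

lemma tensor_lift_pure:
  assumes "a \<in> carrier A" "b \<in> carrier B"
  shows "tensor_lift C \<beta> (pure_tensor A B a b) = \<beta> a b"
proof -
  have "tensor_lift C \<beta> (pure_tensor A B a b) = lin_ext C (\<lambda>(a, b). \<beta> a b) (single (a, b) 1)"
    unfolding tensor_lift_def pure_tensor_def
    by (rule quot_alg_lift_coset[OF calgebra_M bilin_span_ideal C lin_ext_bilin_hom lin_ext_bilin_span])
      (use assms in auto)
  then show ?thesis
    using C assms by (simp add: lin_ext_single bilin_simps)
qed

lemma tensor_lift_calg_hom:
  assumes mult: "\<And>a b a' b'. a \<in> carrier A \<Longrightarrow> b \<in> carrier B \<Longrightarrow> a' \<in> carrier A \<Longrightarrow> b' \<in> carrier B \<Longrightarrow>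
      \<beta> (a \<otimes>\<^bsub>A\<^esub> a') (b \<otimes>\<^bsub>B\<^esub> b') = \<beta> a b \<otimes>\<^bsub>C\<^esub> \<beta> a' b'"
    and one: "\<beta> \<one>\<^bsub>A\<^esub> \<one>\<^bsub>B\<^esub> = \<one>\<^bsub>C\<^esub>"
  shows "tensor_lift C \<beta> \<in> calg_hom (tensor A B) C"
proof -
  note l = tensor_lift_hom
  have "tensor_lift C \<beta> (s \<otimes>\<^bsub>tensor A B\<^esub> t) = tensor_lift C \<beta> s \<otimes>\<^bsub>C\<^esub> tensor_lift C \<beta> t"
    if s: "s \<in> carrier (tensor A B)" and t: "t \<in> carrier (tensor A B)" for s t
    using s
  proof (induction s rule: tensor_induct)
    case (pure a b)
    note ab = this
    show ?case
      using t
    proof (induction t rule: tensor_induct)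
      case (pure a' b')
      then show ?case using ab by (simp add: pure_mult tensor_lift_pure mult)
    next
      case (add s t)
      then show ?case using ab by (simp add: T.r_distr clin_hom_add[OF l] clin_hom_closed[OF l] C.r_distr)
    qed
  next
    case (add s s')
    then show ?case using t by (simp add: T.l_distr clin_hom_add[OF l] clin_hom_closed[OF l] C.l_distr)
  qed
  then show ?thesis
    using l one tensor_lift_pure[of "\<one>\<^bsub>A\<^esub>" "\<one>\<^bsub>B\<^esub>"] by (simp add: calg_hom_iff pure_one)
qed

end

end

lemma bilin_tensor_map:
  assumes f: "f \<in> clin_hom A C" and g: "g \<in> clin_hom B D" and C: "calgebra C" and D: "calgebra D"
  shows "bilin A B (tensor C D) (\<lambda>a b. pure_tensor C D (f a) (g b))"
proof -
  interpret T: tensor_algs C D using C D by unfold_locales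
  show ?thesis
    using T.pure_bilin unfolding bilin_def
    by (auto intro: clin_hom_comp[OF f] clin_hom_comp[OF g] clin_hom_closed[OF f] clin_hom_closed[OF g])
qed

lemma tensor_map_props:
  assumes A: "calgebra A" and B: "calgebra B" and C: "calgebra C" and D: "calgebra D"
    and f: "f \<in> clin_hom A C" and g: "g \<in> clin_hom B D"
  shows tensor_map_clin_hom: "tensor_map C D f g \<in> clin_hom (tensor A B) (tensor C D)"
    and tensor_map_pure: "a \<in> carrier A \<Longrightarrow> b \<in> carrier B \<Longrightarrow>
      tensor_map C D f g (pure_tensor A B a b) = pure_tensor C D (f a) (g b)"
    and tensor_map_calg_hom: "f \<in> calg_hom A C \<Longrightarrow> g \<in> calg_hom B D \<Longrightarrow>
      tensor_map C D f g \<in> calg_hom (tensor A B) (tensor C D)"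
proof -
  interpret S: tensor_algs A B using A B by unfold_locales
  interpret T: tensor_algs C D using C D by unfold_locales
  note b = bilin_tensor_map[OF f g C D]
  show "tensor_map C D f g \<in> clin_hom (tensor A B) (tensor C D)"
    unfolding tensor_map_def by (rule S.tensor_lift_hom[OF T.calgebra_tensor b])
  show "a \<in> carrier A \<Longrightarrow> b \<in> carrier B \<Longrightarrow>
      tensor_map C D f g (pure_tensor A B a b) = pure_tensor C D (f a) (g b)"
    unfolding tensor_map_def by (rule S.tensor_lift_pure[OF T.calgebra_tensor b])
  assume f': "f \<in> calg_hom A C" and g': "g \<in> calg_hom B D"
  show "tensor_map C D f g \<in> calg_hom (tensor A B) (tensor C D)"
    unfolding tensor_map_def
    by (rule S.tensor_lift_calg_hom[OF T.calgebra_tensor b])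
      (simp_all add: calg_hom_mult[OF f'] calg_hom_mult[OF g'] calg_hom_one[OF f'] calg_hom_one[OF g'] T.pure_one
         T.pure_mult calg_hom_closed[OF f'] calg_hom_closed[OF g'])
qed

section \<open>Matrices over an algebra\<close>

definition amat :: "(complex, 'a, 'm) module_scheme \<Rightarrow> ('n \<Rightarrow> 'n \<Rightarrow> 'a) \<Rightarrow> bool" where
  "amat A M \<longleftrightarrow> (\<forall>i j. M i j \<in> carrier A)"

lemma amat_closed: "amat A M \<Longrightarrow> M i j \<in> carrier A"
  by (simp add: amat_def)

lemma amat_transpose_simps [simp]:
  "amat_transpose (amat_transpose M) = M" "amat A (amat_transpose M) = amat A M"
  by (auto simp: amat_transpose_def amat_def)

lemma amat_scalar_transpose [simp]: "amat_transpose (amat_scalar A P) = amat_scalar A (transpose P)"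
  by (simp add: amat_transpose_def amat_scalar_def transpose_def)

definition amat_map :: "('a \<Rightarrow> 'b) \<Rightarrow> ('n \<Rightarrow> 'n \<Rightarrow> 'a) \<Rightarrow> 'n \<Rightarrow> 'n \<Rightarrow> 'b" where
  "amat_map h M = (\<lambda>i j. h (M i j))"

lemma amat_map_transpose: "amat_map h (amat_transpose M) = amat_transpose (amat_map h M)"
  by (simp add: amat_map_def amat_transpose_def)

context calg
begin

abbreviation mm (infixl \<open>\<cdot>\<close> 70) where "M \<cdot> N \<equiv> amat_mult A M N"
abbreviation "sc P \<equiv> amat_scalar A P"

lemma amat_mult_closed [simp]: "amat A M \<Longrightarrow> amat A N \<Longrightarrow> amat A (M \<cdot> N)"
  by (auto simp: amat_def amat_mult_def intro!: finsum_closed)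

lemma amat_scalar_closed [simp]: "amat A (sc P)"
  by (simp add: amat_def amat_scalar_def)

lemma amat_mult_assoc:
  assumes "amat A M" "amat A N" "amat A L"
  shows "M \<cdot> N \<cdot> L = M \<cdot> (N \<cdot> L)"
proof (intro ext)
  fix i j
  note c = assms[THEN amat_closed]
  have "(M \<cdot> N \<cdot> L) i j = finsum A (\<lambda>k. finsum A (\<lambda>l. M i l \<otimes> N l k \<otimes> L k j) UNIV) UNIV"
    unfolding amat_mult_def by (intro finsum_cong' finsum_ldistr) (auto simp: c intro!: finsum_closed)
  also have "\<dots> = finsum A (\<lambda>l. finsum A (\<lambda>k. M i l \<otimes> N l k \<otimes> L k j) UNIV) UNIV"
    by (rule finsum_swap) (auto simp: c)
  also have "\<dots> = (M \<cdot> (N \<cdot> L)) i j"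
    unfolding amat_mult_def
    by (intro finsum_cong') (auto simp: c finsum_rdistr m_assoc intro!: finsum_closed)
  finally show "(M \<cdot> N \<cdot> L) i j = (M \<cdot> (N \<cdot> L)) i j" .
qed

lemma amat_scalar_one:
  assumes "amat A M"
  shows "sc (mat 1) \<cdot> M = M" "M \<cdot> sc (mat 1) = M"
proof -
  note c = assms[THEN amat_closed]
  have 1: "(if i = k then 1 else 0) \<odot> \<one> \<otimes> M k j = (if i = k then M k j else \<zero>)"
    "M k j \<otimes> ((if j = i then 1 else 0) \<odot> \<one>) = (if j = i then M k j else \<zero>)" for i j k
    by (simp_all add: c)
  show "sc (mat 1) \<cdot> M = M" "M \<cdot> sc (mat 1) = M"
    by (auto simp: amat_mult_def amat_scalar_def mat_def 1 c finsum_delta intro!: ext)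
qed

lemma amat_scalar_mult: "sc P \<cdot> sc Q = sc (P ** Q)"
proof (intro ext)
  fix i j
  have "finite S \<Longrightarrow> finsum A (\<lambda>k. f k \<odot> \<one>) S = sum f S \<odot> \<one>" for f and S :: "'b set"
    by (induction S rule: finite_induct) (simp_all add: smult_l_distr)
  then show "(sc P \<cdot> sc Q) i j = sc (P ** Q) i j"
    by (simp add: amat_mult_def amat_scalar_def matrix_matrix_mult_def mult.commute)
qed

text \<open>Transposition does not reverse products over a noncommutative algebra in general.
  Entrywise commutation rescues the rule, and it is available for scalar factors and for the two
  legs of a tensor product.\<close>

lemma amat_transpose_mult:
  assumes "\<And>i j k. M i k \<otimes> N k j = N k j \<otimes> M i k"
  shows "amat_transpose (M \<cdot> N) = amat_transpose N \<cdot> amat_transpose M"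
  by (simp add: amat_transpose_def amat_mult_def assms)

lemma amat_transpose_scalar_mult:
  assumes "amat A M"
  shows "amat_transpose (sc P \<cdot> M) = amat_transpose M \<cdot> sc (transpose P)"
    "amat_transpose (M \<cdot> sc P) = sc (transpose P) \<cdot> amat_transpose M"
proof -
  have "sc P i k \<otimes> M k j = M k j \<otimes> sc P i k" "M i k \<otimes> sc P k j = sc P k j \<otimes> M i k" for i j k
    using amat_closed[OF assms] by (simp_all add: amat_scalar_def)
  note c = this
  show "amat_transpose (sc P \<cdot> M) = amat_transpose M \<cdot> sc (transpose P)"
    "amat_transpose (M \<cdot> sc P) = sc (transpose P) \<cdot> amat_transpose M"
    by (simp_all add: amat_transpose_mult[OF c(1)] amat_transpose_mult[OF c(2)])
qed

text \<open>Rewriting with this equation removes the opposite algebra, so that relations for the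
  antipode become ordinary matrix identities.\<close>

lemma amat_mult_opposite:
  "amat_mult (opposite_alg A) M N = amat_transpose (amat_transpose N \<cdot> amat_transpose M)"
  by (simp add: amat_mult_def amat_transpose_def)

lemma amat_scalar_mult_left: "amat A M \<Longrightarrow> sc P \<cdot> (sc Q \<cdot> M) = sc (P ** Q) \<cdot> M"
  by (simp add: amat_mult_assoc[symmetric] amat_scalar_mult)

lemma amat_cancel:
  assumes "amat A M" "amat A N" "amat A L" "M \<cdot> N = R"
  shows "M \<cdot> (N \<cdot> L) = R \<cdot> L"
  using assms by (simp add: amat_mult_assoc[symmetric])

text \<open>The usual argument N = (L M) N = L (M N) = L; it later identifies matrices that would be
  tedious to compare entry by entry.\<close>

lemma amat_inverse_unique:
  assumes "amat A M" "amat A N" "amat A L" "M \<cdot> N = sc (mat 1)" "L \<cdot> M = sc (mat 1)"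
  shows "N = L"
  using assms by (metis amat_mult_assoc amat_scalar_one)

lemma amat_twist_alt: "amat_twist A P x Q = sc P \<cdot> amat_transpose x \<cdot> sc Q"
  by (simp add: amat_twist_def)

end

lemma amat_scalar_opposite [simp]: "amat_scalar (opposite_alg A) P = amat_scalar A P"
  by (simp add: amat_scalar_def)

lemma amat_map_hom:
  assumes h: "h \<in> calg_hom A B" and A: "calgebra A" and B: "calgebra B"
  shows amat_map_closed: "amat A M \<Longrightarrow> amat B (amat_map h M)"
    and amat_map_mult: "amat A M \<Longrightarrow> amat A N \<Longrightarrow>
      amat_map h (amat_mult A M N) = amat_mult B (amat_map h M) (amat_map h N)"
    and amat_map_scalar: "amat_map h (amat_scalar A P) = amat_scalar B P"
proof -
  interpret A: calg A using A by (simp add: calgebra_iff_calg)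
  note l = calg_hom_clin[OF h]
  show "amat A M \<Longrightarrow> amat B (amat_map h M)"
    by (simp add: amat_def amat_map_def calg_hom_closed[OF h])
  show "amat A M \<Longrightarrow> amat A N \<Longrightarrow>
      amat_map h (amat_mult A M N) = amat_mult B (amat_map h M) (amat_map h N)"
    by (simp add: amat_map_def amat_mult_def clin_hom_finsum[OF l A B] amat_closed calg_hom_mult[OF h])
  show "amat_map h (amat_scalar A P) = amat_scalar B P"
    by (simp add: amat_map_def amat_scalar_def calg_hom_smult[OF h] calg_hom_one[OF h])
qed

text \<open>
  The relations of \<open>\<B>(E)\<close> and \<open>\<H>(F)\<close> with the outer scalar factors moved to the right-hand side,
  where \<open>E'\<close> and \<open>F'\<close> stand for the inverse matrices.
\<close>

definition Brel :: "(complex, 'a, 'm) module_scheme \<Rightarrow> complex^'n::finite^'n \<Rightarrow> complex^'n^'n \<Rightarrow>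
    ('n \<Rightarrow> 'n \<Rightarrow> 'a) \<Rightarrow> bool" where
  "Brel A E E' x \<longleftrightarrow> amat A x \<and>
     amat_mult A x (amat_mult A (amat_scalar A E') (amat_transpose x)) = amat_scalar A E' \<and>
     amat_mult A (amat_transpose x) (amat_mult A (amat_scalar A E) x) = amat_scalar A E"

definition Hrel :: "(complex, 'a, 'm) module_scheme \<Rightarrow> complex^'n::finite^'n \<Rightarrow> complex^'n^'n \<Rightarrow>
    ('n \<Rightarrow> 'n \<Rightarrow> 'a) \<Rightarrow> ('n \<Rightarrow> 'n \<Rightarrow> 'a) \<Rightarrow> bool" where
  "Hrel A F F' u v \<longleftrightarrow> amat A u \<and> amat A v \<and>
     amat_mult A u (amat_transpose v) = amat_scalar A (mat 1) \<and>
     amat_mult A (amat_transpose v) u = amat_scalar A (mat 1) \<and>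
     amat_mult A v (amat_mult A (amat_scalar A F) (amat_transpose u)) = amat_scalar A F \<and>
     amat_mult A (amat_transpose u) (amat_mult A (amat_scalar A F') v) = amat_scalar A F'"

lemma Brel_map:
  assumes h: "h \<in> calg_hom A B" and A: "calgebra A" and B: "calgebra B" and x: "Brel A E E' x"
  shows "Brel B E E' (amat_map h x)"
proof -
  interpret A: calg A using A by (simp add: calgebra_iff_calg)
  note m = amat_map_mult[OF h A B, symmetric] amat_map_scalar[OF h A B, symmetric]
    amat_map_transpose[of h, symmetric]
  show ?thesis
    using x unfolding Brel_def by (simp add: m amat_map_closed[OF h A B])
qed

lemma Hrel_map:
  assumes h: "h \<in> calg_hom A B" and A: "calgebra A" and B: "calgebra B" and x: "Hrel A F F' u v"
  shows "Hrel B F F' (amat_map h u) (amat_map h v)"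
proof -
  interpret A: calg A using A by (simp add: calgebra_iff_calg)
  note m = amat_map_mult[OF h A B, symmetric] amat_map_scalar[OF h A B, symmetric]
    amat_map_transpose[of h, symmetric]
  show ?thesis
    using x unfolding Hrel_def by (simp add: m amat_map_closed[OF h A B])
qed

section \<open>Solutions of the matrix relations in an arbitrary algebra\<close>

context calg
begin

text \<open>Products are normalised by bracketing to the right. A relation must then also fire in
  front of a further factor \<open>Y\<close>, which the last two rules provide.\<close>

lemma Brel_simps:
  assumes "Brel A E E' x"
  shows "amat A x" "x \<cdot> (sc E' \<cdot> amat_transpose x) = sc E'" "amat_transpose x \<cdot> (sc E \<cdot> x) = sc E"
    "amat A Y \<Longrightarrow> x \<cdot> (sc E' \<cdot> (amat_transpose x \<cdot> Y)) = sc E' \<cdot> Y"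
    "amat A Y \<Longrightarrow> amat_transpose x \<cdot> (sc E \<cdot> (x \<cdot> Y)) = sc E \<cdot> Y"
proof -
  show x: "amat A x" and 1: "x \<cdot> (sc E' \<cdot> amat_transpose x) = sc E'"
    and 2: "amat_transpose x \<cdot> (sc E \<cdot> x) = sc E"
    using assms by (simp_all add: Brel_def)
  show "amat A Y \<Longrightarrow> x \<cdot> (sc E' \<cdot> (amat_transpose x \<cdot> Y)) = sc E' \<cdot> Y"
    using x arg_cong[OF 1, of "\<lambda>M. M \<cdot> Y"] by (simp add: amat_mult_assoc)
  show "amat A Y \<Longrightarrow> amat_transpose x \<cdot> (sc E \<cdot> (x \<cdot> Y)) = sc E \<cdot> Y"
    using x arg_cong[OF 2, of "\<lambda>M. M \<cdot> Y"] by (simp add: amat_mult_assoc)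
qed

lemma Hrel_simps:
  assumes "Hrel A F F' u v"
  shows "amat A u" "amat A v" "u \<cdot> amat_transpose v = sc (mat 1)" "amat_transpose v \<cdot> u = sc (mat 1)"
    "v \<cdot> (sc F \<cdot> amat_transpose u) = sc F" "amat_transpose u \<cdot> (sc F' \<cdot> v) = sc F'"
    "amat A Y \<Longrightarrow> u \<cdot> (amat_transpose v \<cdot> Y) = Y" "amat A Y \<Longrightarrow> amat_transpose v \<cdot> (u \<cdot> Y) = Y"
    "amat A Y \<Longrightarrow> v \<cdot> (sc F \<cdot> (amat_transpose u \<cdot> Y)) = sc F \<cdot> Y"
    "amat A Y \<Longrightarrow> amat_transpose u \<cdot> (sc F' \<cdot> (v \<cdot> Y)) = sc F' \<cdot> Y"
proof -
  show u: "amat A u" and v: "amat A v" and 1: "u \<cdot> amat_transpose v = sc (mat 1)"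
    and 2: "amat_transpose v \<cdot> u = sc (mat 1)"
    and 3: "v \<cdot> (sc F \<cdot> amat_transpose u) = sc F" and 4: "amat_transpose u \<cdot> (sc F' \<cdot> v) = sc F'"
    using assms by (simp_all add: Hrel_def)
  assume Y: "amat A Y"
  show "u \<cdot> (amat_transpose v \<cdot> Y) = Y"
    using u v Y amat_cancel[OF _ _ _ 1, of Y] by (simp add: amat_scalar_one)
  show "amat_transpose v \<cdot> (u \<cdot> Y) = Y"
    using u v Y amat_cancel[OF _ _ _ 2, of Y] by (simp add: amat_scalar_one)
  show "v \<cdot> (sc F \<cdot> (amat_transpose u \<cdot> Y)) = sc F \<cdot> Y"
    using u v Y arg_cong[OF 3, of "\<lambda>M. M \<cdot> Y"] by (simp add: amat_mult_assoc)
  show "amat_transpose u \<cdot> (sc F' \<cdot> (v \<cdot> Y)) = sc F' \<cdot> Y"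
    using u v Y arg_cong[OF 4, of "\<lambda>M. M \<cdot> Y"] by (simp add: amat_mult_assoc)
qed

text \<open>Over \<open>complex_alg\<close> this solution is the counit.\<close>

lemma Brel_one: "Brel A E E' (sc (mat 1))"
  by (simp add: Brel_def amat_scalar_mult)

lemma Hrel_one: "Hrel A F F' (sc (mat 1)) (sc (mat 1))"
  by (simp add: Hrel_def amat_scalar_mult)

text \<open>Commutation gives (x y)^t = y^t x^t, so that x y E' y^t x^t collapses from the inside to
  x E' x^t = E'; likewise y^t x^t E x y collapses to E.\<close>

lemma Brel_mult:
  assumes x: "Brel A E E' x" and y: "Brel A E E' y"
    and comm: "\<And>i j k l. x i j \<otimes> y k l = y k l \<otimes> x i j"
  shows "Brel A E E' (x \<cdot> y)"
proof -
  note s = Brel_simps[OF x] Brel_simps[OF y]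
  show ?thesis
    unfolding Brel_def by (simp add: s amat_transpose_mult[OF comm] amat_mult_assoc)
qed

lemma Hrel_mult:
  assumes u: "Hrel A F F' u v" and y: "Hrel A F F' u' v'"
    and comm: "\<And>i j k l. u i j \<otimes> u' k l = u' k l \<otimes> u i j" "\<And>i j k l. v i j \<otimes> v' k l = v' k l \<otimes> v i j"
  shows "Hrel A F F' (u \<cdot> u') (v \<cdot> v')"
proof -
  note s = Hrel_simps[OF u] Hrel_simps[OF y]
  show ?thesis
    unfolding Hrel_def by (simp add: s amat_transpose_mult[OF comm(1)] amat_transpose_mult[OF comm(2)] amat_mult_assoc)
qed

lemma amat_transpose_eq_iff: "amat_transpose M = N \<longleftrightarrow> M = amat_transpose N"
  by auto

text \<open>Transposing the relations in the opposite algebra turns them into relations for \<open>E\<^sup>t\<close> in the algebra.\<close>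

lemma Brel_opposite:
  fixes E :: "complex^'n::finite^'n"
  assumes x: "Brel A E E' x" and E: "E ** E' = mat 1" "E' ** E = mat 1"
  shows "Brel (opposite_alg A) E E' (sc E' \<cdot> amat_transpose x \<cdot> sc E)"
proof -
  note s = Brel_simps[OF x]
  have E': "transpose E ** transpose E' = mat 1" "transpose E' ** transpose E = mat 1"
    using E by (simp_all add: transpose_mat flip: matrix_transpose_mul)
  have E'': "transpose E ** (transpose E' ** P) = P" "transpose E' ** (transpose E ** P) = P"
    "E ** (E' ** P) = P" "E' ** (E ** P) = P" for P
    by (simp_all add: matrix_mul_assoc E E')
  have op: "amat (opposite_alg A) M = amat A M" for M :: "'n \<Rightarrow> 'n \<Rightarrow> 'a"
    by (simp add: amat_def)
  show ?thesis
    unfolding Brel_def amat_mult_opposite op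
    by (simp add: s amat_mult_assoc amat_transpose_scalar_mult amat_scalar_mult_left amat_scalar_mult
        amat_scalar_one E E' E'' amat_transpose_eq_iff matrix_mul_assoc[symmetric])
qed

text \<open>Put U = v^t and V = F u^t F', the prescribed antipode values. The opposite product of U
  and V^t is the transpose of V U^t = F u^t F' v, which equals 1 because u^t F' v = F'. The other
  three relations are reversed in the same manner.\<close>

lemma Hrel_opposite:
  fixes F :: "complex^'n::finite^'n"
  assumes u: "Hrel A F F' u v" and F: "F ** F' = mat 1" "F' ** F = mat 1"
  shows "Hrel (opposite_alg A) F F' (amat_transpose v) (sc F \<cdot> amat_transpose u \<cdot> sc F')"
proof -
  note s = Hrel_simps[OF u]
  have F': "transpose F ** transpose F' = mat 1" "transpose F' ** transpose F = mat 1"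
    using F by (simp_all add: transpose_mat flip: matrix_transpose_mul)
  have F'': "transpose F ** (transpose F' ** P) = P" "transpose F' ** (transpose F ** P) = P"
    "F ** (F' ** P) = P" "F' ** (F ** P) = P" for P
    by (simp_all add: matrix_mul_assoc F F')
  have op: "amat (opposite_alg A) M = amat A M" for M :: "'n \<Rightarrow> 'n \<Rightarrow> 'a"
    by (simp add: amat_def)
  show ?thesis
    unfolding Hrel_def amat_mult_opposite op
    by (simp add: s amat_mult_assoc amat_transpose_scalar_mult amat_scalar_mult_left amat_scalar_mult
        amat_scalar_one F F' F'' amat_transpose_eq_iff transpose_mat matrix_mul_assoc[symmetric])
qed

lemma Hrel_unique:
  assumes "Hrel A F F' u v" "Hrel A F F' u v'"
  shows "v = v'"
proof -
  note s = Hrel_simps[OF assms(1)] Hrel_simps[OF assms(2)]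
  have "amat_transpose v = amat_transpose v'"
    by (rule amat_inverse_unique[of u]) (simp_all add: s)
  then show ?thesis by (metis amat_transpose_simps(1))
qed

text \<open>The element g commutes with scalars and cancels in pairs, so u v^t = x g g E' x^t E = 1.
  The choice of F gives E'^t F = E', whence v F u^t = E^t g (x E' x^t) g = E^t E' = F. Similarly u^t
  F' v reduces to x^t E x E'^t = E E'^t, the inverse of F.\<close>

lemma Hrel_of_Brel:
  fixes E :: "complex^'n::finite^'n"
  assumes x: "Brel A E E' x" and E: "E ** E' = mat 1" "E' ** E = mat 1"
    and g: "g \<in> carrier A" "g \<otimes> g = \<one>"
  shows "Hrel A (transpose E ** E') (E ** transpose E') (\<lambda>i j. x i j \<otimes> g)
    (sc (transpose E) \<cdot> (\<lambda>i j. g \<otimes> x i j) \<cdot> sc (transpose E'))"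
proof -
  note s = Brel_simps[OF x]
  \<comment> \<open>Writing multiplication by g as a product with the diagonal matrix g I lets
    associativity and cancellation run entirely on matrices.\<close>
  define G :: "'n \<Rightarrow> 'n \<Rightarrow> 'a" where "G = (\<lambda>i j. if i = j then g else \<zero>)"
  have G: "amat A G" "amat_transpose G = G" using g by (auto simp: amat_def G_def amat_transpose_def intro!: ext)
  have *: "(if i = k then g else \<zero>) \<otimes> y = (if i = k then g \<otimes> y else \<zero>)"
    "y \<otimes> (if i = k then g else \<zero>) = (if i = k then y \<otimes> g else \<zero>)" if "y \<in> carrier A" for i k :: 'n and y
    using that by auto
  have Gl: "G \<cdot> M = (\<lambda>i j. g \<otimes> M i j)" and Gr: "M \<cdot> G = (\<lambda>i j. M i j \<otimes> g)" if "amat A M" for M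
    using that g by (auto simp: amat_mult_def G_def * amat_closed finsum_delta intro!: ext)
  have GG: "G \<cdot> G = sc (mat 1)"
    unfolding Gl[OF G(1)] using g by (auto simp: amat_scalar_def mat_def G_def intro!: ext)
  have GS: "G \<cdot> sc P = sc P \<cdot> G" for P
    unfolding Gl[OF amat_scalar_closed] Gr[OF amat_scalar_closed] using g by (simp add: amat_scalar_def)
  have GS': "G \<cdot> (sc P \<cdot> Y) = sc P \<cdot> (G \<cdot> Y)" if "amat A Y" for P Y
    using that G by (simp add: GS flip: amat_mult_assoc)
  have GG': "G \<cdot> (G \<cdot> Y) = Y" if "amat A Y" for Y
    using that G by (simp add: GG amat_scalar_one flip: amat_mult_assoc)
  have t: "amat_transpose (M \<cdot> G) = amat_transpose M \<cdot> G" "amat_transpose (G \<cdot> M) = G \<cdot> amat_transpose M"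
    if "amat A M" for M
    using that by (simp_all add: Gl[of M] Gr[of M] Gl[of "amat_transpose M"] Gr[of "amat_transpose M"])
      (simp_all add: amat_transpose_def)
  have E': "transpose E ** transpose E' = mat 1" "transpose E' ** transpose E = mat 1"
    using E by (simp_all add: transpose_mat flip: matrix_transpose_mul)
  have E'': "transpose E ** (transpose E' ** P) = P" "transpose E' ** (transpose E ** P) = P"
    "E ** (E' ** P) = P" "E' ** (E ** P) = P" for P
    by (simp_all add: matrix_mul_assoc E E')
  have "Hrel A (transpose E ** E') (E ** transpose E') (x \<cdot> G) (sc (transpose E) \<cdot> (G \<cdot> x) \<cdot> sc (transpose E'))"
    unfolding Hrel_def
    by (simp add: s G t GS GS' GG GG' amat_mult_assoc amat_transpose_scalar_mult amat_scalar_mult_left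
        amat_scalar_mult amat_scalar_one E E' E'' matrix_mul_assoc[symmetric])
  then show ?thesis using s(1) by (simp add: Gl Gr)
qed

end

section \<open>Two by two matrices over an algebra, in block form\<close>

definition mat_alg :: "(complex, 'a, 'm) module_scheme \<Rightarrow> (complex, bool \<Rightarrow> bool \<Rightarrow> 'a) module" where
  "mat_alg A = \<lparr>carrier = {M. amat A M}, mult = amat_mult A,
     one = amat_scalar A (mat 1 :: complex^bool^bool),
     zero = (\<lambda>i j. \<zero>\<^bsub>A\<^esub>), add = (\<lambda>M N i j. M i j \<oplus>\<^bsub>A\<^esub> N i j), smult = (\<lambda>c M i j. c \<odot>\<^bsub>A\<^esub> M i j)\<rparr>"

lemma mat_alg_simps [simp]:
  "carrier (mat_alg A) = {M. amat A M}" "mult (mat_alg A) = amat_mult A"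
  "\<one>\<^bsub>mat_alg A\<^esub> = amat_scalar A (mat 1)"
  "\<zero>\<^bsub>mat_alg A\<^esub> = (\<lambda>i j. \<zero>\<^bsub>A\<^esub>)" "M \<oplus>\<^bsub>mat_alg A\<^esub> N = (\<lambda>i j. M i j \<oplus>\<^bsub>A\<^esub> N i j)"
  "c \<odot>\<^bsub>mat_alg A\<^esub> M = (\<lambda>i j. c \<odot>\<^bsub>A\<^esub> M i j)"
  by (simp_all add: mat_alg_def)

context calg
begin

lemma calgebra_mat_alg: "calgebra (mat_alg A)"
proof -
  have bool_sum: "finsum A f UNIV = f True \<oplus> f False" if "\<And>b. f b \<in> carrier A" for f
    using that by (simp add: UNIV_bool finsum_insert a_comm)
  have mult: "amat A M \<Longrightarrow> amat A N \<Longrightarrow> (M \<cdot> N) i j = M i True \<otimes> N True j \<oplus> M i False \<otimes> N False j"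
    for M N i j
    unfolding amat_mult_def by (rule bool_sum) (simp add: amat_closed)
  have "ring (mat_alg A)"
  proof (rule ringI)
    show "abelian_group (mat_alg A)"
    proof (rule abelian_groupI)
      fix M assume "M \<in> carrier (mat_alg A)"
      then show "\<exists>N\<in>carrier (mat_alg A). N \<oplus>\<^bsub>mat_alg A\<^esub> M = \<zero>\<^bsub>mat_alg A\<^esub>"
        by (intro bexI[of _ "\<lambda>i j. \<ominus> M i j"]) (auto simp: amat_def l_neg)
    qed (auto simp: amat_def a_ac)
    show "Group.monoid (mat_alg A)"
      by (rule monoidI) (auto simp: amat_mult_assoc amat_scalar_one)
  qed (auto intro!: ext simp: mult amat_closed l_distr r_distr a_ac, auto simp: amat_def mult l_distr r_distr a_ac)
  moreover have "calg_axioms (mat_alg A)"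
    by standard (auto intro!: ext simp: mult amat_closed smult_l_distr smult_r_distr amat_def)
  ultimately show ?thesis by (simp add: calgebra_iff_calg calg_def)
qed

lemma mat_alg_entry_hom: "(\<lambda>M. M p q) \<in> clin_hom (mat_alg A) A"
  by (rule clin_homI) (auto simp: amat_def)

text \<open>A matrix of 2 x 2 matrices is the same as a 2 x 2 array of matrices of the outer size.
  Fixing the inner indices p and q and splitting the inner sum over the two Booleans yields block
  multiplication.\<close>

lemma mat_alg_amat_mult:
  assumes X: "amat (mat_alg A) X" and Y: "amat (mat_alg A) Y"
  shows "amat_mult (mat_alg A) X Y i j p q =
    (amat_map (\<lambda>M. M p True) X \<cdot> amat_map (\<lambda>M. M True q) Y) i j \<oplus>
    (amat_map (\<lambda>M. M p False) X \<cdot> amat_map (\<lambda>M. M False q) Y) i j"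
proof -
  have c: "X i j p q \<in> carrier A" "Y i j p q \<in> carrier A" for i j p q
    using amat_closed[OF X, of i j] amat_closed[OF Y, of i j] by (simp_all add: amat_def)
  have bool_sum: "finsum A f UNIV = f True \<oplus> f False" if "\<And>b. f b \<in> carrier A" for f
    using that by (simp add: UNIV_bool finsum_insert a_comm)
  have "amat_mult (mat_alg A) X Y i j p q = finsum A (\<lambda>k. (X i k \<cdot> Y k j) p q) UNIV"
    using clin_hom_finsum[OF mat_alg_entry_hom[of p q] calgebra_mat_alg, of "\<lambda>k. X i k \<cdot> Y k j" UNIV]
      amat_closed[OF X] amat_closed[OF Y] calg_axioms
    by (simp add: calgebra_iff_calg amat_mult_def[of "mat_alg A"])
  also have "\<dots> = finsum A (\<lambda>k. X i k p True \<otimes> Y k j True q \<oplus> X i k p False \<otimes> Y k j False q) UNIV"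
    by (intro finsum_cong') (auto simp: amat_mult_def bool_sum c)
  also have "\<dots> = (amat_map (\<lambda>M. M p True) X \<cdot> amat_map (\<lambda>M. M True q) Y) i j \<oplus>
    (amat_map (\<lambda>M. M p False) X \<cdot> amat_map (\<lambda>M. M False q) Y) i j"
    by (simp add: amat_mult_def amat_map_def finsum_addf c)
  finally show ?thesis .
qed

text \<open>Block-diagonal (\<open>d = True\<close>) and block-antidiagonal
  (\<open>d = False\<close>) matrices are treated together because this parity is multiplicative.
  The index \<open>True\<close> denotes the upper row and the left column, so \<open>U\<close> lies
  in the upper row for either parity.\<close>

definition blocks :: "bool \<Rightarrow> ('n \<Rightarrow> 'n \<Rightarrow> 'a) \<Rightarrow> ('n \<Rightarrow> 'n \<Rightarrow> 'a) \<Rightarrow> 'n \<Rightarrow> 'n \<Rightarrow> bool \<Rightarrow> bool \<Rightarrow> 'a" where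
  "blocks d U W i j = (\<lambda>p q. if (p = q) = d then if p then U i j else W i j else \<zero>)"

lemma blocks_closed: "amat A U \<Longrightarrow> amat A W \<Longrightarrow> amat (mat_alg A) (blocks d U W)"
  by (auto simp: amat_def blocks_def)

text \<open>Only the outer indices are transposed. The inner 2 x 2 positions stay fixed, so
  antidiagonal blocks do not change places.\<close>

lemma blocks_transpose: "amat_transpose (blocks d U W) = blocks d (amat_transpose U) (amat_transpose W)"
  by (auto simp: amat_transpose_def blocks_def intro!: ext)

lemma blocks_scalar: "amat_scalar (mat_alg A) P = blocks True (sc P) (sc P)"
  by (auto simp: amat_scalar_def blocks_def mat_def intro!: ext)

lemma blocks_mult:
  fixes U :: "'n::finite \<Rightarrow> 'n \<Rightarrow> 'a"
  assumes "amat A U" "amat A W" "amat A U'" "amat A W'"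
  shows "amat_mult (mat_alg A) (blocks d U W) (blocks d' U' W') =
    blocks (d = d') (U \<cdot> (if d then U' else W')) (W \<cdot> (if d then W' else U'))"
proof (intro ext)
  fix i j p q
  have 0: "amat A (\<lambda>i j. \<zero>)" by (simp add: amat_def)
  have z: "(M \<cdot> (\<lambda>i j. \<zero>)) i j = \<zero>" "((\<lambda>i j. \<zero>) \<cdot> M) i j = \<zero>" if "amat A M" for M :: "'n \<Rightarrow> 'n \<Rightarrow> 'a" and i j
    using amat_closed[OF that] by (simp_all add: amat_mult_def)
  have m: "amat_map (\<lambda>M. M p q) (blocks d U W) = (if (p = q) = d then if p then U else W else (\<lambda>i j. \<zero>))" for p q d U W
    by (auto simp: amat_map_def blocks_def)
  have c: "(M \<cdot> N) i j \<in> carrier A" if "amat A M" "amat A N" for M N :: "'n \<Rightarrow> 'n \<Rightarrow> 'a" and i j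
    using that by (intro amat_closed amat_mult_closed)
  show "amat_mult (mat_alg A) (blocks d U W) (blocks d' U' W') i j p q =
    blocks (d = d') (U \<cdot> (if d then U' else W')) (W \<cdot> (if d then W' else U')) i j p q"
    by (subst mat_alg_amat_mult) (use assms in \<open>auto simp: blocks_closed m blocks_def z c 0\<close>)
qed

text \<open>Let w = E'^t v E^t, so w^t = E v^t E'. The diagonal blocks of x E' x^t are u E' w^t = u
  v^t E' = E' and w E' u^t = E'^t v F u^t = E'^t F = E'. Those of x^t E x are u^t E w = u^t F' v E^t
  = E and w^t E u = E v^t u = E. Thus each of the four relations of H(F) accounts for one
  block.\<close>

lemma Brel_blocks:
  fixes E :: "complex^'n::finite^'n"
  assumes u: "Hrel A (transpose E ** E') (E ** transpose E') u v" and E: "E ** E' = mat 1" "E' ** E = mat 1"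
  shows "Brel (mat_alg A) E E' (blocks False u (sc (transpose E') \<cdot> v \<cdot> sc (transpose E)))"
proof -
  note s = Hrel_simps[OF u]
  have E': "transpose E ** transpose E' = mat 1" "transpose E' ** transpose E = mat 1"
    using E by (simp_all add: transpose_mat flip: matrix_transpose_mul)
  have E'': "transpose E ** (transpose E' ** P) = P" "transpose E' ** (transpose E ** P) = P"
    "E ** (E' ** P) = P" "E' ** (E ** P) = P" for P
    by (simp_all add: matrix_mul_assoc E E')
  show ?thesis
    unfolding Brel_def blocks_transpose blocks_scalar
    by (simp add: s blocks_closed blocks_mult amat_mult_assoc amat_transpose_scalar_mult amat_scalar_mult_left
        amat_scalar_mult amat_scalar_one E E' E'' matrix_mul_assoc[symmetric])
qed

end

section \<open>Hopf algebras generated by matrix coalgebras\<close>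

text \<open>Multiplicativity is the point: it makes the two sides of coassociativity algebra
  homomorphisms, so that equality can be tested on generators.\<close>

lemma tensor_assoc_props:
  assumes A: "calgebra A" and B: "calgebra B" and C: "calgebra C"
  shows tensor_assoc_pure: "a \<in> carrier A \<Longrightarrow> b \<in> carrier B \<Longrightarrow> c \<in> carrier C \<Longrightarrow>
      tensor_assoc A B C (pure_tensor (tensor A B) C (pure_tensor A B a b) c) =
        pure_tensor A (tensor B C) a (pure_tensor B C b c)"
    and tensor_assoc_hom: "tensor_assoc A B C \<in> calg_hom (tensor (tensor A B) C) (tensor A (tensor B C))"
proof -
  interpret AB: tensor_algs A B using A B by unfold_locales
  interpret BC: tensor_algs B C using B C by unfold_locales
  interpret L: tensor_algs "tensor A B" C using AB.calgebra_tensor C by unfold_locales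
  interpret R: tensor_algs A "tensor B C" using A BC.calgebra_tensor by unfold_locales
  let ?T = "tensor A (tensor B C)"
  interpret T: calg ?T using R.calgebra_tensor by (simp add: calgebra_iff_calg)
  interpret tAB: calg "tensor A B" using AB.calgebra_tensor by (simp add: calgebra_iff_calg)
  interpret cA: calg A using A by (simp add: calgebra_iff_calg)
  interpret cB: calg B using B by (simp add: calgebra_iff_calg)
  interpret cC: calg C using C by (simp add: calgebra_iff_calg)
  let ?\<beta> = "\<lambda>c a b. pure_tensor A (tensor B C) a (pure_tensor B C b c)"
  note Rb = R.bilin_simps[OF R.calgebra_tensor R.pure_bilin]
  note Bb = BC.bilin_simps[OF BC.calgebra_tensor BC.pure_bilin]
  have b: "bilin A B ?T (?\<beta> c)" if "c \<in> carrier C" for c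
    unfolding bilin_def using that by (intro conjI ballI clin_homI) (simp_all add: Rb Bb)
  let ?\<gamma> = "\<lambda>t c. tensor_lift ?T (?\<beta> c) t"
  note l = AB.tensor_lift_hom[OF R.calgebra_tensor b]
  note p = AB.tensor_lift_pure[OF R.calgebra_tensor b]
  note g = clin_hom_add[OF l] clin_hom_closed[OF l] clin_hom_smult[OF l] p
  have g1: "?\<gamma> t (c \<oplus>\<^bsub>C\<^esub> d) = ?\<gamma> t c \<oplus>\<^bsub>?T\<^esub> ?\<gamma> t d"
    if c: "c \<in> carrier C" "d \<in> carrier C" and t: "t \<in> carrier (tensor A B)" for t c d
    using t
  proof (induction t rule: AB.tensor_induct)
    case (pure a b)
    then show ?case using c by (simp add: p Rb Bb)
  next
    case (add s t)
    then show ?case using c by (simp add: g T.a_ac)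
  qed
  have g2: "?\<gamma> t (k \<odot>\<^bsub>C\<^esub> c) = k \<odot>\<^bsub>?T\<^esub> ?\<gamma> t c"
    if c: "c \<in> carrier C" and t: "t \<in> carrier (tensor A B)" for t c k
    using t
  proof (induction t rule: AB.tensor_induct)
    case (pure a b)
    then show ?case using c by (simp add: p Rb Bb)
  next
    case (add s t)
    then show ?case using c by (simp add: g T.smult_r_distr)
  qed
  have bg: "bilin (tensor A B) C ?T ?\<gamma>"
    unfolding bilin_def by (intro conjI ballI clin_homI) (simp_all add: g g1 g2)
  have gm: "?\<gamma> (s \<otimes>\<^bsub>tensor A B\<^esub> t) (c \<otimes>\<^bsub>C\<^esub> d) = ?\<gamma> s c \<otimes>\<^bsub>?T\<^esub> ?\<gamma> t d"
    if c: "c \<in> carrier C" "d \<in> carrier C" and s: "s \<in> carrier (tensor A B)" and t: "t \<in> carrier (tensor A B)" for s t c d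
    using s
  proof (induction s rule: AB.tensor_induct)
    case (pure a b)
    note ab = this
    show ?case
      using t
    proof (induction t rule: AB.tensor_induct)
      case (pure a' b')
      then show ?case using ab c by (simp add: p AB.pure_mult R.pure_mult BC.pure_mult)
    next
      case (add s t)
      then show ?case using ab c by (simp add: tAB.r_distr g T.r_distr Rb Bb)
    qed
  next
    case (add s s')
    then show ?case using t c by (simp add: tAB.l_distr g T.l_distr)
  qed
  have go: "?\<gamma> \<one>\<^bsub>tensor A B\<^esub> \<one>\<^bsub>C\<^esub> = \<one>\<^bsub>?T\<^esub>"
    using p[of "\<one>\<^bsub>C\<^esub>" "\<one>\<^bsub>A\<^esub>" "\<one>\<^bsub>B\<^esub>"] by (simp add: AB.pure_one BC.pure_one R.pure_one)
  show "tensor_assoc A B C \<in> calg_hom (tensor (tensor A B) C) (tensor A (tensor B C))"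
    unfolding tensor_assoc_def by (rule L.tensor_lift_calg_hom[OF R.calgebra_tensor bg gm go])
  show "tensor_assoc A B C (pure_tensor (tensor A B) C (pure_tensor A B a b) c) =
        pure_tensor A (tensor B C) a (pure_tensor B C b c)"
    if "a \<in> carrier A" "b \<in> carrier B" "c \<in> carrier C"
    unfolding tensor_assoc_def using that by (simp add: L.tensor_lift_pure[OF R.calgebra_tensor bg] p)
qed

lemma amat_comult_closed:
  assumes "calgebra A" "amat A x"
  shows "amat (tensor A A) (amat_comult A x)"
proof -
  interpret T: tensor_algs A A using assms by unfold_locales
  interpret t: calg "tensor A A" using T.calgebra_tensor by (simp add: calgebra_iff_calg)
  show ?thesis
    using assms(2) by (auto simp: amat_def amat_comult_def intro!: t.finsum_closed)
qed

lemma tensor_lift_amat_comult: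
  assumes "calgebra A" "calgebra C" "amat A x" "bilin A A C \<beta>"
  shows "tensor_lift C \<beta> (amat_comult A x i j) = finsum C (\<lambda>k. \<beta> (x i k) (x k j)) UNIV"
proof -
  interpret T: tensor_algs A A using assms by unfold_locales
  show ?thesis
    using assms(3) unfolding amat_comult_def
    by (simp add: clin_hom_finsum[OF T.tensor_lift_hom[OF assms(2,4)] T.calgebra_tensor assms(2)]
        T.tensor_lift_pure[OF assms(2,4)] amat_closed)
qed

text \<open>Coassociativity and the counit laws are equalities of algebra homomorphisms and hold
  once they hold on the entries of the matrices in \<open>\<M>\<close>. The antipode laws are not of
  this kind; for them the set of elements satisfying the law is shown to be a subalgebra.\<close>

lemma hopf_algebra_of_matrices:
  fixes H :: "'a hopf" (structure) and \<M> :: "('n::finite \<Rightarrow> 'n \<Rightarrow> 'a) set"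
  assumes H: "calgebra H"
    and \<Delta>: "comult H \<in> calg_hom H (tensor H H)"
    and \<epsilon>: "counit H \<in> calg_hom H complex_alg"
    and S: "antipode H \<in> calg_hom H (opposite_alg H)"
    and closed: "\<And>x. x \<in> \<M> \<Longrightarrow> amat H x"
    and comult_x: "\<And>x i j. x \<in> \<M> \<Longrightarrow> comult H (x i j) = amat_comult H x i j"
    and counit_x: "\<And>x i j. x \<in> \<M> \<Longrightarrow> counit H (x i j) = (if i = j then 1 else 0)"
    and antipode_x: "\<And>x. x \<in> \<M> \<Longrightarrow> amat_mult H (amat_map (antipode H) x) x = amat_scalar H (mat 1)"
      "\<And>x. x \<in> \<M> \<Longrightarrow> amat_mult H x (amat_map (antipode H) x) = amat_scalar H (mat 1)"
    and generated: "\<And>U. subalg U H \<Longrightarrow> (\<And>x i j. x \<in> \<M> \<Longrightarrow> x i j \<in> U) \<Longrightarrow> carrier H \<subseteq> U"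
  shows "hopf_algebra H"
proof -
  interpret T: tensor_algs H H using H by unfold_locales
  interpret H: calg H using H by (simp add: calgebra_iff_calg)
  interpret t: calg "tensor H H" using T.calgebra_tensor by (simp add: calgebra_iff_calg)
  let ?T = "tensor H H" and ?R = "tensor H (tensor H H)" and ?L = "tensor (tensor H H) H"
  interpret L: tensor_algs ?T H using T.calgebra_tensor H by unfold_locales
  interpret R: tensor_algs H ?T using T.calgebra_tensor H by unfold_locales
  interpret r: calg ?R using R.calgebra_tensor by (simp add: calgebra_iff_calg)
  note cl = closed[THEN amat_closed]
  note Scl = calg_hom_closed[OF S, simplified] and Sadd = calg_hom_add[OF S, simplified]
    and Ssm = calg_hom_smult[OF S, simplified] and Smult = calg_hom_mult[OF S, simplified]
    and Sone = calg_hom_one[OF S, simplified]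
  note \<epsilon>s = calg_hom_add[OF \<epsilon>, simplified] calg_hom_mult[OF \<epsilon>, simplified] calg_hom_smult[OF \<epsilon>, simplified]
    calg_hom_one[OF \<epsilon>, simplified]
  note id = calg_hom_id[of H]
  have uniq: "f a = h a" if "f \<in> calg_hom H K" "h \<in> calg_hom H K"
    "\<And>x i j. x \<in> \<M> \<Longrightarrow> f (x i j) = h (x i j)" "a \<in> carrier H"
    for f h and K :: "(complex, 'k, 'l) module_scheme" and a
    using generated[OF subalg_equalizer[OF that(1,2) H]] that(3,4) cl by auto

  note mR = tensor_map_props[OF H H H T.calgebra_tensor calg_hom_clin[OF id] calg_hom_clin[OF \<Delta>]]
  note mL = tensor_map_props[OF H H T.calgebra_tensor H calg_hom_clin[OF \<Delta>] calg_hom_clin[OF id]]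
  note as = tensor_assoc_props[OF H H H]
  have coassoc: "tensor_assoc H H H (tensor_map ?T H (comult H) (\<lambda>x. x) (comult H a)) =
      tensor_map H ?T (\<lambda>x. x) (comult H) (comult H a)" if a: "a \<in> carrier H" for a
  proof (rule uniq[OF _ _ _ a])
    show "(\<lambda>a. tensor_assoc H H H (tensor_map ?T H (comult H) (\<lambda>x. x) (comult H a))) \<in> calg_hom H ?R"
      by (rule calg_hom_comp[OF calg_hom_comp[OF \<Delta> mL(3)[OF \<Delta> id]] as(2)])
    show "(\<lambda>a. tensor_map H ?T (\<lambda>x. x) (comult H) (comult H a)) \<in> calg_hom H ?R"
      by (rule calg_hom_comp[OF \<Delta> mR(3)[OF id \<Delta>]])
    fix x i j assume x: "x \<in> \<M>"
    note c = cl[OF x]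
    have C: "comult H (x i j) = finsum ?T (\<lambda>k. pure_tensor H H (x i k) (x k j)) UNIV" for i j
      by (simp add: comult_x[OF x] amat_comult_def)
    have cc: "comult H (x i j) \<in> carrier ?T" for i j using calg_hom_closed[OF \<Delta> c] .
    \<comment> \<open>Both sides are expanded into the double sum of x_il \<otimes> (x_lk \<otimes>
      x_kj). The expansions arrive with opposite orders of summation, which \<open>e4\<close>
      exchanges.\<close>
    have e1: "tensor_map ?T H (comult H) (\<lambda>x. x) (comult H (x i j)) =
        finsum ?L (\<lambda>k. pure_tensor ?T H (comult H (x i k)) (x k j)) UNIV"
      unfolding C[of i j]
      by (simp add: clin_hom_finsum[OF mL(1) T.calgebra_tensor L.calgebra_tensor] c mL(2))
    have e2: "tensor_assoc H H H (finsum ?L (\<lambda>k. pure_tensor ?T H (comult H (x i k)) (x k j)) UNIV) =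
        finsum ?R (\<lambda>k. tensor_assoc H H H (pure_tensor ?T H (comult H (x i k)) (x k j))) UNIV"
      by (simp add: clin_hom_finsum[OF calg_hom_clin[OF as(2)] L.calgebra_tensor R.calgebra_tensor] c cc)
    have e3: "tensor_assoc H H H (pure_tensor ?T H (comult H (x i k)) (x k j)) =
        finsum ?R (\<lambda>l. pure_tensor H ?T (x i l) (pure_tensor H H (x l k) (x k j))) UNIV" for k
    proof -
      have pl: "(\<lambda>t. pure_tensor ?T H t (x k j)) \<in> clin_hom ?T ?L"
        using L.pure_bilin c by (simp add: bilin_def)
      show ?thesis
        unfolding C[of i k]
        by (simp add: clin_hom_finsum[OF pl T.calgebra_tensor L.calgebra_tensor] c as(1)
          clin_hom_finsum[OF calg_hom_clin[OF as(2)] L.calgebra_tensor R.calgebra_tensor])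
    qed
    have e4: "finsum ?R (\<lambda>k. finsum ?R (\<lambda>l. pure_tensor H ?T (x i l) (pure_tensor H H (x l k) (x k j))) UNIV) UNIV =
        finsum ?R (\<lambda>l. finsum ?R (\<lambda>k. pure_tensor H ?T (x i l) (pure_tensor H H (x l k) (x k j))) UNIV) UNIV"
      by (rule r.finsum_swap) (simp_all add: c)
    have e5: "finsum ?R (\<lambda>k. pure_tensor H ?T (x i l) (pure_tensor H H (x l k) (x k j))) UNIV =
        pure_tensor H ?T (x i l) (comult H (x l j))" for l
    proof -
      have pl: "pure_tensor H ?T (x i l) \<in> clin_hom ?T ?R"
        using R.pure_bilin c by (simp add: bilin_def)
      show ?thesis
        unfolding C[of l j]
        by (simp add: clin_hom_finsum[OF pl T.calgebra_tensor R.calgebra_tensor] c)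
    qed
    have e6: "finsum ?R (\<lambda>l. pure_tensor H ?T (x i l) (comult H (x l j))) UNIV =
        tensor_map H ?T (\<lambda>x. x) (comult H) (comult H (x i j))"
      unfolding C[of i j]
      by (simp add: clin_hom_finsum[OF mR(1) T.calgebra_tensor R.calgebra_tensor] c mR(2))
    show "tensor_assoc H H H (tensor_map ?T H (comult H) (\<lambda>x. x) (comult H (x i j))) =
      tensor_map H ?T (\<lambda>x. x) (comult H) (comult H (x i j))"
      by (simp only: e1 e2 e3 e4 e5 e6)
  qed

  have b1: "bilin H H H (\<lambda>x y. counit H x \<odot> y)" and b2: "bilin H H H (\<lambda>x y. counit H y \<odot> x)"
    unfolding bilin_def
    by (auto intro!: clin_homI simp: \<epsilon>s H.smult_l_distr H.smult_r_distr mult_ac)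
  have counit_l: "tensor_lift H (\<lambda>x y. counit H x \<odot> y) (comult H a) = a" if a: "a \<in> carrier H" for a
  proof (rule uniq[OF _ id _ a])
    show "(\<lambda>a. tensor_lift H (\<lambda>x y. counit H x \<odot> y) (comult H a)) \<in> calg_hom H H"
      by (rule calg_hom_comp[OF \<Delta> T.tensor_lift_calg_hom[OF H b1]]) (simp_all add: \<epsilon>s mult_ac)
    fix x i j assume x: "x \<in> \<M>"
    have "(if i = k then 1 else 0) \<odot> x k j = (if i = k then x k j else \<zero>)" for k
      using cl[OF x] by simp
    then show "tensor_lift H (\<lambda>x y. counit H x \<odot> y) (comult H (x i j)) = x i j"
      using cl[OF x]
      by (simp add: comult_x[OF x] tensor_lift_amat_comult[OF H H closed[OF x] b1] counit_x[OF x] H.finsum_delta)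
  qed
  have counit_r: "tensor_lift H (\<lambda>x y. counit H y \<odot> x) (comult H a) = a" if a: "a \<in> carrier H" for a
  proof (rule uniq[OF _ id _ a])
    show "(\<lambda>a. tensor_lift H (\<lambda>x y. counit H y \<odot> x) (comult H a)) \<in> calg_hom H H"
      by (rule calg_hom_comp[OF \<Delta> T.tensor_lift_calg_hom[OF H b2]]) (simp_all add: \<epsilon>s mult_ac)
    fix x i j assume x: "x \<in> \<M>"
    have "(if k = j then 1 else 0) \<odot> x i k = (if k = j then x i k else \<zero>)" for k
      using cl[OF x] by simp
    then show "tensor_lift H (\<lambda>x y. counit H y \<odot> x) (comult H (x i j)) = x i j"
      using cl[OF x]
      by (simp add: comult_x[OF x] tensor_lift_amat_comult[OF H H closed[OF x] b2] counit_x[OF x] H.finsum_delta)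
  qed

  have b3: "bilin H H H (\<lambda>x y. antipode H x \<otimes> y)" and b4: "bilin H H H (\<lambda>x y. x \<otimes> antipode H y)"
    unfolding bilin_def
    by (auto intro!: clin_homI simp: Scl Sadd Ssm H.l_distr H.r_distr)
  let ?l = "tensor_lift H (\<lambda>x y. antipode H x \<otimes> y)" and ?r = "tensor_lift H (\<lambda>x y. x \<otimes> antipode H y)"
  note lh = T.tensor_lift_hom[OF H b3] and lp = T.tensor_lift_pure[OF H b3]
  note rh = T.tensor_lift_hom[OF H b4] and rp = T.tensor_lift_pure[OF H b4]
  note ls = clin_hom_add[OF lh] clin_hom_closed[OF lh] clin_hom_smult[OF lh]
  note rs = clin_hom_add[OF rh] clin_hom_closed[OF rh] clin_hom_smult[OF rh]
  \<comment> \<open>Here the antipode acts as an antihomomorphism: S(a1 b1) a2 b2 = S(b1) (S(a1) a2)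
    b2, so the value on t ends up in the middle.\<close>
  have l1: "?l (t \<otimes>\<^bsub>?T\<^esub> pure_tensor H H b1 b2) = antipode H b1 \<otimes> ?l t \<otimes> b2"
    if b: "b1 \<in> carrier H" "b2 \<in> carrier H" and t: "t \<in> carrier ?T" for t b1 b2
    using t
  proof (induction t rule: T.tensor_induct)
    case (pure a1 a2)
    then show ?case using b by (simp add: T.pure_mult lp Smult Scl H.m_assoc)
  next
    case (add s t)
    then show ?case using b by (simp add: t.l_distr ls Scl H.l_distr H.r_distr)
  qed
  \<comment> \<open>A scalar in the middle can be pulled out. With the comultiplications of two
    elements for t and s, this gives closure of the left antipode law under products.\<close>
  have l2: "?l (t \<otimes>\<^bsub>?T\<^esub> s) = e \<odot> ?l s"
    if e: "?l t = e \<odot> \<one>" and t: "t \<in> carrier ?T" and s: "s \<in> carrier ?T" for s t e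
    using s
  proof (induction s rule: T.tensor_induct)
    case (pure a1 a2)
    then show ?case using t by (simp add: l1 e lp Scl)
  next
    case (add s s')
    then show ?case using t by (simp add: t.r_distr ls H.smult_r_distr)
  qed
  \<comment> \<open>The mirror image: a1 (b1 S(b2)) S(a2) nests the other way, so now the right-hand
    factor of the product must be the one with scalar value.\<close>
  have r1: "?r (pure_tensor H H a1 a2 \<otimes>\<^bsub>?T\<^esub> t) = a1 \<otimes> ?r t \<otimes> antipode H a2"
    if b: "a1 \<in> carrier H" "a2 \<in> carrier H" and t: "t \<in> carrier ?T" for t a1 a2
    using t
  proof (induction t rule: T.tensor_induct)
    case (pure b1 b2)
    then show ?case using b by (simp add: T.pure_mult rp Smult Scl H.m_assoc)
  next
    case (add s t)
    then show ?case using b by (simp add: t.r_distr rs Scl H.l_distr H.r_distr)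
  qed
  have r2: "?r (t \<otimes>\<^bsub>?T\<^esub> s) = e \<odot> ?r t"
    if e: "?r s = e \<odot> \<one>" and t: "t \<in> carrier ?T" and s: "s \<in> carrier ?T" for s t e
    using t
  proof (induction t rule: T.tensor_induct)
    case (pure a1 a2)
    then show ?case using s by (simp add: r1 e rp Scl)
  next
    case (add t t')
    then show ?case using s by (simp add: t.l_distr rs H.smult_r_distr)
  qed
  have dcl: "comult H a \<in> carrier ?T" if "a \<in> carrier H" for a using calg_hom_closed[OF \<Delta> that] .
  note ds = calg_hom_add[OF \<Delta>] calg_hom_mult[OF \<Delta>] calg_hom_smult[OF \<Delta>] calg_hom_one[OF \<Delta>]
  have l_one: "?l \<one>\<^bsub>?T\<^esub> = \<one>" and r_one: "?r \<one>\<^bsub>?T\<^esub> = \<one>"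
    using lp[of \<one> \<one>] rp[of \<one> \<one>] by (simp_all add: T.pure_one Sone)
  have "carrier H \<subseteq> {a \<in> carrier H. ?l (comult H a) = counit H a \<odot> \<one>}"
  proof (rule generated)
    show "subalg {a \<in> carrier H. ?l (comult H a) = counit H a \<odot> \<one>} H"
      unfolding subalg_def by (auto simp: ds \<epsilon>s dcl ls l2 l_one H.smult_l_distr)
    fix x i j assume x: "x \<in> \<M>"
    have "?l (comult H (x i j)) = amat_mult H (amat_map (antipode H) x) x i j"
      by (simp add: comult_x[OF x] tensor_lift_amat_comult[OF H H closed[OF x] b3] amat_mult_def amat_map_def)
    then show "x i j \<in> {a \<in> carrier H. ?l (comult H a) = counit H a \<odot> \<one>}"
      using cl[OF x] by (simp add: antipode_x[OF x] counit_x[OF x] amat_scalar_def mat_def)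
  qed
  moreover have "carrier H \<subseteq> {a \<in> carrier H. ?r (comult H a) = counit H a \<odot> \<one>}"
  proof (rule generated)
    show "subalg {a \<in> carrier H. ?r (comult H a) = counit H a \<odot> \<one>} H"
      unfolding subalg_def by (auto simp: ds \<epsilon>s dcl rs r2 r_one H.smult_l_distr mult_ac)
    fix x i j assume x: "x \<in> \<M>"
    have "?r (comult H (x i j)) = amat_mult H x (amat_map (antipode H) x) i j"
      by (simp add: comult_x[OF x] tensor_lift_amat_comult[OF H H closed[OF x] b4] amat_mult_def amat_map_def)
    then show "x i j \<in> {a \<in> carrier H. ?r (comult H a) = counit H a \<odot> \<one>}"
      using cl[OF x] by (simp add: antipode_x[OF x] counit_x[OF x] amat_scalar_def mat_def)
  qed
  moreover have "antipode H \<in> clin_hom H H" using calg_hom_clin[OF S] by simp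
  ultimately show ?thesis
    unfolding hopf_algebra_def using H \<Delta> \<epsilon> coassoc counit_l counit_r by blast
qed

section \<open>Presented Hopf algebras\<close>

text \<open>
  Equality of the algebra structures underlying two records of possibly different types;
  the Hopf algebras at hand extend the algebras from which they are defined.
\<close>

definition same_alg :: "(complex, 'a, 'm) module_scheme \<Rightarrow> (complex, 'a, 'k) module_scheme \<Rightarrow> bool" where
  "same_alg A A' \<longleftrightarrow> carrier A = carrier A' \<and> mult A = mult A' \<and> one A = one A' \<and>
     zero A = zero A' \<and> add A = add A' \<and> smult A = smult A'"

lemma same_alg_sym: "same_alg A A' \<Longrightarrow> same_alg A' A"
  by (simp add: same_alg_def)

lemma same_alg_calgebra:
  fixes A (structure)
  assumes "same_alg A A'" "calgebra A"
  shows "calgebra A'"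
proof -
  interpret calg A using assms by (simp add: calgebra_iff_calg)
  have s: "carrier A' = carrier A" "mult A' = mult A" "one A' = one A" "zero A' = zero A" "add A' = add A"
    "smult A' = smult A"
    using assms by (simp_all add: same_alg_def)
  have "ring A'"
  proof (rule ringI)
    show "abelian_group A'"
    proof (rule abelian_groupI)
      fix x assume "x \<in> carrier A'"
      then show "\<exists>y\<in>carrier A'. y \<oplus>\<^bsub>A'\<^esub> x = \<zero>\<^bsub>A'\<^esub>"
        by (intro bexI[of _ "\<ominus> x"]) (auto simp: s l_neg)
    qed (auto simp: s a_ac)
    show "Group.monoid A'"
      by (rule monoidI) (auto simp: s m_assoc)
  qed (auto simp: s l_distr r_distr)
  then show ?thesis
    by (simp add: calgebra_iff_calg calg_def calg_axioms_def s smult_l_distr smult_r_distr)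
qed

lemma same_alg_finsum:
  assumes "same_alg A A'" shows "finsum A = finsum A'"
  using assms by (auto simp: same_alg_def finsum_def finprod_def intro!: ext)

lemma same_alg_hom:
  assumes "same_alg A A'" "same_alg B B'"
  shows "calg_hom A B = calg_hom A' B'" "clin_hom A B = clin_hom A' B'"
  using assms by (auto simp: same_alg_def calg_hom_iff clin_hom_def)

lemma same_alg_refl: "same_alg A A"
  by (simp add: same_alg_def)

lemma same_alg_opposite: "same_alg A A' \<Longrightarrow> same_alg (opposite_alg A) (opposite_alg A')"
  by (simp add: same_alg_def opposite_alg_def)

text \<open>The construction reads only components compared by \<open>same_alg\<close>. Hence these
  are equalities of records, and tensor products over a Hopf algebra and over its underlying algebra
  are interchangeable by rewriting.\<close>

lemma same_alg_tensor:
  assumes "same_alg A A'" "same_alg B B'"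
  shows "tensor A B = tensor A' B'" "pure_tensor A B = pure_tensor A' B'"
proof -
  have D: "A \<times>\<times> B = A' \<times>\<times> B'"
    using assms by (simp add: same_alg_def DirProd_def)
  have "bilin_rels A B = bilin_rels A' B'"
    using assms by (simp add: same_alg_def bilin_rels_def)
  then have "bilin_span A B = bilin_span A' B'"
    by (simp add: bilin_span_def D)
  then show "tensor A B = tensor A' B'" "pure_tensor A B = pure_tensor A' B'"
    by (auto simp: tensor_def pure_tensor_def D intro!: ext)
qed

lemma same_alg_tensor_map:
  assumes "same_alg A A'" "same_alg B B'"
  shows "tensor_map A B = tensor_map A' B'"
  using same_alg_tensor[OF assms] by (simp add: tensor_map_def[abs_def])

lemma same_alg_amat:
  assumes "same_alg A A'"
  shows "amat A = amat A'" "amat_mult A = amat_mult A'" "amat_scalar A = amat_scalar A'"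
    "amat_comult A = amat_comult A'" "Brel A = Brel A'" "Hrel A = Hrel A'" "amat_twist A = amat_twist A'"
    "subalg S A = subalg S A'"
proof -
  have s: "carrier A = carrier A'" "mult A = mult A'" "one A = one A'" "smult A = smult A'" "add A = add A'"
    using assms by (simp_all add: same_alg_def)
  note f = same_alg_finsum[OF assms]
  show 1: "amat A = amat A'" and 2: "amat_mult A = amat_mult A'" and 3: "amat_scalar A = amat_scalar A'"
    by (auto simp: amat_def amat_mult_def amat_scalar_def s f intro!: ext)
  show "amat_comult A = amat_comult A'"
    by (auto simp: amat_comult_def same_alg_tensor[OF assms assms] intro!: ext)
  show "Brel A = Brel A'" "Hrel A = Hrel A'" "amat_twist A = amat_twist A'"
    by (auto simp: Brel_def Hrel_def amat_twist_def 1 2 3 intro!: ext)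
  show "subalg S A = subalg S A'" by (simp add: subalg_def s)
qed

text \<open>Each family of prescribed values must kill the relations in the algebra where its map
  lands: the tensor square, the complex numbers, and for the antipode the opposite algebra, in which
  an antihomomorphism is a homomorphism. This makes the structure maps well defined; the Hopf axioms
  are a separate matter.\<close>

locale presented_hopf = presentation X R for X :: "'g set" and R +
  fixes \<delta> :: "'g \<Rightarrow> (('g list \<Rightarrow>\<^sub>0 complex) set \<times> ('g list \<Rightarrow>\<^sub>0 complex) set \<Rightarrow>\<^sub>0 complex) set"
    and \<epsilon> :: "'g \<Rightarrow> complex" and s :: "'g \<Rightarrow> ('g list \<Rightarrow>\<^sub>0 complex) set"
  assumes \<delta>: "\<delta> \<in> X \<rightarrow> carrier (tensor PA PA)"
    "\<And>r. r \<in> R \<Longrightarrow> free_eval (tensor PA PA) \<delta> r = \<zero>\<^bsub>tensor PA PA\<^esub>"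
    and \<epsilon>: "\<And>r. r \<in> R \<Longrightarrow> free_eval complex_alg \<epsilon> r = 0"
    and s: "s \<in> X \<rightarrow> carrier PA" "\<And>r. r \<in> R \<Longrightarrow> free_eval (opposite_alg PA) s r = \<zero>\<^bsub>PA\<^esub>"
begin

abbreviation "PH \<equiv> present_hopf X R \<delta> \<epsilon> s"

lemma same_PH: "same_alg PH PA"
  by (simp add: present_hopf_def Let_def same_alg_def)

lemma calgebra_PH: "calgebra PH"
  by (rule same_alg_calgebra[OF same_alg_sym[OF same_PH] calgebra_PA])

lemma calgebra_tensor_PA: "calgebra (tensor PA PA)"
proof -
  interpret T: tensor_algs PA PA using calgebra_PA by unfold_locales
  show ?thesis by (rule T.calgebra_tensor)
qed

lemma PH_comult:
  "comult PH \<in> calg_hom PH (tensor PH PH)" "g \<in> X \<Longrightarrow> comult PH (present_gen X R g) = \<delta> g"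
  using present_lift_hom[OF calgebra_tensor_PA \<delta>] present_lift_gen[OF calgebra_tensor_PA \<delta>]
    same_alg_hom(1)[OF same_PH same_alg_refl, of "tensor PA PA"]
  by (simp_all add: same_alg_tensor[OF same_PH same_PH]) (simp_all add: present_hopf_def Let_def)

lemma PH_counit:
  "counit PH \<in> calg_hom PH complex_alg" "g \<in> X \<Longrightarrow> counit PH (present_gen X R g) = \<epsilon> g"
  using present_lift_hom[OF calgebra_complex_alg, of \<epsilon>] present_lift_gen[OF calgebra_complex_alg, of \<epsilon>] \<epsilon>
    same_alg_hom(1)[OF same_PH same_alg_refl, of complex_alg]
  by (simp_all add: present_hopf_def Let_def)

lemma PH_antipode:
  "antipode PH \<in> calg_hom PH (opposite_alg PH)" "g \<in> X \<Longrightarrow> antipode PH (present_gen X R g) = s g"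
  using present_lift_hom[OF calgebra_opposite[OF calgebra_PA], of s] s
    present_lift_gen[OF calgebra_opposite[OF calgebra_PA], of s]
    same_alg_hom(1)[OF same_PH same_alg_opposite[OF same_PH]]
  by simp_all (simp_all add: present_hopf_def Let_def)

lemma PH_induct: "subalg S PH \<Longrightarrow> (\<And>g. g \<in> X \<Longrightarrow> present_gen X R g \<in> S) \<Longrightarrow> carrier PH \<subseteq> S"
  using present_induct[of S] same_alg_amat(8)[OF same_PH] same_PH by (simp add: same_alg_def)

end

section \<open>The relations of \<open>\<B>(E)\<close> and \<open>\<H>(F)\<close>\<close>

lemma amat_eq_rels_kill:
  assumes h: "h \<in> calg_hom (free_alg X) C" and C: "calgebra C"
    and M: "amat (free_alg X) M" and N: "amat (free_alg X) N"
  shows "(\<forall>r\<in>amat_eq_rels M N. h r = \<zero>\<^bsub>C\<^esub>) \<longleftrightarrow> amat_map h M = amat_map h N"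
proof -
  interpret C: calg C using C by (simp add: calgebra_iff_calg)
  have "h (M i j - N i j) = h (M i j) \<ominus>\<^bsub>C\<^esub> h (N i j)" for i j
    by (rule clin_hom_monoid_alg_diff[OF calg_hom_clin[OF h] monoid_free_monoid C])
      (use amat_closed[OF M] amat_closed[OF N] in auto)
  moreover have "h (M i j) \<in> carrier C" "h (N i j) \<in> carrier C" for i j
    using calg_hom_closed[OF h] amat_closed[OF M] amat_closed[OF N] by auto
  ultimately have "h (M i j - N i j) = \<zero>\<^bsub>C\<^esub> \<longleftrightarrow> h (M i j) = h (N i j)" for i j
    by simp
  moreover have "(\<forall>r\<in>amat_eq_rels M N. h r = \<zero>\<^bsub>C\<^esub>) \<longleftrightarrow> (\<forall>i j. h (M i j - N i j) = \<zero>\<^bsub>C\<^esub>)"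
    by (auto simp: amat_eq_rels_def)
  ultimately show ?thesis
    by (simp add: amat_map_def fun_eq_iff)
qed

text \<open>The two forms differ by multiplication with the invertible scalar matrices E and E',
  which cancels on either side.\<close>

lemma (in calg) Brel_iff:
  fixes E :: "complex^'n::finite^'n"
  assumes x: "amat A x" and E: "E ** E' = mat 1" "E' ** E = mat 1"
  shows "amat_twist A E' x E \<cdot> x = sc (mat 1) \<and> x \<cdot> amat_twist A E' x E = sc (mat 1) \<longleftrightarrow> Brel A E E' x"
proof
  assume *: "amat_twist A E' x E \<cdot> x = sc (mat 1) \<and> x \<cdot> amat_twist A E' x E = sc (mat 1)"
  have "amat_transpose x \<cdot> (sc E \<cdot> x) = sc E \<cdot> (amat_twist A E' x E \<cdot> x)"
    using x by (simp add: amat_twist_alt amat_mult_assoc amat_scalar_mult_left E amat_scalar_one)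
  moreover have "x \<cdot> (sc E' \<cdot> amat_transpose x) = (x \<cdot> amat_twist A E' x E) \<cdot> sc E'"
    using x by (simp add: amat_twist_alt amat_mult_assoc amat_scalar_mult E amat_scalar_one)
  ultimately show "Brel A E E' x"
    using * x by (simp add: Brel_def amat_scalar_one)
next
  assume "Brel A E E' x"
  note s = Brel_simps[OF this]
  show "amat_twist A E' x E \<cdot> x = sc (mat 1) \<and> x \<cdot> amat_twist A E' x E = sc (mat 1)"
    by (simp add: amat_twist_alt s amat_mult_assoc amat_scalar_mult E)
qed

lemma (in calg) Hrel_iff:
  fixes F :: "complex^'n::finite^'n"
  assumes u: "amat A u" "amat A v" and F: "F ** F' = mat 1" "F' ** F = mat 1"
  shows "u \<cdot> amat_transpose v = sc (mat 1) \<and> amat_transpose v \<cdot> u = sc (mat 1) \<and>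
    v \<cdot> amat_twist A F u F' = sc (mat 1) \<and> amat_twist A F u F' \<cdot> v = sc (mat 1) \<longleftrightarrow> Hrel A F F' u v"
proof
  assume *: "u \<cdot> amat_transpose v = sc (mat 1) \<and> amat_transpose v \<cdot> u = sc (mat 1) \<and>
    v \<cdot> amat_twist A F u F' = sc (mat 1) \<and> amat_twist A F u F' \<cdot> v = sc (mat 1)"
  have "amat_transpose u \<cdot> (sc F' \<cdot> v) = sc F' \<cdot> (amat_twist A F u F' \<cdot> v)"
    using u by (simp add: amat_twist_alt amat_mult_assoc amat_scalar_mult_left F amat_scalar_one)
  moreover have "v \<cdot> (sc F \<cdot> amat_transpose u) = (v \<cdot> amat_twist A F u F') \<cdot> sc F"
    using u by (simp add: amat_twist_alt amat_mult_assoc amat_scalar_mult F amat_scalar_one)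
  ultimately show "Hrel A F F' u v"
    using * u by (simp add: Hrel_def amat_scalar_one)
next
  assume "Hrel A F F' u v"
  note s = Hrel_simps[OF this]
  have "v \<cdot> (sc F \<cdot> (amat_transpose u \<cdot> sc F')) = sc (mat 1)"
    by (simp add: s amat_scalar_mult F)
  then show "u \<cdot> amat_transpose v = sc (mat 1) \<and> amat_transpose v \<cdot> u = sc (mat 1) \<and>
    v \<cdot> amat_twist A F u F' = sc (mat 1) \<and> amat_twist A F u F' \<cdot> v = sc (mat 1)"
    by (simp add: amat_twist_alt s amat_mult_assoc amat_scalar_mult F)
qed

lemma amat_map_twist:
  assumes "h \<in> calg_hom A B" "calgebra A" "calgebra B" "amat A x"
  shows "amat_map h (amat_twist A P x Q) = amat_twist B P (amat_map h x) Q"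
proof -
  interpret A: calg A using assms by (simp add: calgebra_iff_calg)
  show ?thesis
    using assms(4) by (simp add: amat_twist_def amat_map_mult[OF assms(1-3)] amat_map_scalar[OF assms(1-3)]
        amat_map_transpose)
qed

text \<open>Evaluation is an algebra homomorphism on the free algebra, hence commutes with the
  matrix operations that build the relations. The equivalence is used both ways: to extend maps from
  generators, and to read off the relations that hold in the presented algebra.\<close>

lemma B_rels_kill:
  fixes E :: "complex^'n::finite^'n"
  assumes C: "calgebra C" and x: "amat C x" and E: "E ** matrix_inv E = mat 1" "matrix_inv E ** E = mat 1"
  shows "(\<forall>r\<in>B_rels E. free_eval C (\<lambda>(i, j). x i j) r = \<zero>\<^bsub>C\<^esub>) \<longleftrightarrow> Brel C E (matrix_inv E) x"
proof -
  interpret F: calg "free_alg (UNIV :: ('n \<times> 'n) set)" using calgebra_free_alg by (simp add: calgebra_iff_calg)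
  interpret C: calg C using C by (simp add: calgebra_iff_calg)
  let ?A = "free_alg (UNIV :: ('n \<times> 'n) set)" and ?f = "\<lambda>(i, j). x i j"
  let ?x = "\<lambda>i j :: 'n. free_gen (i, j) :: ('n \<times> 'n) list \<Rightarrow>\<^sub>0 complex"
  let ?E = "matrix_inv E"
  have f: "?f \<in> UNIV \<rightarrow> carrier C" using x by (auto simp: amat_def)
  note h = free_eval_hom[OF C f]
  have gx: "amat ?A ?x" by (simp add: amat_def)
  have gy: "amat ?A (amat_twist ?A ?E ?x E)" using gx by (simp add: amat_twist_def)
  have hx: "amat_map (free_eval C ?f) ?x = x"
    by (auto simp: amat_map_def free_eval_gen[OF C f])
  note m = amat_map_mult[OF h calgebra_free_alg C] amat_map_twist[OF h calgebra_free_alg C gx] amat_map_scalar[OF h calgebra_free_alg C]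
  show ?thesis
    unfolding B_rels_def Let_def ball_Un
    using gx gy by (simp add: amat_eq_rels_kill[OF h C] m hx C.Brel_iff[OF x E])
qed

lemma H_rels_kill:
  fixes F :: "complex^'n::finite^'n"
  assumes C: "calgebra C" and u: "amat C u" "amat C v" and F: "F ** matrix_inv F = mat 1" "matrix_inv F ** F = mat 1"
  shows "(\<forall>r\<in>H_rels F. free_eval C (case_sum (\<lambda>(i, j). u i j) (\<lambda>(i, j). v i j)) r = \<zero>\<^bsub>C\<^esub>) \<longleftrightarrow>
    Hrel C F (matrix_inv F) u v"
proof -
  interpret F: calg "free_alg (UNIV :: ('n \<times> 'n + 'n \<times> 'n) set)" using calgebra_free_alg by (simp add: calgebra_iff_calg)
  interpret C: calg C using C by (simp add: calgebra_iff_calg)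
  let ?A = "free_alg (UNIV :: ('n \<times> 'n + 'n \<times> 'n) set)" and ?f = "case_sum (\<lambda>(i, j). u i j) (\<lambda>(i, j). v i j)"
  let ?u = "\<lambda>i j :: 'n. free_gen (Inl (i, j)) :: ('n \<times> 'n + 'n \<times> 'n) list \<Rightarrow>\<^sub>0 complex"
  let ?v = "\<lambda>i j :: 'n. free_gen (Inr (i, j)) :: ('n \<times> 'n + 'n \<times> 'n) list \<Rightarrow>\<^sub>0 complex"
  let ?F = "matrix_inv F"
  have f: "?f \<in> UNIV \<rightarrow> carrier C" using u by (auto simp: amat_def split: sum.split)
  note h = free_eval_hom[OF C f]
  have gu: "amat ?A ?u" and gv: "amat ?A ?v" by (simp_all add: amat_def)
  have gw: "amat ?A (amat_twist ?A F ?u ?F)" using gu by (simp add: amat_twist_def)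
  have hx: "amat_map (free_eval C ?f) ?u = u" "amat_map (free_eval C ?f) ?v = v"
    by (auto simp: amat_map_def free_eval_gen[OF C f])
  note m = amat_map_mult[OF h calgebra_free_alg C] amat_map_twist[OF h calgebra_free_alg C gu] amat_map_scalar[OF h calgebra_free_alg C]
    amat_map_transpose
  show ?thesis
    unfolding H_rels_def Let_def ball_Un
    using gu gv gw by (simp add: amat_eq_rels_kill[OF h C] m hx flip: C.Hrel_iff[OF u F])
qed

lemma tensor_incl_hom:
  assumes A: "calgebra A"
  shows "(\<lambda>a. pure_tensor A A a \<one>\<^bsub>A\<^esub>) \<in> calg_hom A (tensor A A)"
    and "(\<lambda>a. pure_tensor A A \<one>\<^bsub>A\<^esub> a) \<in> calg_hom A (tensor A A)"
proof -
  interpret A: calg A using A by (simp add: calgebra_iff_calg)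
  interpret T: tensor_algs A A using A by unfold_locales
  show "(\<lambda>a. pure_tensor A A a \<one>\<^bsub>A\<^esub>) \<in> calg_hom A (tensor A A)"
    "(\<lambda>a. pure_tensor A A \<one>\<^bsub>A\<^esub> a) \<in> calg_hom A (tensor A A)"
    using T.pure_bilin by (auto simp: calg_hom_iff bilin_def T.pure_mult T.pure_one)
qed

text \<open>The comultiplication matrix factors as \<open>(x \<otimes> 1) (1 \<otimes> x)\<close>, with entrywise commuting factors.\<close>

lemma amat_comult_rel:
  assumes A: "calgebra A"
  shows amat_comult_Brel: "Brel A E E' x \<Longrightarrow> Brel (tensor A A) E E' (amat_comult A x)"
    and amat_comult_Hrel: "Hrel A F F' u v \<Longrightarrow> Hrel (tensor A A) F F' (amat_comult A u) (amat_comult A v)"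
proof -
  interpret A: calg A using A by (simp add: calgebra_iff_calg)
  interpret T: tensor_algs A A using A by unfold_locales
  interpret t: calg "tensor A A" using T.calgebra_tensor by (simp add: calgebra_iff_calg)
  let ?i1 = "\<lambda>a. pure_tensor A A a \<one>\<^bsub>A\<^esub>" and ?i2 = "\<lambda>a. pure_tensor A A \<one>\<^bsub>A\<^esub> a"
  note h1 = tensor_incl_hom(1)[OF A] and h2 = tensor_incl_hom(2)[OF A]
  have f: "amat_comult A x = amat_mult (tensor A A) (amat_map ?i1 x) (amat_map ?i2 x)" if "amat A x" for x :: "'z::finite \<Rightarrow> 'z \<Rightarrow> 'a"
    using amat_closed[OF that] by (intro ext) (simp add: amat_comult_def amat_mult_def amat_map_def T.pure_mult)
  have c: "amat_map ?i1 x i j \<otimes>\<^bsub>tensor A A\<^esub> amat_map ?i2 x k l = amat_map ?i2 x k l \<otimes>\<^bsub>tensor A A\<^esub> amat_map ?i1 x i j"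
    if "amat A x" for i j k l and x :: "'z::finite \<Rightarrow> 'z \<Rightarrow> 'a"
    using amat_closed[OF that] by (simp add: amat_map_def T.pure_mult)
  show "Brel (tensor A A) E E' (amat_comult A x)" if x: "Brel A E E' x"
    unfolding f[OF A.Brel_simps(1)[OF x]]
    by (rule t.Brel_mult[OF Brel_map[OF h1 A T.calgebra_tensor x] Brel_map[OF h2 A T.calgebra_tensor x]
          c[OF A.Brel_simps(1)[OF x]]])
  show "Hrel (tensor A A) F F' (amat_comult A u) (amat_comult A v)" if u: "Hrel A F F' u v"
    unfolding f[OF A.Hrel_simps(1)[OF u]] f[OF A.Hrel_simps(2)[OF u]]
    by (rule t.Hrel_mult[OF Hrel_map[OF h1 A T.calgebra_tensor u] Hrel_map[OF h2 A T.calgebra_tensor u]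
          c[OF A.Hrel_simps(1)[OF u]] c[OF A.Hrel_simps(2)[OF u]]])
qed

lemma amat_scalar_complex: "amat_scalar complex_alg (mat 1) = (\<lambda>i j. if i = j then 1 else 0)"
  by (auto simp: amat_scalar_def mat_def intro!: ext)

lemma matrix_inv_simps:
  fixes E :: "complex^'n::finite^'n"
  assumes "invertible E"
  shows "E ** matrix_inv E = mat 1" "matrix_inv E ** E = mat 1"
  using someI_ex[OF assms[unfolded invertible_def]] unfolding matrix_inv_def by auto

section \<open>The structure maps and the universal property of \<open>B_hopf\<close>\<close>

locale B_setup =
  fixes E :: "complex^'n::finite^'n"
  assumes inv: "invertible E"
begin

abbreviation "E' \<equiv> matrix_inv E"

lemmas EE' = matrix_inv_simps[OF inv]

sublocale pres: presentation UNIV "B_rels E"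
  by unfold_locales simp

lemma gen_case: "present_gen UNIV (B_rels E) = (\<lambda>(i, j). B_gen E i j)"
  by (auto simp: B_gen_def)

lemma B_gen_amat_PA: "amat pres.PA (B_gen E)"
  using pres.gen_closed by (simp add: amat_def B_gen_def)

lemma Brel_PA: "Brel pres.PA E E' (B_gen E)"
  using B_rels_kill[OF pres.calgebra_PA B_gen_amat_PA EE'] pres.present_rel
  by (simp add: gen_case)

text \<open>The essential obligations are three solutions of \<open>Brel\<close>: the
  comultiplication matrix in the tensor square, the identity matrix over the complex numbers, and E'
  x^t E in the opposite algebra.\<close>

sublocale BH: presented_hopf UNIV "B_rels E" "\<lambda>(i, j). amat_comult pres.PA (B_gen E) i j"
  "\<lambda>(i, j). if i = j then 1 else 0" "\<lambda>(i, j). amat_twist pres.PA E' (B_gen E) E i j"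
proof unfold_locales
  interpret A: calg pres.PA using pres.calgebra_PA by (simp add: calgebra_iff_calg)
  interpret T: tensor_algs pres.PA pres.PA using pres.calgebra_PA by unfold_locales
  note rd = amat_comult_Brel[OF pres.calgebra_PA Brel_PA]
  have d: "amat (tensor pres.PA pres.PA) (amat_comult pres.PA (B_gen E))"
    by (rule amat_comult_closed[OF pres.calgebra_PA B_gen_amat_PA])
  then show "(\<lambda>(i, j). amat_comult pres.PA (B_gen E) i j) \<in> UNIV \<rightarrow> carrier (tensor pres.PA pres.PA)"
    by (auto simp: amat_def)
  have s: "amat pres.PA (amat_twist pres.PA E' (B_gen E) E)"
    using B_gen_amat_PA by (simp add: amat_twist_def)
  then show "(\<lambda>(i, j). amat_twist pres.PA E' (B_gen E) E i j) \<in> UNIV \<rightarrow> carrier pres.PA"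
    by (auto simp: amat_def)
  fix r assume r: "r \<in> B_rels E"
  show "free_eval (tensor pres.PA pres.PA) (\<lambda>(i, j). amat_comult pres.PA (B_gen E) i j) r = \<zero>\<^bsub>tensor pres.PA pres.PA\<^esub>"
    using B_rels_kill[OF T.calgebra_tensor d EE'] rd r by blast
  interpret C: calg complex_alg using calgebra_complex_alg by (simp add: calgebra_iff_calg)
  show "free_eval complex_alg (\<lambda>(i, j). if i = j then 1 else 0) r = 0"
    using B_rels_kill[OF calgebra_complex_alg C.amat_scalar_closed EE', of "mat 1"] C.Brel_one[of E E'] r
    by (simp add: amat_scalar_complex)
  have "Brel (opposite_alg pres.PA) E E' (amat_twist pres.PA E' (B_gen E) E)"
    using A.Brel_opposite[OF Brel_PA EE'] by (simp add: amat_twist_def)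
  then show "free_eval (opposite_alg pres.PA) (\<lambda>(i, j). amat_twist pres.PA E' (B_gen E) E i j) r = \<zero>\<^bsub>pres.PA\<^esub>"
    using B_rels_kill[OF calgebra_opposite[OF pres.calgebra_PA] _ EE', of "amat_twist pres.PA E' (B_gen E) E"] s r
    by (simp add: amat_def)
qed

abbreviation "B \<equiv> B_hopf E"
abbreviation "x \<equiv> B_gen E"

lemma B_eq: "B = BH.PH"
  by (simp add: B_hopf_def Let_def)

lemma same_B: "same_alg B pres.PA"
  unfolding B_eq by (rule BH.same_PH)

lemma B_calgebra: "calgebra B" unfolding B_eq by (rule BH.calgebra_PH)
lemma B_comult_hom: "comult B \<in> calg_hom B (tensor B B)" unfolding B_eq by (rule BH.PH_comult)
lemma B_counit_hom: "counit B \<in> calg_hom B complex_alg" unfolding B_eq by (rule BH.PH_counit)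
lemma B_antipode_hom: "antipode B \<in> calg_hom B (opposite_alg B)" unfolding B_eq by (rule BH.PH_antipode)

lemma B_Brel: "Brel B E E' x"
  using Brel_PA by (simp add: same_alg_amat[OF same_B])

lemma B_comult_gen: "comult B (x i j) = amat_comult B x i j"
  using BH.PH_comult(2)[of "(i, j)"] by (simp add: same_alg_amat[OF same_B]) (simp add: B_eq B_gen_def)

lemma B_counit_gen: "counit B (x i j) = (if i = j then 1 else 0)"
  using BH.PH_counit(2)[of "(i, j)"] by (simp add: B_eq B_gen_def)

lemma B_antipode_gen: "antipode B (x i j) = amat_twist B E' x E i j"
  using BH.PH_antipode(2)[of "(i, j)"] by (simp add: same_alg_amat[OF same_B]) (simp add: B_eq B_gen_def)

lemma B_universal:
  assumes C: "calgebra C" and y: "Brel C E E' y"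
  obtains h where "h \<in> calg_hom B C" "amat_map h x = y"
proof -
  interpret C: calg C using C by (simp add: calgebra_iff_calg)
  let ?f = "\<lambda>(i, j). y i j"
  have f: "?f \<in> UNIV \<rightarrow> carrier C" using C.Brel_simps(1)[OF y] by (auto simp: amat_def)
  have k: "\<And>r. r \<in> B_rels E \<Longrightarrow> free_eval C ?f r = \<zero>\<^bsub>C\<^esub>"
    using B_rels_kill[OF C C.Brel_simps(1)[OF y] EE'] y by blast
  show ?thesis
  proof (rule that)
    show "(\<lambda>a. the_elem (free_eval C ?f ` a)) \<in> calg_hom B C"
      using pres.present_lift_hom[OF C f k] same_alg_hom(1)[OF same_B same_alg_refl] by blast
    show "amat_map (\<lambda>a. the_elem (free_eval C ?f ` a)) x = y"
      using pres.present_lift_gen[OF C f k] by (simp add: amat_map_def B_gen_def)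
  qed
qed

end

section \<open>The Hopf algebra \<open>H_hopf\<close> and its universal property\<close>

definition H_u :: "complex^'n::finite^'n \<Rightarrow> 'n \<Rightarrow> 'n \<Rightarrow> (('n \<times> 'n + 'n \<times> 'n) list \<Rightarrow>\<^sub>0 complex) set" where
  "H_u F i j = present_gen UNIV (H_rels F) (Inl (i, j))"

definition H_v :: "complex^'n::finite^'n \<Rightarrow> 'n \<Rightarrow> 'n \<Rightarrow> (('n \<times> 'n + 'n \<times> 'n) list \<Rightarrow>\<^sub>0 complex) set" where
  "H_v F i j = present_gen UNIV (H_rels F) (Inr (i, j))"

locale H_setup =
  fixes F :: "complex^'n::finite^'n"
  assumes inv: "invertible F"
begin

abbreviation "F' \<equiv> matrix_inv F"

lemmas FF' = matrix_inv_simps[OF inv]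

sublocale pres: presentation UNIV "H_rels F"
  by unfold_locales simp

abbreviation "u \<equiv> H_u F"
abbreviation "v \<equiv> H_v F"

lemma gen_case: "present_gen UNIV (H_rels F) = case_sum (\<lambda>(i, j). u i j) (\<lambda>(i, j). v i j)"
  by (rule ext) (auto simp: H_u_def H_v_def split: sum.split)

lemma u_amat_PA: "amat pres.PA u" and v_amat_PA: "amat pres.PA v"
  using pres.gen_closed by (simp_all add: amat_def H_u_def H_v_def)

lemma Hrel_PA: "Hrel pres.PA F F' u v"
  using H_rels_kill[OF pres.calgebra_PA u_amat_PA v_amat_PA FF'] pres.present_rel
  by (simp add: gen_case)

sublocale HH: presented_hopf UNIV "H_rels F"
  "case_sum (\<lambda>(i, j). amat_comult pres.PA u i j) (\<lambda>(i, j). amat_comult pres.PA v i j)"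
  "case_sum (\<lambda>(i, j). if i = j then 1 else 0) (\<lambda>(i, j). if i = j then 1 else 0)"
  "case_sum (\<lambda>(i, j). amat_transpose v i j) (\<lambda>(i, j). amat_twist pres.PA F u F' i j)"
proof unfold_locales
  interpret A: calg pres.PA using pres.calgebra_PA by (simp add: calgebra_iff_calg)
  interpret T: tensor_algs pres.PA pres.PA using pres.calgebra_PA by unfold_locales
  note rd = amat_comult_Hrel[OF pres.calgebra_PA Hrel_PA]
  note d = amat_comult_closed[OF pres.calgebra_PA u_amat_PA] amat_comult_closed[OF pres.calgebra_PA v_amat_PA]
  then show "case_sum (\<lambda>(i, j). amat_comult pres.PA u i j) (\<lambda>(i, j). amat_comult pres.PA v i j)
      \<in> UNIV \<rightarrow> carrier (tensor pres.PA pres.PA)"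
    by (auto simp: amat_def split: sum.split)
  have s: "amat pres.PA (amat_twist pres.PA F u F')" "amat pres.PA (amat_transpose v)"
    using u_amat_PA v_amat_PA by (simp_all add: amat_twist_def)
  then show "case_sum (\<lambda>(i, j). amat_transpose v i j) (\<lambda>(i, j). amat_twist pres.PA F u F' i j) \<in> UNIV \<rightarrow> carrier pres.PA"
    by (auto simp: amat_def split: sum.split)
  fix r assume r: "r \<in> H_rels F"
  show "free_eval (tensor pres.PA pres.PA) (case_sum (\<lambda>(i, j). amat_comult pres.PA u i j)
      (\<lambda>(i, j). amat_comult pres.PA v i j)) r = \<zero>\<^bsub>tensor pres.PA pres.PA\<^esub>"
    using H_rels_kill[OF T.calgebra_tensor d FF'] rd r by blast
  interpret C: calg complex_alg using calgebra_complex_alg by (simp add: calgebra_iff_calg)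
  show "free_eval complex_alg (case_sum (\<lambda>(i, j). if i = j then 1 else 0) (\<lambda>(i, j). if i = j then 1 else 0)) r = 0"
    using H_rels_kill[OF calgebra_complex_alg C.amat_scalar_closed C.amat_scalar_closed FF', of "mat 1" "mat 1"] C.Hrel_one[of F F'] r
    by (simp add: amat_scalar_complex)
  have "Hrel (opposite_alg pres.PA) F F' (amat_transpose v) (amat_twist pres.PA F u F')"
    using A.Hrel_opposite[OF Hrel_PA FF'] by (simp add: amat_twist_def)
  then show "free_eval (opposite_alg pres.PA) (case_sum (\<lambda>(i, j). amat_transpose v i j)
      (\<lambda>(i, j). amat_twist pres.PA F u F' i j)) r = \<zero>\<^bsub>pres.PA\<^esub>"
    using H_rels_kill[OF calgebra_opposite[OF pres.calgebra_PA] _ _ FF', of "amat_transpose v" "amat_twist pres.PA F u F'"] s r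
    by (simp add: amat_def)
qed

abbreviation "H \<equiv> H_hopf F"

lemma H_eq: "H = HH.PH"
  by (simp add: H_hopf_def Let_def flip: H_u_def H_v_def)

lemma same_H: "same_alg H pres.PA"
  unfolding H_eq by (rule HH.same_PH)

lemma H_calgebra: "calgebra H" unfolding H_eq by (rule HH.calgebra_PH)
lemma H_comult_hom: "comult H \<in> calg_hom H (tensor H H)" unfolding H_eq by (rule HH.PH_comult)
lemma H_counit_hom: "counit H \<in> calg_hom H complex_alg" unfolding H_eq by (rule HH.PH_counit)
lemma H_antipode_hom: "antipode H \<in> calg_hom H (opposite_alg H)" unfolding H_eq by (rule HH.PH_antipode)

lemma H_Hrel: "Hrel H F F' u v"
  using Hrel_PA by (simp add: same_alg_amat[OF same_H])

lemma H_comult_gen: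
  "comult H (u i j) = amat_comult H u i j" "comult H (v i j) = amat_comult H v i j"
  using HH.PH_comult(2)[of "Inl (i, j)"] HH.PH_comult(2)[of "Inr (i, j)"]
  by (simp_all add: same_alg_amat[OF same_H]) (simp_all add: H_eq H_u_def[symmetric] H_v_def[symmetric])

lemma H_counit_gen:
  "counit H (u i j) = (if i = j then 1 else 0)" "counit H (v i j) = (if i = j then 1 else 0)"
  using HH.PH_counit(2)[of "Inl (i, j)"] HH.PH_counit(2)[of "Inr (i, j)"]
  by (simp_all add: H_eq H_u_def[symmetric] H_v_def[symmetric])

lemma H_antipode_gen:
  "amat_map (antipode H) u = amat_transpose v" "amat_map (antipode H) v = amat_twist H F u F'"
  using HH.PH_antipode(2)[of "Inl (_, _)"] HH.PH_antipode(2)[of "Inr (_, _)"]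
  by (simp_all add: same_alg_amat[OF same_H] amat_map_def) (simp_all add: H_eq H_u_def[symmetric] H_v_def[symmetric])

lemma H_induct:
  assumes "subalg S H" "\<And>i j. u i j \<in> S" "\<And>i j. v i j \<in> S"
  shows "carrier H \<subseteq> S"
proof -
  have "present_gen UNIV (H_rels F) g \<in> S" for g
    using assms(2,3) by (cases g) (auto simp: H_u_def H_v_def)
  then show ?thesis using HH.PH_induct[of S] assms(1) by (simp add: H_eq)
qed

lemma H_universal:
  assumes C: "calgebra C" and y: "Hrel C F F' y z"
  obtains h where "h \<in> calg_hom H C" "amat_map h u = y" "amat_map h v = z"
proof -
  interpret C: calg C using C by (simp add: calgebra_iff_calg)
  let ?f = "case_sum (\<lambda>(i, j). y i j) (\<lambda>(i, j). z i j)"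
  have f: "?f \<in> UNIV \<rightarrow> carrier C"
    using C.Hrel_simps(1,2)[OF y] by (auto simp: amat_def split: sum.split)
  have k: "\<And>r. r \<in> H_rels F \<Longrightarrow> free_eval C ?f r = \<zero>\<^bsub>C\<^esub>"
    using H_rels_kill[OF C C.Hrel_simps(1,2)[OF y] FF'] y by blast
  show ?thesis
  proof (rule that)
    show "(\<lambda>a. the_elem (free_eval C ?f ` a)) \<in> calg_hom H C"
      using pres.present_lift_hom[OF C f k] same_alg_hom(1)[OF same_H same_alg_refl] by blast
    show "amat_map (\<lambda>a. the_elem (free_eval C ?f ` a)) u = y" "amat_map (\<lambda>a. the_elem (free_eval C ?f ` a)) v = z"
      using pres.present_lift_gen[OF C f k] by (simp_all add: amat_map_def H_u_def H_v_def)
  qed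
qed

text \<open>The values on \<open>v\<close> are forced because \<open>v\<^sup>t\<close> is the inverse of \<open>u\<close>.\<close>

lemma H_hom_unique:
  assumes C: "calgebra C" and f: "f \<in> calg_hom H C" and h: "h \<in> calg_hom H C"
    and u: "amat_map f u = amat_map h u" and a: "a \<in> carrier H"
  shows "f a = h a"
proof -
  interpret C: calg C using C by (simp add: calgebra_iff_calg)
  interpret H: calg H using H_calgebra by (simp add: calgebra_iff_calg)
  have v: "amat_map f v = amat_map h v"
    using C.Hrel_unique Hrel_map[OF f H_calgebra C H_Hrel] Hrel_map[OF h H_calgebra C H_Hrel] u by metis
  have "carrier H \<subseteq> {a \<in> carrier H. f a = h a}"
    using u v amat_closed[OF H.Hrel_simps(1)[OF H_Hrel]] amat_closed[OF H.Hrel_simps(2)[OF H_Hrel]]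
    by (intro H_induct subalg_equalizer[OF f h H_calgebra]) (auto simp: amat_map_def fun_eq_iff)
  with a show ?thesis by blast
qed

lemma H_antipode_laws:
  assumes "x \<in> {u, v}"
  shows "amat_mult H (amat_map (antipode H) x) x = amat_scalar H (mat 1)"
    "amat_mult H x (amat_map (antipode H) x) = amat_scalar H (mat 1)"
proof -
  interpret H: calg H using H_calgebra by (simp add: calgebra_iff_calg)
  show "amat_mult H (amat_map (antipode H) x) x = amat_scalar H (mat 1)"
    "amat_mult H x (amat_map (antipode H) x) = amat_scalar H (mat 1)"
    using H.Hrel_iff[OF H.Hrel_simps(1,2)[OF H_Hrel] FF'] H_Hrel assms by (auto simp: H_antipode_gen)
qed

lemma hopf_algebra_H: "hopf_algebra H"
proof (rule hopf_algebra_of_matrices[OF H_calgebra H_comult_hom H_counit_hom H_antipode_hom, of "{u, v}"])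
  interpret H: calg H using H_calgebra by (simp add: calgebra_iff_calg)
  show "\<And>x. x \<in> {u, v} \<Longrightarrow> amat H x" using H.Hrel_simps(1,2)[OF H_Hrel] by blast
qed (use H_comult_gen H_counit_gen H_antipode_laws H_induct in auto)

end

section \<open>Group algebras and free products\<close>

lemma group_hopf_props:
  assumes G: "Group.group G"
  defines "K \<equiv> group_hopf G" and "\<gamma> \<equiv> (\<lambda>g. single g (1 :: complex))"
  shows calgebra_group_hopf: "calgebra K"
    and same_group_hopf: "same_alg K (monoid_alg G)"
    and group_hopf_comult_hom: "comult K \<in> calg_hom K (tensor K K)"
    and group_hopf_counit_hom: "counit K \<in> calg_hom K complex_alg"
    and group_hopf_antipode_hom: "antipode K \<in> calg_hom K (opposite_alg K)"
    and group_hopf_comult: "g \<in> carrier G \<Longrightarrow> comult K (\<gamma> g) = pure_tensor K K (\<gamma> g) (\<gamma> g)"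
    and group_hopf_counit: "g \<in> carrier G \<Longrightarrow> counit K (\<gamma> g) = 1"
    and group_hopf_antipode: "g \<in> carrier G \<Longrightarrow> antipode K (\<gamma> g) = \<gamma> (inv\<^bsub>G\<^esub> g)"
proof -
  interpret G: Group.group G by fact
  let ?A = "monoid_alg G"
  have A: "calgebra ?A" by (rule calgebra_monoid_alg[OF G.is_monoid])
  interpret A: calg ?A using A by (simp add: calgebra_iff_calg)
  interpret T: tensor_algs ?A ?A using A by unfold_locales
  interpret t: calg "tensor ?A ?A" using T.calgebra_tensor by (simp add: calgebra_iff_calg)
  show same: "same_alg K ?A" by (simp add: K_def group_hopf_def Let_def same_alg_def)
  show K: "calgebra K" by (rule same_alg_calgebra[OF same_alg_sym[OF same] A])
  have c: "\<gamma> g \<in> carrier ?A" if "g \<in> carrier G" for g using that by (simp add: \<gamma>_def)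
  have m: "\<gamma> (g \<otimes>\<^bsub>G\<^esub> h) = \<gamma> g \<otimes>\<^bsub>?A\<^esub> \<gamma> h" for g h by (simp add: \<gamma>_def monoid_alg_mult_single)
  have o: "\<gamma> \<one>\<^bsub>G\<^esub> = \<one>\<^bsub>?A\<^esub>" by (simp add: \<gamma>_def)
  note st = same_alg_tensor[OF same same]
  \<comment> \<open>A linear extension sees only addition and scalars, so the one defining the
    antipode may be taken with values in the opposite algebra, where multiplicativity can be
    proved.\<close>
  have k: "comult K = lin_ext (tensor ?A ?A) (\<lambda>g. pure_tensor ?A ?A (\<gamma> g) (\<gamma> g))"
    "counit K = lin_ext complex_alg (\<lambda>g. 1)" "antipode K = lin_ext (opposite_alg ?A) (\<lambda>g. \<gamma> (inv\<^bsub>G\<^esub> g))"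
    by (simp_all add: K_def group_hopf_def Let_def \<gamma>_def lin_ext_def[abs_def])
  show "comult K \<in> calg_hom K (tensor K K)"
    unfolding k st same_alg_hom(1)[OF same same_alg_refl]
    by (rule lin_ext_calg_hom[OF G.is_monoid T.calgebra_tensor]) (use c T.pure_one in \<open>auto simp: m o T.pure_mult\<close>)
  show "counit K \<in> calg_hom K complex_alg"
    unfolding k st same_alg_hom(1)[OF same same_alg_refl]
    by (rule lin_ext_calg_hom[OF G.is_monoid calgebra_complex_alg]) auto
  show "antipode K \<in> calg_hom K (opposite_alg K)"
    unfolding k same_alg_hom(1)[OF same same_alg_opposite[OF same]]
    by (rule lin_ext_calg_hom[OF G.is_monoid calgebra_opposite[OF A]]) (use c in \<open>auto simp: m o G.inv_mult_group\<close>)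
  assume g: "g \<in> carrier G"
  show "comult K (\<gamma> g) = pure_tensor K K (\<gamma> g) (\<gamma> g)"
    using g lin_ext_single[OF T.calgebra_tensor, of "\<lambda>g. pure_tensor ?A ?A (\<gamma> g) (\<gamma> g)" g 1]
    by (simp add: k st \<gamma>_def)
  show "counit K (\<gamma> g) = 1"
    unfolding k \<gamma>_def by (subst lin_ext_single[OF calgebra_complex_alg]) simp_all
  show "antipode K (\<gamma> g) = \<gamma> (inv\<^bsub>G\<^esub> g)"
    using g lin_ext_single[OF calgebra_opposite[OF A], of "\<lambda>g. \<gamma> (inv\<^bsub>G\<^esub> g)" g 1]
    by (simp add: k \<gamma>_def)
qed

section \<open>The group algebra of the group of order two\<close>

lemma CZ2_gen_props:
  shows CZ2_gen_closed: "CZ2_gen \<in> carrier CZ2_hopf"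
    and CZ2_gen_square: "CZ2_gen \<otimes>\<^bsub>CZ2_hopf\<^esub> CZ2_gen = \<one>\<^bsub>CZ2_hopf\<^esub>"
    and CZ2_gen_comult: "comult CZ2_hopf CZ2_gen = pure_tensor CZ2_hopf CZ2_hopf CZ2_gen CZ2_gen"
    and CZ2_gen_counit: "counit CZ2_hopf CZ2_gen = 1"
    and CZ2_gen_antipode: "antipode CZ2_hopf CZ2_gen = CZ2_gen"
proof -
  note p = group_hopf_props[OF group_integer_mod_group[of 2], folded CZ2_hopf_def]
  have s: "carrier CZ2_hopf = carrier (monoid_alg (integer_mod_group 2))"
    "mult CZ2_hopf = mult (monoid_alg (integer_mod_group 2))" "one CZ2_hopf = one (monoid_alg (integer_mod_group 2))"
    using p(2) by (simp_all add: same_alg_def)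
  have 1: "(1 :: int) \<in> carrier (integer_mod_group 2)" by simp
  show "CZ2_gen \<in> carrier CZ2_hopf" by (simp add: s CZ2_gen_def)
  show "CZ2_gen \<otimes>\<^bsub>CZ2_hopf\<^esub> CZ2_gen = \<one>\<^bsub>CZ2_hopf\<^esub>"
    by (simp add: s CZ2_gen_def monoid_alg_mult_single)
  show "comult CZ2_hopf CZ2_gen = pure_tensor CZ2_hopf CZ2_hopf CZ2_gen CZ2_gen"
    "counit CZ2_hopf CZ2_gen = 1" "antipode CZ2_hopf CZ2_gen = CZ2_gen"
    using p(6-8)[OF 1] 1 by (simp_all add: CZ2_gen_def)
qed

lemma CZ2_universal:
  assumes C: "calgebra C" and g: "g \<in> carrier C" "g \<otimes>\<^bsub>C\<^esub> g = \<one>\<^bsub>C\<^esub>"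
  obtains h where "h \<in> calg_hom CZ2_hopf C" "h CZ2_gen = g"
proof
  interpret C: calg C using C by (simp add: calgebra_iff_calg)
  interpret G: Group.group "integer_mod_group 2" by simp
  \<comment> \<open>The carrier of the group is {0, 1}. Of the products to be checked, only 1 + 1 =
    0 is not a unit law, and it is the hypothesis that g squares to 1.\<close>
  let ?f = "\<lambda>k :: int. if k = 0 then \<one>\<^bsub>C\<^esub> else g"
  note p = group_hopf_props[OF group_integer_mod_group[of 2], folded CZ2_hopf_def]
  have k: "k = 0 \<or> k = 1" if "k \<in> carrier (integer_mod_group 2)" for k
    using that by (auto simp: carrier_integer_mod_group)
  show "lin_ext C ?f \<in> calg_hom CZ2_hopf C"
    unfolding same_alg_hom(1)[OF p(2) same_alg_refl]
    by (rule lin_ext_calg_hom[OF G.is_monoid C]) (use g in \<open>auto dest!: k\<close>)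
  show "lin_ext C ?f CZ2_gen = g"
    unfolding CZ2_gen_def using g by (subst lin_ext_single[OF C]) simp_all
qed

text \<open>The four families of relations correspond one by one to the clauses of a unital algebra
  homomorphism: sums, scalars, products and the unit.\<close>

lemma alg_rels_kill_iff:
  assumes C: "calgebra C" and f: "f \<in> X \<rightarrow> carrier C" and j: "j \<in> carrier A \<rightarrow> X" and A: "calgebra A"
  shows "(\<forall>r\<in>alg_rels j A. free_eval C f r = \<zero>\<^bsub>C\<^esub>) \<longleftrightarrow> (\<lambda>a. f (j a)) \<in> calg_hom A C"
proof -
  interpret C: calg C using C by (simp add: calgebra_iff_calg)
  interpret A: calg A using A by (simp add: calgebra_iff_calg)
  note h = free_eval_hom[OF C f]
  have jX: "j a \<in> X" if "a \<in> carrier A" for a using that j by auto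
  have fc: "f (j a) \<in> carrier C" if "a \<in> carrier A" for a using jX[OF that] f by auto
  have e: "free_eval C f (single w c) = c \<odot>\<^bsub>C\<^esub> foldr (\<lambda>g a. f g \<otimes>\<^bsub>C\<^esub> a) w \<one>\<^bsub>C\<^esub>" if "w \<in> lists X" for w c
    by (rule free_eval_single[OF C f that])
  have d: "free_eval C f (p - q) = free_eval C f p \<ominus>\<^bsub>C\<^esub> free_eval C f q"
    if "keys p \<subseteq> lists X" "keys q \<subseteq> lists X" for p q
    using clin_hom_monoid_alg_diff[OF calg_hom_clin[OF h] monoid_free_monoid C] that by simp
  have z: "x \<ominus>\<^bsub>C\<^esub> y \<ominus>\<^bsub>C\<^esub> z = \<zero>\<^bsub>C\<^esub> \<longleftrightarrow> x = y \<oplus>\<^bsub>C\<^esub> z" if "x \<in> carrier C" "y \<in> carrier C" "z \<in> carrier C" for x y z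
  proof -
    have "x \<ominus>\<^bsub>C\<^esub> y \<ominus>\<^bsub>C\<^esub> z = x \<ominus>\<^bsub>C\<^esub> (y \<oplus>\<^bsub>C\<^esub> z)"
      using that by (simp add: C.minus_eq C.minus_add C.a_assoc)
    then show ?thesis using that by simp
  qed
  have 1: "free_eval C f (free_gen (j (a \<oplus>\<^bsub>A\<^esub> b)) - free_gen (j a) - free_gen (j b)) = \<zero>\<^bsub>C\<^esub> \<longleftrightarrow>
      f (j (a \<oplus>\<^bsub>A\<^esub> b)) = f (j a) \<oplus>\<^bsub>C\<^esub> f (j b)" if "a \<in> carrier A" "b \<in> carrier A" for a b
    using that by (simp add: d e jX fc keys_diff_subset z del: C.r_right_minus_eq)
  have 2: "free_eval C f (free_gen (j (c \<odot>\<^bsub>A\<^esub> a)) - single [j a] c) = \<zero>\<^bsub>C\<^esub> \<longleftrightarrow>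
      f (j (c \<odot>\<^bsub>A\<^esub> a)) = c \<odot>\<^bsub>C\<^esub> f (j a)" if "a \<in> carrier A" for a c
    using that by (simp add: d e jX fc)
  have 3: "free_eval C f (free_gen (j (a \<otimes>\<^bsub>A\<^esub> b)) - single [j a, j b] 1) = \<zero>\<^bsub>C\<^esub> \<longleftrightarrow>
      f (j (a \<otimes>\<^bsub>A\<^esub> b)) = f (j a) \<otimes>\<^bsub>C\<^esub> f (j b)" if "a \<in> carrier A" "b \<in> carrier A" for a b
    using that by (simp add: d e jX fc)
  have 4: "free_eval C f (free_gen (j \<one>\<^bsub>A\<^esub>) - single [] 1) = \<zero>\<^bsub>C\<^esub> \<longleftrightarrow> f (j \<one>\<^bsub>A\<^esub>) = \<one>\<^bsub>C\<^esub>"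
    by (simp add: d e jX fc)
  have "(\<forall>r\<in>alg_rels j A. free_eval C f r = \<zero>\<^bsub>C\<^esub>) \<longleftrightarrow>
      (\<forall>a\<in>carrier A. \<forall>b\<in>carrier A. f (j (a \<oplus>\<^bsub>A\<^esub> b)) = f (j a) \<oplus>\<^bsub>C\<^esub> f (j b)) \<and>
      (\<forall>c. \<forall>a\<in>carrier A. f (j (c \<odot>\<^bsub>A\<^esub> a)) = c \<odot>\<^bsub>C\<^esub> f (j a)) \<and>
      (\<forall>a\<in>carrier A. \<forall>b\<in>carrier A. f (j (a \<otimes>\<^bsub>A\<^esub> b)) = f (j a) \<otimes>\<^bsub>C\<^esub> f (j b)) \<and> f (j \<one>\<^bsub>A\<^esub>) = \<one>\<^bsub>C\<^esub>"
    unfolding alg_rels_def ball_Un conj_assoc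
  proof (intro arg_cong2[where f = "(\<and>)"])
    show "(\<forall>r\<in>{free_gen (j (a \<oplus>\<^bsub>A\<^esub> b)) - free_gen (j a) - free_gen (j b) | a b. a \<in> carrier A \<and> b \<in> carrier A}.
        free_eval C f r = \<zero>\<^bsub>C\<^esub>) = (\<forall>a\<in>carrier A. \<forall>b\<in>carrier A. f (j (a \<oplus>\<^bsub>A\<^esub> b)) = f (j a) \<oplus>\<^bsub>C\<^esub> f (j b))"
      using 1 by blast
    show "(\<forall>r\<in>{free_gen (j (c \<odot>\<^bsub>A\<^esub> a)) - single [j a] c | c a. a \<in> carrier A}.
        free_eval C f r = \<zero>\<^bsub>C\<^esub>) = (\<forall>c. \<forall>a\<in>carrier A. f (j (c \<odot>\<^bsub>A\<^esub> a)) = c \<odot>\<^bsub>C\<^esub> f (j a))"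
      using 2 by blast
    show "(\<forall>r\<in>{free_gen (j (a \<otimes>\<^bsub>A\<^esub> b)) - single [j a, j b] 1 | a b. a \<in> carrier A \<and> b \<in> carrier A}.
        free_eval C f r = \<zero>\<^bsub>C\<^esub>) = (\<forall>a\<in>carrier A. \<forall>b\<in>carrier A. f (j (a \<otimes>\<^bsub>A\<^esub> b)) = f (j a) \<otimes>\<^bsub>C\<^esub> f (j b))"
      using 3 by blast
    show "(\<forall>r\<in>{free_gen (j \<one>\<^bsub>A\<^esub>) - single [] 1}. free_eval C f r = \<zero>\<^bsub>C\<^esub>) = (f (j \<one>\<^bsub>A\<^esub>) = \<one>\<^bsub>C\<^esub>)"
      using 4 by simp
  qed
  then show ?thesis
    using fc by (auto simp: calg_hom_iff clin_hom_def)
qed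

section \<open>Free products: structure maps and universal property\<close>

locale free_product =
  fixes A :: "'a hopf" and B :: "'b hopf"
  assumes A: "calgebra A" "comult A \<in> calg_hom A (tensor A A)" "counit A \<in> calg_hom A complex_alg"
      "antipode A \<in> calg_hom A (opposite_alg A)"
    and B: "calgebra B" "comult B \<in> calg_hom B (tensor B B)" "counit B \<in> calg_hom B complex_alg"
      "antipode B \<in> calg_hom B (opposite_alg B)"
begin

abbreviation "X \<equiv> carrier A <+> carrier B"
abbreviation "\<iota>\<^sub>1 \<equiv> free_prod_inl A B"
abbreviation "\<iota>\<^sub>2 \<equiv> free_prod_inr A B"
abbreviation "P \<equiv> free_prod A B"

sublocale pres: presentation X "free_prod_rels A B"
proof
  interpret A: calg A using A by (simp add: calgebra_iff_calg)
  interpret B: calg B using B by (simp add: calgebra_iff_calg)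
  show "free_prod_rels A B \<subseteq> carrier (free_alg X)"
  proof
    fix r assume "r \<in> free_prod_rels A B"
    then show "r \<in> carrier (free_alg X)"
      unfolding free_prod_rels_def alg_rels_def
      by (elim UnE CollectE exE conjE singletonE) (simp_all add: keys_diff_subset InlI InrI)
  qed
qed

lemma rels_kill_iff:
  assumes C: "calgebra C" and f: "f \<in> X \<rightarrow> carrier C"
  shows "(\<forall>r\<in>free_prod_rels A B. free_eval C f r = \<zero>\<^bsub>C\<^esub>) \<longleftrightarrow>
    (\<lambda>a. f (Inl a)) \<in> calg_hom A C \<and> (\<lambda>b. f (Inr b)) \<in> calg_hom B C"
  unfolding free_prod_rels_def ball_Un
  using alg_rels_kill_iff[OF C f _ A(1), of Inl] alg_rels_kill_iff[OF C f _ B(1), of Inr] by auto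

lemma inl_hom_PA: "\<iota>\<^sub>1 \<in> calg_hom A pres.PA" and inr_hom_PA: "\<iota>\<^sub>2 \<in> calg_hom B pres.PA"
  using rels_kill_iff[OF pres.calgebra_PA, of "present_gen X (free_prod_rels A B)"] pres.gen_closed pres.present_rel
  by (auto simp: free_prod_inl_def[abs_def] free_prod_inr_def[abs_def])

sublocale FP: presented_hopf X "free_prod_rels A B"
  "case_sum (\<lambda>a. tensor_map pres.PA pres.PA \<iota>\<^sub>1 \<iota>\<^sub>1 (comult A a)) (\<lambda>b. tensor_map pres.PA pres.PA \<iota>\<^sub>2 \<iota>\<^sub>2 (comult B b))"
  "case_sum (counit A) (counit B)"
  "case_sum (\<lambda>a. \<iota>\<^sub>1 (antipode A a)) (\<lambda>b. \<iota>\<^sub>2 (antipode B b))"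
proof unfold_locales
  interpret T: tensor_algs pres.PA pres.PA using pres.calgebra_PA by unfold_locales
  note P = pres.calgebra_PA
  note l1 = calg_hom_clin[OF inl_hom_PA] and l2 = calg_hom_clin[OF inr_hom_PA]
  have d1: "(\<lambda>a. tensor_map pres.PA pres.PA \<iota>\<^sub>1 \<iota>\<^sub>1 (comult A a)) \<in> calg_hom A (tensor pres.PA pres.PA)"
    by (rule calg_hom_comp[OF A(2) tensor_map_calg_hom[OF A(1) A(1) P P l1 l1 inl_hom_PA inl_hom_PA]])
  have d2: "(\<lambda>a. tensor_map pres.PA pres.PA \<iota>\<^sub>2 \<iota>\<^sub>2 (comult B a)) \<in> calg_hom B (tensor pres.PA pres.PA)"
    by (rule calg_hom_comp[OF B(2) tensor_map_calg_hom[OF B(1) B(1) P P l2 l2 inr_hom_PA inr_hom_PA]])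
  have s1: "(\<lambda>a. \<iota>\<^sub>1 (antipode A a)) \<in> calg_hom A (opposite_alg pres.PA)"
    by (rule calg_hom_comp[OF A(4) calg_hom_opposite[OF inl_hom_PA A(1)]])
  have s2: "(\<lambda>a. \<iota>\<^sub>2 (antipode B a)) \<in> calg_hom B (opposite_alg pres.PA)"
    by (rule calg_hom_comp[OF B(4) calg_hom_opposite[OF inr_hom_PA B(1)]])
  show d: "case_sum (\<lambda>a. tensor_map pres.PA pres.PA \<iota>\<^sub>1 \<iota>\<^sub>1 (comult A a))
      (\<lambda>b. tensor_map pres.PA pres.PA \<iota>\<^sub>2 \<iota>\<^sub>2 (comult B b)) \<in> X \<rightarrow> carrier (tensor pres.PA pres.PA)"
    using calg_hom_closed[OF d1] calg_hom_closed[OF d2] by auto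
  show s: "case_sum (\<lambda>a. \<iota>\<^sub>1 (antipode A a)) (\<lambda>b. \<iota>\<^sub>2 (antipode B b)) \<in> X \<rightarrow> carrier pres.PA"
    using calg_hom_closed[OF s1] calg_hom_closed[OF s2] by auto
  fix r assume r: "r \<in> free_prod_rels A B"
  show "free_eval (tensor pres.PA pres.PA) (case_sum (\<lambda>a. tensor_map pres.PA pres.PA \<iota>\<^sub>1 \<iota>\<^sub>1 (comult A a))
      (\<lambda>b. tensor_map pres.PA pres.PA \<iota>\<^sub>2 \<iota>\<^sub>2 (comult B b))) r = \<zero>\<^bsub>tensor pres.PA pres.PA\<^esub>"
    using rels_kill_iff[OF T.calgebra_tensor d] d1 d2 r by simp
  show "free_eval complex_alg (case_sum (counit A) (counit B)) r = 0"
    using rels_kill_iff[OF calgebra_complex_alg, of "case_sum (counit A) (counit B)"] A(3) B(3) r by simp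
  show "free_eval (opposite_alg pres.PA) (case_sum (\<lambda>a. \<iota>\<^sub>1 (antipode A a)) (\<lambda>b. \<iota>\<^sub>2 (antipode B b))) r = \<zero>\<^bsub>pres.PA\<^esub>"
    using rels_kill_iff[OF calgebra_opposite[OF P], of "case_sum (\<lambda>a. \<iota>\<^sub>1 (antipode A a)) (\<lambda>b. \<iota>\<^sub>2 (antipode B b))"] s s1 s2 r
    by simp
qed

lemma P_eq: "P = FP.PH"
  by (simp add: free_prod_def Let_def)

lemma same_P: "same_alg P pres.PA"
  unfolding P_eq by (rule FP.same_PH)

lemma P_calgebra: "calgebra P" unfolding P_eq by (rule FP.calgebra_PH)
lemma P_comult_hom: "comult P \<in> calg_hom P (tensor P P)" unfolding P_eq by (rule FP.PH_comult)
lemma P_counit_hom: "counit P \<in> calg_hom P complex_alg" unfolding P_eq by (rule FP.PH_counit)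
lemma P_antipode_hom: "antipode P \<in> calg_hom P (opposite_alg P)" unfolding P_eq by (rule FP.PH_antipode)

lemma inl_hom: "\<iota>\<^sub>1 \<in> calg_hom A P" and inr_hom: "\<iota>\<^sub>2 \<in> calg_hom B P"
  using inl_hom_PA inr_hom_PA same_alg_hom(1)[OF same_alg_refl same_P] by blast+

lemma P_gen:
  assumes "a \<in> carrier A"
  shows "comult P (\<iota>\<^sub>1 a) = tensor_map P P \<iota>\<^sub>1 \<iota>\<^sub>1 (comult A a)" "counit P (\<iota>\<^sub>1 a) = counit A a"
    "antipode P (\<iota>\<^sub>1 a) = \<iota>\<^sub>1 (antipode A a)"
  using FP.PH_comult(2)[of "Inl a"] FP.PH_counit(2)[of "Inl a"] FP.PH_antipode(2)[of "Inl a"] assms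
  by (simp_all add: same_alg_tensor_map[OF same_P same_P] InlI) (simp_all add: P_eq free_prod_inl_def)

lemma P_gen':
  assumes "b \<in> carrier B"
  shows "comult P (\<iota>\<^sub>2 b) = tensor_map P P \<iota>\<^sub>2 \<iota>\<^sub>2 (comult B b)" "counit P (\<iota>\<^sub>2 b) = counit B b"
    "antipode P (\<iota>\<^sub>2 b) = \<iota>\<^sub>2 (antipode B b)"
  using FP.PH_comult(2)[of "Inr b"] FP.PH_counit(2)[of "Inr b"] FP.PH_antipode(2)[of "Inr b"] assms
  by (simp_all add: same_alg_tensor_map[OF same_P same_P] InrI) (simp_all add: P_eq free_prod_inr_def)

lemma P_universal:
  assumes C: "calgebra C" and h1: "h1 \<in> calg_hom A C" and h2: "h2 \<in> calg_hom B C"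
  obtains h where "h \<in> calg_hom P C" "\<And>a. a \<in> carrier A \<Longrightarrow> h (\<iota>\<^sub>1 a) = h1 a" "\<And>b. b \<in> carrier B \<Longrightarrow> h (\<iota>\<^sub>2 b) = h2 b"
proof -
  let ?f = "case_sum h1 h2"
  have f: "?f \<in> X \<rightarrow> carrier C" using calg_hom_closed[OF h1] calg_hom_closed[OF h2] by auto
  have k: "\<And>r. r \<in> free_prod_rels A B \<Longrightarrow> free_eval C ?f r = \<zero>\<^bsub>C\<^esub>"
    using rels_kill_iff[OF C f] h1 h2 by simp
  show ?thesis
  proof (rule that)
    show "(\<lambda>a. the_elem (free_eval C ?f ` a)) \<in> calg_hom P C"
      using pres.present_lift_hom[OF C f k] same_alg_hom(1)[OF same_P same_alg_refl] by blast
    show "a \<in> carrier A \<Longrightarrow> the_elem (free_eval C ?f ` \<iota>\<^sub>1 a) = h1 a" for a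
      using pres.present_lift_gen[OF C f k, of "Inl a"] by (simp add: free_prod_inl_def InlI)
    show "b \<in> carrier B \<Longrightarrow> the_elem (free_eval C ?f ` \<iota>\<^sub>2 b) = h2 b" for b
      using pres.present_lift_gen[OF C f k, of "Inr b"] by (simp add: free_prod_inr_def InrI)
  qed
qed

end

section \<open>Hopf subalgebras with a linear retraction\<close>

text \<open>
  The linear retraction \<open>r\<close> of \<open>f\<close> makes the map \<open>f(H) \<otimes> f(H) \<rightarrow> P \<otimes> P\<close> split injective,
  so the comultiplication of the Hopf subalgebra \<open>f(H)\<close> is well defined.
\<close>

locale hopf_embedding =
  fixes H :: "'a hopf" and P :: "'b hopf" and f :: "'a \<Rightarrow> 'b" and r :: "'b \<Rightarrow> 'a"
  assumes H: "calgebra H" and P: "calgebra P" and f: "f \<in> calg_hom H P"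
    and \<Delta>H: "comult H \<in> calg_hom H (tensor H H)" and \<epsilon>H: "counit H \<in> calg_hom H complex_alg"
    and SH: "antipode H \<in> calg_hom H (opposite_alg H)"
    and comult_f: "\<And>a. a \<in> carrier H \<Longrightarrow> comult P (f a) = tensor_map P P f f (comult H a)"
    and counit_f: "\<And>a. a \<in> carrier H \<Longrightarrow> counit P (f a) = counit H a"
    and antipode_f: "\<And>a. a \<in> carrier H \<Longrightarrow> antipode P (f a) = f (antipode H a)"
    and r: "r \<in> clin_hom P H" and rf: "\<And>a. a \<in> carrier H \<Longrightarrow> r (f a) = a"
begin

abbreviation "K \<equiv> f ` carrier H"
abbreviation "PK \<equiv> P\<lparr>carrier := K\<rparr>"
abbreviation "Q \<equiv> sub_hopf P K"

lemma subalg_K: "subalg K P"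
  by (rule subalg_image[OF f H subalg_carrier[OF H]])

lemma calgebra_PK: "calgebra PK"
  by (rule calgebra_restrict[OF P subalg_K])

lemma same_Q: "same_alg Q PK"
  by (simp add: sub_hopf_def same_alg_def)

lemma calgebra_Q: "calgebra Q"
  by (rule same_alg_calgebra[OF same_alg_sym[OF same_Q] calgebra_PK])

lemma f_PK: "f \<in> calg_hom H PK"
  using f by (auto simp: calg_hom_iff clin_hom_def)

lemma incl_PK: "(\<lambda>x. x) \<in> clin_hom PK P"
  using subalg_K by (auto simp: clin_hom_def subalg_def)

lemma fr_PK: "(\<lambda>x. f (r x)) \<in> clin_hom P PK"
  by (rule clin_hom_comp[OF r calg_hom_clin[OF f_PK]])

lemma tensor_map_f_closed:
  "t \<in> carrier (tensor H H) \<Longrightarrow> tensor_map PK PK f f t \<in> carrier (tensor PK PK)"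
  using clin_hom_closed[OF tensor_map_clin_hom[OF H H calgebra_PK calgebra_PK]] f_PK calg_hom_clin by blast

lemma incl_tensor_map_f:
  assumes "t \<in> carrier (tensor H H)"
  shows "sub_tensor_incl P (tensor_map PK PK f f t) = tensor_map P P f f t"
proof -
  interpret T: tensor_algs H H using H by unfold_locales
  note l = calg_hom_clin[OF f] calg_hom_clin[OF f_PK]
  note m1 = tensor_map_props[OF H H calgebra_PK calgebra_PK l(2) l(2)]
  note m2 = tensor_map_props[OF calgebra_PK calgebra_PK P P incl_PK incl_PK]
  note m3 = tensor_map_props[OF H H P P l(1) l(1)]
  show ?thesis
    unfolding sub_tensor_incl_def
    by (rule T.tensor_hom_unique[OF clin_hom_comp[OF m1(1) m2(1)] m3(1) _ assms])
      (simp add: m1(2) m2(2) m3(2))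
qed

text \<open>The composite of \<open>r\<close> and \<open>f\<close> fixes the image of
  \<open>f\<close> pointwise, so its tensor square undoes the inclusion on pure tensors. Forming
  this tensor square takes only linearity of \<open>r\<close>.\<close>

lemma incl_left_inverse:
  assumes "t \<in> carrier (tensor PK PK)"
  shows "tensor_map PK PK (\<lambda>x. f (r x)) (\<lambda>x. f (r x)) (sub_tensor_incl P t) = t"
proof -
  interpret T: tensor_algs PK PK using calgebra_PK by unfold_locales
  note m2 = tensor_map_props[OF calgebra_PK calgebra_PK P P incl_PK incl_PK]
  note m3 = tensor_map_props[OF P P calgebra_PK calgebra_PK fr_PK fr_PK]
  have K: "x \<in> carrier P" if "x \<in> K" for x using subalg_K that by (auto simp: subalg_def)
  show ?thesis
    unfolding sub_tensor_incl_def
    by (rule T.tensor_hom_unique[OF clin_hom_comp[OF m2(1) m3(1)] calg_hom_clin[OF calg_hom_id] _ assms])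
      (auto simp: m2(2) m3(2) K rf)
qed

text \<open>Resolves the definite description in \<open>sub_hopf\<close>: the given tensor is a
  preimage of the comultiplication by \<open>incl_tensor_map_f\<close>, and the only one by the left
  inverse.\<close>

lemma comult_Q:
  assumes a: "a \<in> carrier H"
  shows "comult Q (f a) = tensor_map PK PK f f (comult H a)"
proof -
  have d: "comult H a \<in> carrier (tensor H H)" by (rule calg_hom_closed[OF \<Delta>H a])
  show ?thesis
    unfolding sub_hopf_def
  proof (simp, rule the_equality)
    show "tensor_map PK PK f f (comult H a) \<in> carrier (tensor PK PK) \<and>
        sub_tensor_incl P (tensor_map PK PK f f (comult H a)) = comult P (f a)"
      by (simp add: tensor_map_f_closed[OF d] incl_tensor_map_f[OF d] comult_f[OF a])
    fix t assume "t \<in> carrier (tensor PK PK) \<and> sub_tensor_incl P t = comult P (f a)"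
    then show "t = tensor_map PK PK f f (comult H a)"
      by (metis incl_left_inverse incl_tensor_map_f[OF d] tensor_map_f_closed[OF d] comult_f[OF a])
  qed
qed

lemma hopf_subalgebra_K: "hopf_subalgebra K P"
  unfolding hopf_subalgebra_def
proof (intro conjI allI ballI)
  interpret P: calg P using P by (simp add: calgebra_iff_calg)
  have s: "\<ominus>\<^bsub>P\<^esub> x \<in> K" if "x \<in> K" for x
  proof -
    have "x \<in> carrier P" "(-1) \<odot>\<^bsub>P\<^esub> x \<in> K" using that subalg_K by (auto simp: subalg_def)
    then show ?thesis by (simp add: P.smult_minus_one)
  qed
  show "subring K P"
    by (rule P.subringI) (use subalg_K s in \<open>auto simp: subalg_def\<close>)
  show "c \<odot>\<^bsub>P\<^esub> h \<in> K" if "h \<in> K" for c h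
    using subalg_K that unfolding subalg_def by blast
  show "antipode P h \<in> K" if "h \<in> K" for h
    using that calg_hom_closed[OF SH] by (auto simp: antipode_f)
  show "comult P h \<in> sub_tensor_incl P ` carrier (tensor PK PK)" if h: "h \<in> K" for h
  proof -
    obtain a where a: "a \<in> carrier H" "h = f a" using h by auto
    have d: "comult H a \<in> carrier (tensor H H)" by (rule calg_hom_closed[OF \<Delta>H a(1)])
    show ?thesis
      using tensor_map_f_closed[OF d] by (simp add: a comult_f incl_tensor_map_f[OF d, symmetric])
  qed
qed

lemma f_Q: "f \<in> calg_hom H Q"
  using f_PK same_alg_hom(1)[OF same_alg_refl same_Q] by blast

text \<open>Only linear on all of \<open>P\<close>, the map \<open>r\<close> is multiplicative on
  the image of \<open>f\<close>, where it inverts the homomorphism \<open>f\<close>.\<close>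

lemma r_Q: "r \<in> calg_hom Q H"
proof -
  interpret H: calg H using H by (simp add: calgebra_iff_calg)
  have Q: "carrier Q = K" "mult Q = mult P" "one Q = one P" "add Q = add P" "smult Q = smult P"
    by (simp_all add: sub_hopf_def)
  show ?thesis
    unfolding calg_hom_iff clin_hom_def Q
    by (auto simp: rf simp flip: calg_hom_add[OF f] calg_hom_mult[OF f] calg_hom_smult[OF f] calg_hom_one[OF f])
qed

lemma comult_Q': "a \<in> carrier H \<Longrightarrow> comult Q (f a) = tensor_map Q Q f f (comult H a)"
  using comult_Q by (simp add: same_alg_tensor_map[OF same_Q same_Q])

text \<open>On \<open>Q\<close> the comultiplication is the one of \<open>H\<close> conjugated by
  \<open>f\<close> and its inverse \<open>r\<close>, hence a composite of homomorphisms. Counit and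
  antipode are handled in the same way.\<close>

lemma comult_Q_hom: "comult Q \<in> calg_hom Q (tensor Q Q)"
proof (rule calg_hom_cong[OF _ _ calgebra_Q])
  show "(\<lambda>x. tensor_map Q Q f f (comult H (r x))) \<in> calg_hom Q (tensor Q Q)"
    using tensor_map_calg_hom[OF H H calgebra_Q calgebra_Q _ _ f_Q f_Q] f_Q calg_hom_clin
    by (intro calg_hom_comp[OF calg_hom_comp[OF r_Q \<Delta>H]]) blast
  fix x assume "x \<in> carrier Q"
  then obtain a where a: "a \<in> carrier H" "x = f a" by (auto simp: sub_hopf_def)
  then show "tensor_map Q Q f f (comult H (r x)) = comult Q x" by (simp add: rf comult_Q')
qed

lemma counit_antipode_Q:
  assumes "a \<in> carrier H"
  shows "counit Q (f a) = counit H a" "antipode Q (f a) = f (antipode H a)"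
  using counit_f[OF assms] antipode_f[OF assms] by (simp_all add: sub_hopf_def)

lemma counit_Q_hom: "counit Q \<in> calg_hom Q complex_alg"
proof (rule calg_hom_cong[OF calg_hom_comp[OF r_Q \<epsilon>H] _ calgebra_Q])
  fix x assume "x \<in> carrier Q"
  then show "counit H (r x) = counit Q x" by (auto simp: sub_hopf_def rf counit_f)
qed

lemma antipode_Q_hom: "antipode Q \<in> calg_hom Q (opposite_alg Q)"
proof (rule calg_hom_cong[OF calg_hom_comp[OF calg_hom_comp[OF r_Q SH] calg_hom_opposite[OF f_Q H]] _ calgebra_Q])
  fix x assume "x \<in> carrier Q"
  then show "f (antipode H (r x)) = antipode Q x" by (auto simp: sub_hopf_def rf antipode_f)
qed

lemma f_hopf_hom: "f \<in> hopf_hom H Q"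
  by (simp add: hopf_hom_def f_Q comult_Q' counit_antipode_Q)

lemma f_bij: "bij_betw f (carrier H) (carrier Q)"
  unfolding bij_betw_def by (auto simp: sub_hopf_def intro!: inj_on_inverseI[of _ r] rf)

lemma subalg_preimage:
  assumes "subalg U P"
  shows "subalg {a \<in> carrier H. f a \<in> U} H"
proof -
  interpret H: calg H using H by (simp add: calgebra_iff_calg)
  show ?thesis
    using assms by (auto simp: subalg_def calg_hom_simps[OF f])
qed

text \<open>Instead of transporting each Hopf axiom along \<open>f\<close>, the matrix criterion is
  applied to the images of the generating matrices, for which only identities of matrices have to be
  transported.\<close>

lemma hopf_algebra_Q:
  fixes \<M> :: "('n::finite \<Rightarrow> 'n \<Rightarrow> 'a) set"
  assumes closed: "\<And>x. x \<in> \<M> \<Longrightarrow> amat H x"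
    and comult_x: "\<And>x i j. x \<in> \<M> \<Longrightarrow> comult H (x i j) = amat_comult H x i j"
    and counit_x: "\<And>x i j. x \<in> \<M> \<Longrightarrow> counit H (x i j) = (if i = j then 1 else 0)"
    and antipode_x: "\<And>x. x \<in> \<M> \<Longrightarrow> amat_mult H (amat_map (antipode H) x) x = amat_scalar H (mat 1)"
      "\<And>x. x \<in> \<M> \<Longrightarrow> amat_mult H x (amat_map (antipode H) x) = amat_scalar H (mat 1)"
    and generated: "\<And>U. subalg U H \<Longrightarrow> (\<And>x i j. x \<in> \<M> \<Longrightarrow> x i j \<in> U) \<Longrightarrow> carrier H \<subseteq> U"
  shows "hopf_algebra Q"
proof (rule hopf_algebra_of_matrices[OF calgebra_Q comult_Q_hom counit_Q_hom antipode_Q_hom, of "amat_map f ` \<M>"])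
  interpret T: tensor_algs H H using H by unfold_locales
  interpret TQ: tensor_algs Q Q using calgebra_Q by unfold_locales
  note m = amat_map_hom[OF f_Q H calgebra_Q]
  note l = calg_hom_clin[OF f_Q]
  note t = tensor_map_props[OF H H calgebra_Q calgebra_Q l l]
  fix y assume "y \<in> amat_map f ` \<M>"
  then obtain x where x: "x \<in> \<M>" "y = amat_map f x" by auto
  note c = amat_closed[OF closed[OF x(1)]]
  show "amat Q y" using closed[OF x(1)] x(2) m(1) by simp
  show "comult Q (y i j) = amat_comult Q y i j" for i j
    using c by (simp add: x(2) amat_map_def comult_Q' comult_x[OF x(1)])
      (simp add: amat_comult_def clin_hom_finsum[OF t(1) T.calgebra_tensor TQ.calgebra_tensor] t(2))
  show "counit Q (y i j) = (if i = j then 1 else 0)" for i j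
    using c by (simp add: x(2) amat_map_def counit_antipode_Q counit_x[OF x(1)])
  have S: "amat_map (antipode Q) y = amat_map f (amat_map (antipode H) x)"
    using c by (simp add: x(2) amat_map_def counit_antipode_Q)
  have Sx: "amat H (amat_map (antipode H) x)"
    using c calg_hom_closed[OF SH] by (simp add: amat_def amat_map_def)
  show "amat_mult Q (amat_map (antipode Q) y) y = amat_scalar Q (mat 1)"
    "amat_mult Q y (amat_map (antipode Q) y) = amat_scalar Q (mat 1)"
    using closed[OF x(1)] Sx
    by (simp_all add: S, simp_all add: x(2) m(2)[symmetric] m(3)[symmetric] antipode_x[OF x(1)])
next
  fix U assume U: "subalg U Q" "\<And>y i j. y \<in> amat_map f ` \<M> \<Longrightarrow> y i j \<in> U"
  have "subalg U P"
    using U(1) subalg_K by (auto simp: subalg_def sub_hopf_def)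
  from generated[OF subalg_preimage[OF this]] have "carrier H \<subseteq> {a \<in> carrier H. f a \<in> U}"
    using U(2) amat_closed[OF closed] by (force simp: amat_map_def)
  then show "carrier Q \<subseteq> U" by (auto simp: sub_hopf_def)
qed

end

section \<open>The isomorphism\<close>

locale glued =
  fixes E :: "complex^'n::finite^'n"
  assumes inv_E: "invertible E"
begin

abbreviation "F \<equiv> transpose E ** matrix_inv E"

sublocale B: B_setup E
  using inv_E by unfold_locales

lemma E_transpose: "transpose E ** transpose B.E' = mat 1" "transpose B.E' ** transpose E = mat 1"
  using B.EE' by (simp_all add: transpose_mat flip: matrix_transpose_mul)

lemma F_inverse: "F ** (E ** transpose B.E') = mat 1" "(E ** transpose B.E') ** F = mat 1"
proof -
  have "F ** (E ** transpose B.E') = transpose E ** (B.E' ** E) ** transpose B.E'"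
    "(E ** transpose B.E') ** F = E ** (transpose B.E' ** transpose E) ** B.E'"
    by (simp_all only: matrix_mul_assoc)
  then show "F ** (E ** transpose B.E') = mat 1" "(E ** transpose B.E') ** F = mat 1"
    by (simp_all add: B.EE' E_transpose)
qed

sublocale H: H_setup F
  using F_inverse by unfold_locales (auto simp: invertible_def)

text \<open>The value of \<open>matrix_inv\<close> is a choice. Uniqueness of inverses pins it down
  to the explicit matrix that occurs in \<open>Hrel_of_Brel\<close> and
  \<open>Brel_blocks\<close>.\<close>

lemma F'_eq: "H.F' = E ** transpose B.E'"
proof -
  have "H.F' = H.F' ** (F ** (E ** transpose B.E'))" by (simp add: F_inverse)
  also have "\<dots> = H.F' ** F ** (E ** transpose B.E')" by (simp only: matrix_mul_assoc)
  finally show ?thesis by (simp add: H.FF')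
qed

sublocale FP: free_product B.B CZ2_hopf
  by unfold_locales
    (rule B.B_calgebra B.B_comult_hom B.B_counit_hom B.B_antipode_hom
      group_hopf_props(1,3-5)[OF group_integer_mod_group[of 2], folded CZ2_hopf_def])+

abbreviation "P \<equiv> free_prod B.B CZ2_hopf"
abbreviation "xP \<equiv> amat_map FP.\<iota>\<^sub>1 B.x"
abbreviation "g \<equiv> FP.\<iota>\<^sub>2 CZ2_gen"

sublocale P: calg P
  using FP.P_calgebra by (simp add: calgebra_iff_calg)

sublocale HA: calg H.H
  using H.H_calgebra by (simp add: calgebra_iff_calg)

sublocale BA: calg B.B
  using B.B_calgebra by (simp add: calgebra_iff_calg)

sublocale TP: tensor_algs P P
  using FP.P_calgebra by unfold_locales

lemma xP: "Brel P E B.E' xP"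
  by (rule Brel_map[OF FP.inl_hom B.B_calgebra FP.P_calgebra B.B_Brel])

lemmas x_closed = BA.Brel_simps(1)[OF B.B_Brel, THEN amat_closed]
lemmas xP_closed = P.Brel_simps(1)[OF xP, THEN amat_closed]

lemma g: "g \<in> carrier P" "g \<otimes>\<^bsub>P\<^esub> g = \<one>\<^bsub>P\<^esub>"
  using calg_hom_closed[OF FP.inr_hom CZ2_gen_closed] calg_hom_mult[OF FP.inr_hom CZ2_gen_closed CZ2_gen_closed]
    calg_hom_one[OF FP.inr_hom] CZ2_gen_square by simp_all

definition y :: "'n \<Rightarrow> 'n \<Rightarrow> _" where "y = (\<lambda>i j. xP i j \<otimes>\<^bsub>P\<^esub> g)"

definition z :: "'n \<Rightarrow> 'n \<Rightarrow> _" where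
  "z = amat_mult P (amat_mult P (amat_scalar P (transpose E)) (\<lambda>i j. g \<otimes>\<^bsub>P\<^esub> xP i j)) (amat_scalar P (transpose B.E'))"

lemma yz: "Hrel P F H.F' y z"
  unfolding F'_eq y_def z_def by (rule P.Hrel_of_Brel[OF xP B.EE' g])

text \<open>Since g is group-like, multiplying the entries of x by g on the right multiplies each
  summand of the comultiplication by g \<otimes> g, and the matrix form survives.\<close>

lemma y_comult: "comult P (y i j) = amat_comult P y i j"
proof -
  interpret TB: tensor_algs B.B B.B using B.B_calgebra by unfold_locales
  interpret t: calg "tensor P P" using TP.calgebra_tensor by (simp add: calgebra_iff_calg)
  note l = calg_hom_clin[OF FP.inl_hom] and l' = calg_hom_clin[OF FP.inr_hom]
  note m = tensor_map_props[OF B.B_calgebra B.B_calgebra FP.P_calgebra FP.P_calgebra l l]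
  note m' = tensor_map_props[OF FP.B(1) FP.B(1) FP.P_calgebra FP.P_calgebra l' l']
  have "comult P (xP i j) = tensor_map P P FP.\<iota>\<^sub>1 FP.\<iota>\<^sub>1 (comult B.B (B.x i j))"
    by (simp add: amat_map_def FP.P_gen(1) x_closed)
  also have "\<dots> = finsum (tensor P P) (\<lambda>k. pure_tensor P P (xP i k) (xP k j)) UNIV"
    unfolding B.B_comult_gen amat_comult_def
    by (simp add: clin_hom_finsum[OF m(1) TB.calgebra_tensor TP.calgebra_tensor] m(2) x_closed amat_map_def)
  finally have 1: "comult P (xP i j) = finsum (tensor P P) (\<lambda>k. pure_tensor P P (xP i k) (xP k j)) UNIV" .
  have 2: "comult P g = pure_tensor P P g g"
    using FP.P_gen'(1)[OF CZ2_gen_closed] by (simp add: CZ2_gen_comult m'(2) CZ2_gen_closed)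
  have "comult P (y i j) = comult P (xP i j) \<otimes>\<^bsub>tensor P P\<^esub> comult P g"
    unfolding y_def by (rule calg_hom_mult[OF FP.P_comult_hom xP_closed g(1)])
  also have "\<dots> = finsum (tensor P P) (\<lambda>k. pure_tensor P P (xP i k) (xP k j) \<otimes>\<^bsub>tensor P P\<^esub> pure_tensor P P g g) UNIV"
    unfolding 1 2 using g xP_closed by (intro t.finsum_ldistr) auto
  also have "\<dots> = amat_comult P y i j"
    using g xP_closed by (simp add: TP.pure_mult amat_comult_def y_def)
  finally show ?thesis .
qed

lemma y_counit: "counit P (y i j) = (if i = j then 1 else 0)"
  using calg_hom_mult[OF FP.P_counit_hom xP_closed g(1), of i j]
  by (simp add: y_def amat_map_def FP.P_gen(2) FP.P_gen'(2) CZ2_gen_closed CZ2_gen_counit x_closed B.B_counit_gen)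

text \<open>The antipode turns x_ij g into g times the (i, j) entry of E' x^t E. That matrix is a
  right inverse of \<open>y\<close> because the two copies of g cancel, and the transpose of
  \<open>z\<close> is a left inverse, so they agree without expanding \<open>z\<close>.\<close>

lemma y_antipode: "amat_map (antipode P) y = amat_transpose z"
proof -
  let ?w = "amat_twist P B.E' xP E"
  have w: "amat P ?w" using P.Brel_simps(1)[OF xP] by (simp add: amat_twist_def)
  have "antipode P (y i j) = g \<otimes>\<^bsub>P\<^esub> ?w i j" for i j
  proof -
    have "antipode P (y i j) = antipode P g \<otimes>\<^bsub>P\<^esub> antipode P (xP i j)"
      using calg_hom_mult[OF FP.P_antipode_hom xP_closed g(1), of i j] by (simp add: y_def)
    moreover have "antipode P g = g"
      by (simp add: FP.P_gen'(3) CZ2_gen_closed CZ2_gen_antipode)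
    moreover have "antipode P (xP i j) = ?w i j"
      using fun_cong[OF fun_cong[OF amat_map_twist[OF FP.inl_hom B.B_calgebra FP.P_calgebra
              BA.Brel_simps(1)[OF B.B_Brel], of B.E' E]], of i j]
      by (simp add: amat_map_def FP.P_gen(3) x_closed B.B_antipode_gen)
    ultimately show ?thesis by simp
  qed
  then have S: "amat_map (antipode P) y = (\<lambda>i j. g \<otimes>\<^bsub>P\<^esub> ?w i j)"
    by (simp add: amat_map_def)
  have c: "amat P (\<lambda>i j. g \<otimes>\<^bsub>P\<^esub> ?w i j)" using amat_closed[OF w] g by (simp add: amat_def)
  have gg: "y i k \<otimes>\<^bsub>P\<^esub> (g \<otimes>\<^bsub>P\<^esub> ?w k j) = xP i k \<otimes>\<^bsub>P\<^esub> ?w k j" for i j k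
  proof -
    have "y i k \<otimes>\<^bsub>P\<^esub> (g \<otimes>\<^bsub>P\<^esub> ?w k j) = xP i k \<otimes>\<^bsub>P\<^esub> ((g \<otimes>\<^bsub>P\<^esub> g) \<otimes>\<^bsub>P\<^esub> ?w k j)"
      using xP_closed[of i k] g(1) amat_closed[OF w, of k j] by (simp add: y_def P.m_assoc)
    then show ?thesis using amat_closed[OF w, of k j] by (simp add: g(2))
  qed
  have "amat_mult P y (\<lambda>i j. g \<otimes>\<^bsub>P\<^esub> ?w i j) = amat_mult P xP ?w"
    by (simp add: amat_mult_def[of P y] amat_mult_def[of P xP] gg)
  also have "\<dots> = amat_scalar P (mat 1)"
    using P.Brel_iff[OF P.Brel_simps(1)[OF xP] B.EE'] xP by simp
  finally have "amat_mult P y (\<lambda>i j. g \<otimes>\<^bsub>P\<^esub> ?w i j) = amat_scalar P (mat 1)" .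
  then have "(\<lambda>i j. g \<otimes>\<^bsub>P\<^esub> ?w i j) = amat_transpose z"
    using P.amat_inverse_unique[OF P.Hrel_simps(1)[OF yz] c _ _ P.Hrel_simps(4)[OF yz]] P.Hrel_simps(2)[OF yz]
    by simp
  with S show ?thesis by simp
qed

text \<open>
  The retraction: \<open>P\<close> maps to the \<open>2 \<times> 2\<close> matrices over \<open>\<H>(F)\<close> with \<open>g\<close> going to the swap and \<open>x\<close>
  to an off-diagonal matrix, such that the image of \<open>f(a)\<close> is diagonal with upper left entry \<open>a\<close>.
\<close>

lemma retraction:
  assumes f: "f \<in> calg_hom H.H P" and fu: "amat_map f H.u = y" and fv: "amat_map f H.v = z"
  obtains r where "r \<in> clin_hom P H.H" "\<And>a. a \<in> carrier H.H \<Longrightarrow> r (f a) = a"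
proof -
  let ?M = "mat_alg H.H" and ?sc = "amat_scalar H.H" and ?u = H.u and ?v = H.v
  have M: "calgebra ?M" by (rule HA.calgebra_mat_alg)
  interpret M: calg ?M using M by (simp add: calgebra_iff_calg)
  \<comment> \<open>Solving v = E^t (g x) E'^t for g x gives this matrix. As g u g = g x for u = x
    g, it is the conjugate of u by g expressed inside H(F).\<close>
  let ?w = "amat_mult H.H (amat_mult H.H (?sc (transpose B.E')) ?v) (?sc (transpose E))"
  let ?swap = "\<lambda>p q. if p = q then \<zero>\<^bsub>H.H\<^esub> else \<one>\<^bsub>H.H\<^esub>"
  note uv = HA.Hrel_simps[OF H.H_Hrel]
  have w: "amat H.H ?w" using uv by simp
  have "Brel ?M E B.E' (HA.blocks False ?u ?w)"
    using H.H_Hrel unfolding F'_eq by (rule HA.Brel_blocks) (rule B.EE')+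
  from B.B_universal[OF M this] obtain h1 where h1: "h1 \<in> calg_hom B.B ?M" "amat_map h1 B.x = HA.blocks False ?u ?w" .
  have bool_sum: "finsum H.H k UNIV = k True \<oplus>\<^bsub>H.H\<^esub> k False" if "\<And>b. k b \<in> carrier H.H" for k
    using that by (simp add: UNIV_bool HA.finsum_insert HA.a_comm)
  have swap: "?swap \<in> carrier ?M" by (simp add: amat_def)
  have mult_swap: "amat_mult H.H N ?swap = (\<lambda>p q. N p (\<not> q))" "amat_mult H.H ?swap N = (\<lambda>p q. N (\<not> p) q)"
    if "amat H.H N" for N :: "bool \<Rightarrow> bool \<Rightarrow> _"
  proof -
    have "amat_mult H.H N ?swap p q = N p (\<not> q)" for p q
      using amat_closed[OF that] by (cases q) (simp_all add: amat_mult_def bool_sum)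
    moreover have "amat_mult H.H ?swap N p q = N (\<not> p) q" for p q
      using amat_closed[OF that] by (cases p) (simp_all add: amat_mult_def bool_sum)
    ultimately show "amat_mult H.H N ?swap = (\<lambda>p q. N p (\<not> q))" "amat_mult H.H ?swap N = (\<lambda>p q. N (\<not> p) q)"
      by (simp_all add: fun_eq_iff)
  qed
  have "?swap \<otimes>\<^bsub>?M\<^esub> ?swap = \<one>\<^bsub>?M\<^esub>"
    using mult_swap(1)[of ?swap] swap by (auto simp: amat_scalar_def mat_def intro!: ext)
  from CZ2_universal[OF M swap this] obtain h2 where h2: "h2 \<in> calg_hom CZ2_hopf ?M" "h2 CZ2_gen = ?swap" .
  from FP.P_universal[OF M h1(1) h2(1)] obtain \<pi> where \<pi>: "\<pi> \<in> calg_hom P ?M"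
    "\<And>a. a \<in> carrier B.B \<Longrightarrow> \<pi> (FP.\<iota>\<^sub>1 a) = h1 a" "\<And>b. b \<in> carrier CZ2_hopf \<Longrightarrow> \<pi> (FP.\<iota>\<^sub>2 b) = h2 b"
    by blast
  have \<pi>x: "\<pi> (xP i j) = HA.blocks False ?u ?w i j" for i j
    using \<pi>(2)[OF x_closed, of i j] h1(2) by (simp add: amat_map_def fun_eq_iff)
  have \<pi>g: "\<pi> g = ?swap" using \<pi>(3)[OF CZ2_gen_closed] h2(2) by simp
  have bl: "amat H.H (HA.blocks False ?u ?w i j)" for i j
    using amat_closed[OF HA.blocks_closed[OF uv(1) w]] by simp
  \<comment> \<open>Right multiplication by the swap exchanges columns and moves the antidiagonal
    blocks onto the diagonal, each staying in its row.\<close>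
  have "\<pi> (y i j) = HA.blocks True ?u ?w i j" for i j
  proof -
    have "\<pi> (y i j) = amat_mult H.H (\<pi> (xP i j)) (\<pi> g)"
      unfolding y_def using calg_hom_mult[OF \<pi>(1) xP_closed g(1)] by simp
    also have "\<dots> = HA.blocks True ?u ?w i j"
      unfolding \<pi>x \<pi>g mult_swap(1)[OF bl] by (simp add: HA.blocks_def fun_eq_iff)
    finally show ?thesis .
  qed
  then have \<pi>y: "amat_map \<pi> y = HA.blocks True ?u ?w"
    by (simp add: amat_map_def[of \<pi>] fun_eq_iff)
  \<comment> \<open>Left multiplication exchanges rows instead, so this time \<open>?w\<close>
    becomes the upper left block.\<close>
  have "\<pi> (g \<otimes>\<^bsub>P\<^esub> xP i j) = HA.blocks True ?w ?u i j" for i j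
  proof -
    have "\<pi> (g \<otimes>\<^bsub>P\<^esub> xP i j) = amat_mult H.H (\<pi> g) (\<pi> (xP i j))"
      using calg_hom_mult[OF \<pi>(1) g(1) xP_closed] by simp
    also have "\<dots> = HA.blocks True ?w ?u i j"
      unfolding \<pi>x \<pi>g mult_swap(2)[OF bl] by (simp add: HA.blocks_def fun_eq_iff)
    finally show ?thesis .
  qed
  then have \<pi>gx: "amat_map \<pi> (\<lambda>i j. g \<otimes>\<^bsub>P\<^esub> xP i j) = HA.blocks True ?w ?u"
    by (simp add: amat_map_def[of \<pi>] fun_eq_iff)
  note m = amat_map_hom[OF \<pi>(1) FP.P_calgebra M]
  have gx: "amat P (\<lambda>i j. g \<otimes>\<^bsub>P\<^esub> xP i j)" using g xP_closed by (simp add: amat_def)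
  \<comment> \<open>The scalar factors in \<open>z\<close> undo those in \<open>?w\<close>, so the
    upper left block of the image of \<open>z\<close> is v. Of the lower right block
    \<open>t\<close> only membership in the algebra is recorded.\<close>
  have "amat_mult H.H (?sc (transpose E)) (amat_mult H.H ?w (?sc (transpose B.E'))) = ?v"
    using uv(1,2) by (simp add: HA.amat_mult_assoc HA.amat_scalar_mult_left HA.amat_scalar_mult
        HA.amat_scalar_one E_transpose)
  then obtain t where \<pi>z: "amat_map \<pi> z = HA.blocks True ?v t" and t: "amat H.H t"
    using gx uv(1) w
    by (simp add: z_def m(2,3) \<pi>gx HA.blocks_scalar HA.blocks_mult HA.amat_mult_assoc)
  \<comment> \<open>The vanishing off-diagonal entries are carried along because the upper left
    entry is multiplicative on diagonal matrices; with them the set is closed under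
    products.\<close>
  let ?S = "{a \<in> carrier H.H. \<pi> (f a) True True = a \<and> \<pi> (f a) True False = \<zero>\<^bsub>H.H\<^esub> \<and> \<pi> (f a) False True = \<zero>\<^bsub>H.H\<^esub>}"
  have \<pi>f: "(\<lambda>a. \<pi> (f a)) \<in> calg_hom H.H ?M" by (rule calg_hom_comp[OF f \<pi>(1)])
  have \<pi>fc: "\<pi> (f a) p q \<in> carrier H.H" if "a \<in> carrier H.H" for a p q
    using calg_hom_closed[OF \<pi>f that] by (simp add: amat_def)
  have "carrier H.H \<subseteq> ?S"
  proof (rule H.H_induct)
    show "subalg ?S H.H"
      unfolding subalg_def
      using \<pi>fc
      by (auto simp: calg_hom_add[OF \<pi>f] calg_hom_mult[OF \<pi>f] calg_hom_smult[OF \<pi>f] calg_hom_one[OF \<pi>f]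
          amat_scalar_def mat_def amat_mult_def bool_sum)
    have "\<pi> (f (?u i j)) = HA.blocks True ?u ?w i j" "\<pi> (f (?v i j)) = HA.blocks True ?v t i j" for i j
      using \<pi>y \<pi>z by (simp_all add: amat_map_def fun_eq_iff flip: fu fv)
    then show "?u i j \<in> ?S" "?v i j \<in> ?S" for i j
      using amat_closed[OF uv(1)] amat_closed[OF uv(2)] by (simp_all add: HA.blocks_def)
  qed
  then have "\<pi> (f a) True True = a" if "a \<in> carrier H.H" for a using that by auto
  moreover have "(\<lambda>p. \<pi> p True True) \<in> clin_hom P H.H"
    by (rule clin_hom_comp[OF calg_hom_clin[OF \<pi>(1)] HA.mat_alg_entry_hom])
  ultimately show ?thesis using that by blast
qed

lemma hopf_isomorphic_glued: "hopf_isomorphic H.H (glued_free_prod E)"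
proof -
  obtain f where f: "f \<in> calg_hom H.H P" "amat_map f H.u = y" "amat_map f H.v = z"
    using H.H_universal[OF FP.P_calgebra yz] by blast
  obtain r where r: "r \<in> clin_hom P H.H" "\<And>a. a \<in> carrier H.H \<Longrightarrow> r (f a) = a"
    using retraction[OF f] by blast
  note uv = HA.Hrel_simps[OF H.H_Hrel]
  note uc = amat_closed[OF uv(1)] and vc = amat_closed[OF uv(2)]
  have fu: "f (H.u i j) = y i j" and fv: "f (H.v i j) = z i j" for i j
    unfolding f(2)[symmetric] f(3)[symmetric] amat_map_def by simp_all
  interpret TH: tensor_algs H.H H.H using H.H_calgebra by unfold_locales
  note l = calg_hom_clin[OF f(1)]
  note m = tensor_map_props[OF H.H_calgebra H.H_calgebra FP.P_calgebra FP.P_calgebra l l]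
  \<comment> \<open>Each compatibility compares two algebra homomorphisms out of H(F), for the
    antipode with values in the opposite algebra of \<open>P\<close>. By \<open>H_hom_unique\<close>
    agreement on the entries of u decides it.\<close>
  interpret emb: hopf_embedding H.H P f r
  proof
    fix a assume a: "a \<in> carrier H.H"
    show "comult P (f a) = tensor_map P P f f (comult H.H a)"
    proof (rule H.H_hom_unique[OF TP.calgebra_tensor calg_hom_comp[OF f(1) FP.P_comult_hom]
          calg_hom_comp[OF H.H_comult_hom m(3)[OF f(1) f(1)]] _ a])
      show "amat_map (\<lambda>a. comult P (f a)) H.u = amat_map (\<lambda>a. tensor_map P P f f (comult H.H a)) H.u"
        using uc by (auto simp: amat_map_def fu y_comult H.H_comult_gen amat_comult_def m(2)
            clin_hom_finsum[OF m(1) TH.calgebra_tensor TP.calgebra_tensor] intro!: ext)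
    qed
    show "counit P (f a) = counit H.H a"
    proof (rule H.H_hom_unique[OF calgebra_complex_alg calg_hom_comp[OF f(1) FP.P_counit_hom] H.H_counit_hom _ a])
      show "amat_map (\<lambda>a. counit P (f a)) H.u = amat_map (counit H.H) H.u"
        by (simp add: amat_map_def fu y_counit H.H_counit_gen)
    qed
    show "antipode P (f a) = f (antipode H.H a)"
    proof (rule H.H_hom_unique[OF calgebra_opposite[OF FP.P_calgebra] calg_hom_comp[OF f(1) FP.P_antipode_hom]
          calg_hom_comp[OF H.H_antipode_hom calg_hom_opposite[OF f(1) H.H_calgebra]] _ a])
      have "amat_map (\<lambda>a. antipode P (f a)) H.u = amat_map (antipode P) y"
        by (simp add: amat_map_def fu)
      moreover have "amat_map (\<lambda>a. f (antipode H.H a)) H.u = amat_map f (amat_map (antipode H.H) H.u)"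
        by (simp add: amat_map_def)
      ultimately show "amat_map (\<lambda>a. antipode P (f a)) H.u = amat_map (\<lambda>a. f (antipode H.H a)) H.u"
        by (simp add: y_antipode H.H_antipode_gen amat_map_transpose f(3))
    qed
  qed (use H.H_calgebra FP.P_calgebra f r H.H_comult_hom H.H_counit_hom H.H_antipode_hom in auto)
  have "hopf_generated P {y i j | i j. True} = emb.K"
    unfolding hopf_generated_def
  proof (rule antisym)
    have "y i j \<in> emb.K" for i j using uc by (metis fu image_eqI)
    then have "emb.K \<in> {H. hopf_subalgebra H P \<and> {y i j | i j. True} \<subseteq> H}"
      using emb.hopf_subalgebra_K by blast
    then show "\<Inter>{H. hopf_subalgebra H P \<and> {y i j | i j. True} \<subseteq> H} \<subseteq> emb.K"
      by (rule Inter_lower)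
    \<comment> \<open>A Hopf subalgebra containing the entries of \<open>y\<close> also contains
      their antipodes, the entries of \<open>z\<close>. Its preimage under f is then a subalgebra
      containing all u_ij and v_ij, hence everything.\<close>
    show "emb.K \<subseteq> \<Inter>{H. hopf_subalgebra H P \<and> {y i j | i j. True} \<subseteq> H}"
    proof (rule Inter_greatest)
      fix L assume "L \<in> {H. hopf_subalgebra H P \<and> {y i j | i j. True} \<subseteq> H}"
      then have L: "hopf_subalgebra L P" and yL: "y i j \<in> L" for i j by auto
      have "subalg L P"
        using L subringE[of L P] by (simp add: hopf_subalgebra_def subalg_def)
      note pre = emb.subalg_preimage[OF this]
      have "antipode P (y i j) \<in> L" for i j using L yL by (simp add: hopf_subalgebra_def)
      moreover have "antipode P (y i j) = z j i" for i j
        using y_antipode by (simp add: amat_map_def amat_transpose_def fun_eq_iff)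
      ultimately have zL: "z i j \<in> L" for i j by metis
      have "carrier H.H \<subseteq> {a \<in> carrier H.H. f a \<in> L}"
        by (rule H.H_induct[OF pre]) (simp_all add: uc vc fu fv yL zL)
      then show "emb.K \<subseteq> L" by auto
    qed
  qed
  then have Q: "glued_free_prod E = emb.Q"
    by (simp add: glued_free_prod_def Let_def y_def amat_map_def)
  have "hopf_algebra emb.Q"
  proof (rule emb.hopf_algebra_Q[of "{H.u, H.v}"])
    show "\<And>x. x \<in> {H.u, H.v} \<Longrightarrow> amat H.H x" using uv(1,2) by blast
  qed (use H.H_comult_gen H.H_counit_gen H.H_antipode_laws H.H_induct in auto)
  then show ?thesis
    unfolding hopf_isomorphic_def Q using H.hopf_algebra_H emb.f_hopf_hom emb.f_bij by blast
qed

end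

theorem theorem4p11:
  fixes E :: "complex^'n::finite^'n"
  assumes "CARD('n) \<ge> 2"
    and "invertible E"
    and "generic (transpose E ** matrix_inv E)"
  shows "hopf_isomorphic (H_hopf (transpose E ** matrix_inv E)) (glued_free_prod E)"
proof -
  interpret glued E using assms(2) by unfold_locales
  show ?thesis by (rule hopf_isomorphic_glued)
qed

end
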